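(* Let $r\ge 3$ be an integer. Then the following hold. (1) If $c=1$, then there exist infinitely many $k\in\mathbb{N}$ such that $$g^k_{1,r}=2-o_r(1),$$ where $o_r(1)$ denotes a quantity bounded in absolute value by some $\varepsilon(r)$, depending only on $r$, with $\varepsilon(r)\to 0$ as $r\to\infty$. (2) If $c\ge(2r)^{1/(r-1)}$, then for infinitely many $k\in\mathbb{N}$, namely for $k=2^s r$ with $s\ge 1$ an integer, the exact value of $g^k_{c,r}$ is $$g^k_{c,r}=\frac{r!}{c\,k^{r}}\left(\binom{ck}{r}+\binom{k}{r}-\frac12\sum_{i=0}^{\infty}\binom{k/2^i}{r}\right).$$ Moreover, for all sufficiently large $k\gg r$ (that is, $k$ sufficiently large in terms of $r$), $$g^k_{c,r}=c^{r-1}+\frac{1}{2c}\left(1-\frac{1}{2^r-1}\right)-O_r\!\left(\frac1k\right),$$ where $O_r(1/k)$ denotes a quantity whose absolute value is at most $C_r/k$ with $C_r$ depending only on $r$.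
   Context: An $r$-uniform hypergraph $H$ has a finite vertex set $V(H)$ and an edge set $E(H)$ consisting of $r$-element subsets of $V(H)$; $e(H)=|E(H)|$. A subgraph of $H$ is an $r$-uniform hypergraph $H'$ with $V(H')\subseteq V(H)$ and $E(H')\subseteq E(H)$. $H$ is connected if for any $x,y\in V(H)$ there is a sequence $x=a_0,a_1,\dots,a_s=y$ of vertices such that each pair $\{a_{i-1},a_i\}$ is contained in a common edge. Deleting a set of vertices removes these vertices and every edge containing at least one of them. $H$ is $(k+1)$-connected if it remains connected after the deletion of any $k$ vertices; a $(k+1)$-connected hypergraph is understood to have at least $k+2$ vertices. For real $c\ge 0$, $\mathcal{F}_{c,r}(n,k)$ is the family of $n$-vertex $r$-uniform hypergraphs containing no $(k+1)$-connected subgraph on more than $ck+k$ vertices. The surplus is $$f_{c,r}(n,k)=\max_{H\in\mathcal{F}_{c,r}(n,k)}e(H)-\binom{n}{r}+\binom{n-k}{r},$$ the relative surplus is, for $n>k$, $g_{c,r}(n,k)=\dfrac{r!\cdot f_{c,r}(n,k)}{k^{r-1}(n-k)}$, and $g^k_{c,r}:=\lim_{n\to\infty}g_{c,r}(n,k)$ (this limit exists for all $k\ge r\ge 2$ and $c\ge 0$). Extended binomial coefficients: for real $x$, $\binom{x}{r}=\frac{x(x-1)\cdots(x-r+1)}{r!}$ if $x\ge r-1$ and $\binom{x}{r}=0$ if $x<r-1$.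
   Formalization: In (2) the exact formula is stated only when ck is an integer (it fails otherwise, as g depends on c only through the floor of ck), and the asymptotic error is bounded by C_r c^(r-2)/k instead of C_r/k, which fails as c tends to infinity. *)

theory Defs
  imports Complex_Main
begin

record 'a hypergraph =
  verts :: "'a set"
  edges :: "'a set set"

definition uniform_hypergraph :: "nat \<Rightarrow> 'a hypergraph \<Rightarrow> bool" where
  "uniform_hypergraph r H \<longleftrightarrow>
     finite (verts H) \<and> (\<forall>e\<in>edges H. e \<subseteq> verts H \<and> card e = r)"

definition subgraph :: "nat \<Rightarrow> 'a hypergraph \<Rightarrow> 'a hypergraph \<Rightarrow> bool" where
  "subgraph r H' H \<longleftrightarrow>
     uniform_hypergraph r H' \<and> verts H' \<subseteq> verts H \<and> edges H' \<subseteq> edges H"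

definition connected_hypergraph :: "'a hypergraph \<Rightarrow> bool" where
  "connected_hypergraph H \<longleftrightarrow>
     (\<forall>x\<in>verts H. \<forall>y\<in>verts H. \<exists>(a :: nat \<Rightarrow> 'a) s.
        a 0 = x \<and> a s = y \<and> (\<forall>i\<le>s. a i \<in> verts H) \<and>
        (\<forall>i\<in>{1..s}. \<exists>e\<in>edges H. {a (i - 1), a i} \<subseteq> e))"

definition delete_verts :: "'a hypergraph \<Rightarrow> 'a set \<Rightarrow> 'a hypergraph" where
  "delete_verts H S = \<lparr>verts = verts H - S, edges = {e \<in> edges H. e \<inter> S = {}}\<rparr>"

text \<open>\<open>vertex_connected k H\<close> says that \<open>H\<close> is \<open>(k+1)\<close>-connected.\<close>

definition vertex_connected :: "nat \<Rightarrow> 'a hypergraph \<Rightarrow> bool" where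
  "vertex_connected k H \<longleftrightarrow>
     card (verts H) \<ge> k + 2 \<and>
     (\<forall>S\<subseteq>verts H. card S = k \<longrightarrow> connected_hypergraph (delete_verts H S))"

text \<open>Vertices are natural numbers; every finite hypergraph has such an isomorphic copy, so this
  does not affect the maximum below.\<close>

definition hyp_family :: "real \<Rightarrow> nat \<Rightarrow> nat \<Rightarrow> nat \<Rightarrow> nat hypergraph set" where
  "hyp_family c r n k =
     {H. uniform_hypergraph r H \<and> card (verts H) = n \<and>
         \<not> (\<exists>H'. subgraph r H' H \<and> vertex_connected k H' \<and>
                real (card (verts H')) > c * real k + real k)}"

definition surplus :: "real \<Rightarrow> nat \<Rightarrow> nat \<Rightarrow> nat \<Rightarrow> real" where
  "surplus c r n k =
     real (Max ((\<lambda>H. card (edges H)) ` hyp_family c r n k))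
       - real (n choose r) + real ((n - k) choose r)"

definition rel_surplus :: "real \<Rightarrow> nat \<Rightarrow> nat \<Rightarrow> nat \<Rightarrow> real" where
  "rel_surplus c r n k =
     fact r * surplus c r n k / (real k ^ (r - 1) * (real n - real k))"

definition lim_rel_surplus :: "real \<Rightarrow> nat \<Rightarrow> nat \<Rightarrow> real" where
  "lim_rel_surplus c r k = lim (\<lambda>n. rel_surplus c r n k)"

text \<open>Unlike \<open>x gchoose r\<close>, the extended binomial coefficient vanishes for \<open>x < r - 1\<close>.\<close>

definition ext_binomial :: "real \<Rightarrow> nat \<Rightarrow> real" where
  "ext_binomial x r = (if x \<ge> real r - 1 then x gchoose r else 0)"

end

theory Submission
  imports Defs "HOL-Analysis.Analysis" "HOL-Library.Ramsey"
begin

text \<open>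
  An \<open>n\<close>-vertex hypergraph of the family with more than \<open>ck + k\<close> vertices has a separator \<open>T\<close> of size \<open>k\<close>;
  edges meeting \<open>T\<close> are unrestricted, so the surplus of the whole is the sum of the surpluses of the two
  sides plus the number of edges missing inside \<open>T\<close>. Gluing copies along a common \<open>k\<close>-set makes the
  surplus superadditive in \<open>n - k\<close>, so the limit is a supremum.

  Repeated splitting gives a tree whose leaves have at most \<open>ck + k\<close> vertices. If the leaves are complete,
  a separator spread over \<open>p\<close> leaves on the smaller side misses at most
  \<open>binom k r - p binom (k/p) r\<close> edges by convexity, and the sum of these gains over the tree is largest for
  the balanced binary tree, which yields \<open>binom k r - 1/2 (\<Sum>i. binom (k/2^i) r)\<close> per leaf. The condition
  \<open>c^(r-1) \<ge> 2r\<close> makes leaves with few vertices unprofitable. For the matching lower bound a hypergraph is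
  repeatedly doubled along a \<open>k\<close>-set chosen evenly from all of its leaves.

  For \<open>c = 1\<close> each leaf and each separator contributes at most \<open>binom k r\<close>, so the relative surplus is at
  most 2. Two leaves of sizes \<open>2k\<close> and \<open>k + q\<close> with \<open>q\<close> about \<open>k / sqrt r\<close>, copied along a \<open>k\<close>-set with
  \<open>k - q\<close> vertices in the first and \<open>q\<close> in the second, come close to this.
\<close>

section \<open>Hypergraphs without large highly connected subgraphs\<close>

text \<open>The obstacle is that separators may split the tree unevenly and that leaves overlap and
  vary in size. Leaves are therefore replaced by disjoint pieces plus some loose vertices. A merge
  of \<open>p1 \<le> p2\<close> pieces gains at most G(p1) = binom k r - p1 binom (k/p1) r, a
  function of the smaller number only. The reserve \<open>psi\<close> solves psi(2p) = 2 psi(p) -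
  G(p) and is concave in p, hence psi(p1 + p2) \<le> psi(p1) + psi(p2) - G(p1): unbalanced merges
  never beat balanced ones, and psi(1) is the total gain per leaf. A loose vertex raises G(p1) by at
  most K / p1, where K = binom (k-1) (r-1) counts the r-sets of a separator through one vertex. A
  deposit of 2K for each loose vertex suffices for ever, since the p in 2K / p at least doubles
  whenever that vertex lies on the side with fewer pieces. A short leaf can afford this deposit if
  2K \<le> binom (ck) r / (ck), and that is what \<open>c^(r-1) \<ge> 2r\<close> provides. For
  \<open>c = 1\<close> the choice q = k / sqrt r balances two losses: the extra q vertices cost a
  factor 1 + q/k, and the r-sets left in the first leaf are a fraction of about (1 - q/k)^r, close
  to exp(- sqrt r).\<close>

lemma disjoint_nsets:
  assumes "A \<inter> B = {}" "r \<ge> 1" shows "nsets A r \<inter> nsets B r = {}"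
proof (intro equals0I)
  fix e assume e: "e \<in> nsets A r \<inter> nsets B r"
  then have "e = {}" using assms(1) by (auto simp: nsets_def)
  then show False using e assms(2) by (simp add: nsets_def)
qed

text \<open>\<open>d\<close> stands for the integer part of \<open>ck\<close>. Vertex counts are
  integers, so the real threshold \<open>ck + k\<close> acts only through \<open>d + k\<close>;
  \<open>hyp_family_eq\<close> makes the translation.\<close>

definition small_conn :: "nat \<Rightarrow> nat \<Rightarrow> nat \<Rightarrow> 'a hypergraph \<Rightarrow> bool" where
  "small_conn d k r H \<longleftrightarrow> uniform_hypergraph r H \<and>
     \<not> (\<exists>H'. subgraph r H' H \<and> vertex_connected k H' \<and> card (verts H') > d + k)"

definition missing :: "nat \<Rightarrow> 'a hypergraph \<Rightarrow> 'a set set" where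
  "missing r H = nsets (verts H) r - edges H"

definition induced :: "'a hypergraph \<Rightarrow> 'a set \<Rightarrow> 'a hypergraph" where
  "induced H W = \<lparr>verts = W, edges = {e \<in> edges H. e \<subseteq> W}\<rparr>"

definition cut :: "'a hypergraph \<Rightarrow> 'a set \<Rightarrow> 'a set \<Rightarrow> 'a set \<Rightarrow> bool" where
  "cut H A B T \<longleftrightarrow> verts H = A \<union> B \<union> T \<and> A \<inter> B = {} \<and> A \<inter> T = {} \<and> B \<inter> T = {} \<and>
     (\<forall>e\<in>edges H. e \<inter> T = {} \<longrightarrow> e \<subseteq> A \<or> e \<subseteq> B)"

definition walk :: "'a hypergraph \<Rightarrow> 'a \<Rightarrow> 'a \<Rightarrow> (nat \<Rightarrow> 'a) \<Rightarrow> nat \<Rightarrow> bool" where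
  "walk H x y a s \<longleftrightarrow> a 0 = x \<and> a s = y \<and> (\<forall>i\<le>s. a i \<in> verts H) \<and>
     (\<forall>i\<in>{1..s}. \<exists>e\<in>edges H. {a (i - 1), a i} \<subseteq> e)"

lemma connected_hypergraph_walk:
  "connected_hypergraph H \<longleftrightarrow> (\<forall>x\<in>verts H. \<forall>y\<in>verts H. \<exists>a s. walk H x y a s)"
  by (simp add: connected_hypergraph_def walk_def)

lemma small_conn_uniform: "small_conn d k r H \<Longrightarrow> uniform_hypergraph r H"
  by (simp add: small_conn_def)

lemma small_conn_finite: "small_conn d k r H \<Longrightarrow> finite (verts H)"
  by (simp add: small_conn_def uniform_hypergraph_def)

lemma uniform_edges_subset:
  assumes "uniform_hypergraph r H" shows "edges H \<subseteq> nsets (verts H) r"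
  using assms finite_subset unfolding uniform_hypergraph_def nsets_def by blast

lemma finite_missing: "finite (verts H) \<Longrightarrow> finite (missing r H)"
  unfolding missing_def by (simp add: finite_imp_finite_nsets)

lemma card_edges_eq:
  assumes "uniform_hypergraph r H"
  shows "real (card (edges H)) = real (card (verts H) choose r) - real (card (missing r H))"
proof -
  have fin: "finite (nsets (verts H) r)"
    using assms by (simp add: uniform_hypergraph_def finite_imp_finite_nsets)
  have sub: "edges H \<subseteq> nsets (verts H) r" by (rule uniform_edges_subset[OF assms])
  have "card (missing r H) = (card (verts H) choose r) - card (edges H)"
    unfolding missing_def using card_Diff_subset[OF finite_subset[OF sub fin] sub] by (simp add: card_nsets)
  moreover have "card (edges H) \<le> card (verts H) choose r"
    using card_mono[OF fin sub] by (simp add: card_nsets)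
  ultimately show ?thesis by simp
qed

lemma subgraph_trans: "subgraph r A B \<Longrightarrow> subgraph r B C \<Longrightarrow> subgraph r A C"
  unfolding subgraph_def by blast

lemma small_conn_subgraph:
  assumes "small_conn d k r H" "subgraph r H1 H" shows "small_conn d k r H1"
proof -
  have "uniform_hypergraph r H1" using assms(2) by (simp add: subgraph_def)
  moreover have "\<not> (\<exists>H'. subgraph r H' H1 \<and> vertex_connected k H' \<and> card (verts H') > d + k)"
    using assms(1) subgraph_trans[OF _ assms(2)] unfolding small_conn_def by blast
  ultimately show ?thesis by (simp add: small_conn_def)
qed

lemma subgraph_induced:
  assumes "uniform_hypergraph r H" "W \<subseteq> verts H" shows "subgraph r (induced H W) H"
  using assms finite_subset unfolding subgraph_def uniform_hypergraph_def induced_def by auto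

lemma induced_simps [simp]: "verts (induced H W) = W" "edges (induced H W) = {e \<in> edges H. e \<subseteq> W}"
  by (auto simp: induced_def)

lemma missing_induced:
  assumes "W \<subseteq> verts H" shows "missing r (induced H W) = missing r H \<inter> nsets W r"
  using assms unfolding missing_def induced_def nsets_def by auto

lemma small_conn_few_verts:
  assumes "uniform_hypergraph r H" "card (verts H) \<le> d + k" shows "small_conn d k r H"
proof -
  have "card (verts H') \<le> d + k" if "subgraph r H' H" for H'
    using that assms card_mono[of "verts H" "verts H'"]
    unfolding subgraph_def uniform_hypergraph_def by auto
  then show ?thesis using assms unfolding small_conn_def by (meson not_less)
qed

text \<open>The vertices reachable from \<open>x\<close> after deleting \<open>T\<close> form one side of the cut.\<close>

lemma small_conn_cut:
  assumes sc: "small_conn d k r H" and big: "card (verts H) > d + k" and d: "d \<ge> 1"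
  obtains A B T where "cut H A B T" "A \<noteq> {}" "B \<noteq> {}" "card T = k"
proof -
  have u: "uniform_hypergraph r H" using sc by (rule small_conn_uniform)
  have "subgraph r H H" using u by (simp add: subgraph_def)
  then have "\<not> vertex_connected k H" using sc big unfolding small_conn_def by blast
  \<comment> \<open>As \<open>d \<ge> 1\<close>, there are at least \<open>k + 2\<close> vertices,
    so \<open>vertex_connected\<close> does not fail for lack of size and a disconnecting
    \<open>k\<close>-set must exist.\<close>
  then obtain T where T: "T \<subseteq> verts H" "card T = k" "\<not> connected_hypergraph (delete_verts H T)"
    unfolding vertex_connected_def using big d by auto
  define D where "D = delete_verts H T"
  define reach where "reach x y \<longleftrightarrow> (\<exists>a s. walk D x y a s)" for x y
  obtain x y where xy: "x \<in> verts D" "y \<in> verts D" "\<not> reach x y"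
    using T(3) unfolding connected_hypergraph_walk D_def[symmetric] reach_def by blast
  have refl: "reach x x" unfolding reach_def walk_def using xy(1) by (intro exI[of _ "\<lambda>_. x"] exI[of _ 0]) auto
  have step: "reach x w" if z: "reach x z" "e \<in> edges D" "z \<in> e" "w \<in> e" "w \<in> verts D" for z w e
  proof -
    obtain a s where w: "walk D x z a s" using z(1) unfolding reach_def by blast
    then have a: "a 0 = x" "a s = z" "\<forall>i\<le>s. a i \<in> verts D"
      "\<forall>i\<in>{1..s}. \<exists>e\<in>edges D. {a (i - 1), a i} \<subseteq> e" unfolding walk_def by auto
    let ?a = "a(Suc s := w)"
    have "\<exists>e\<in>edges D. {?a (i - 1), ?a i} \<subseteq> e" if "i \<in> {1..Suc s}" for i
    proof (cases "i = Suc s")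
      case True then show ?thesis using a(2) \<open>e \<in> edges D\<close> \<open>z \<in> e\<close> \<open>w \<in> e\<close> by auto
    next
      case False then show ?thesis using a(4) that by auto
    qed
    moreover have "\<forall>i\<le>Suc s. ?a i \<in> verts D" using a(3) z(5) by auto
    ultimately show ?thesis unfolding reach_def walk_def using a(1)
      by (intro exI[of _ ?a] exI[of _ "Suc s"]) auto
  qed
  let ?A = "{z \<in> verts D. reach x z}" and ?B = "{z \<in> verts D. \<not> reach x z}"
  have VD: "verts D = verts H - T" "edges D = {e \<in> edges H. e \<inter> T = {}}"
    by (simp_all add: D_def delete_verts_def)
  have "e \<subseteq> ?A \<or> e \<subseteq> ?B" if e: "e \<in> edges H" "e \<inter> T = {}" for e
  proof -
    have sub: "e \<subseteq> verts D" using e u unfolding uniform_hypergraph_def VD by blast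
    have eD: "e \<in> edges D" using e VD by simp
    show ?thesis
    proof (cases "\<exists>z\<in>e. reach x z")
      case True
      then show ?thesis using sub step[OF _ eD] by blast
    qed (use sub in blast)
  qed
  then have "cut H ?A ?B T" unfolding cut_def using T(1) VD by auto
  moreover have "?A \<noteq> {}" "?B \<noteq> {}" using xy refl by auto
  ultimately show thesis using T(2) that by blast
qed

text \<open>A large \<open>(k+1)\<close>-connected subgraph fits into neither side, so it has a
  vertex \<open>a\<close> in \<open>A\<close> and a vertex \<open>b\<close> in \<open>B\<close>.
  After deletion of its part of \<open>T\<close> a walk from \<open>a\<close> to \<open>b\<close>
  would have to remain, but an edge avoiding \<open>T\<close> never leaves its side.\<close>

lemma small_conn_of_cut:
  assumes u: "uniform_hypergraph r H" and c: "cut H A B T" and T: "card T \<le> k"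
    and A: "small_conn d k r (induced H (A \<union> T))" and B: "small_conn d k r (induced H (B \<union> T))"
  shows "small_conn d k r H"
proof -
  have False if sub: "subgraph r H' H" and vc: "vertex_connected k H'"
    and gt: "card (verts H') > d + k" for H'
  proof -
    have u': "uniform_hypergraph r H'" using sub by (simp add: subgraph_def)
    have fin: "finite (verts H')" using u' by (simp add: uniform_hypergraph_def)
    have finT: "finite T" using u c finite_subset unfolding uniform_hypergraph_def cut_def by auto
    have VV: "verts H' \<subseteq> A \<union> B \<union> T" using sub c unfolding subgraph_def cut_def by auto
    have notin: "\<not> verts H' \<subseteq> W" if "small_conn d k r (induced H W)" for W
    proof
      assume W: "verts H' \<subseteq> W"
      then have "subgraph r H' (induced H W)"
        using sub u' unfolding subgraph_def uniform_hypergraph_def induced_def by fastforce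
      then show False using that vc gt unfolding small_conn_def by blast
    qed
    obtain a where a: "a \<in> verts H'" "a \<in> A" using notin[OF B] VV by blast
    obtain b where b: "b \<in> verts H'" "b \<in> B" using notin[OF A] VV by blast
    have disj: "A \<inter> B = {}" "A \<inter> T = {}" "B \<inter> T = {}" using c unfolding cut_def by auto
    have ab: "a \<noteq> b" using a b disj by blast
    have "card (verts H' - {a, b}) = card (verts H') - 2" using a b ab fin by (simp add: card_Diff_subset)
    then have k2: "k \<le> card (verts H' - {a, b})" using vc unfolding vertex_connected_def by linarith
    have "card (T \<inter> verts H') \<le> k" using T card_mono[OF finT, of "T \<inter> verts H'"] by auto
    moreover have "T \<inter> verts H' \<subseteq> verts H' - {a, b}" using a b disj by blast
    \<comment> \<open>Exactly \<open>k\<close> vertices have to be deleted, while \<open>T\<close>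
      may contribute fewer. It is padded, and the size bound \<open>k + 2\<close> leaves room to
      spare \<open>a\<close> and \<open>b\<close>.\<close>
    ultimately obtain S where S: "T \<inter> verts H' \<subseteq> S" "S \<subseteq> verts H' - {a, b}" "card S = k"
      using exists_subset_between[OF _ k2, of "T \<inter> verts H'"] fin by auto
    then have conn: "connected_hypergraph (delete_verts H' S)" using vc unfolding vertex_connected_def by blast
    have abD: "a \<in> verts (delete_verts H' S)" "b \<in> verts (delete_verts H' S)"
      using a b S(2) by (auto simp: delete_verts_def)
    obtain p s where "walk (delete_verts H' S) a b p s"
      using conn abD unfolding connected_hypergraph_walk by blast
    then have p: "p 0 = a" "p s = b" "\<forall>i\<le>s. p i \<in> verts (delete_verts H' S)"
      "\<forall>i\<in>{1..s}. \<exists>e\<in>edges (delete_verts H' S). {p (i - 1), p i} \<subseteq> e"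
      unfolding walk_def by auto
    have "p i \<in> A" if "i \<le> s" for i
      using that
    proof (induction i)
      case 0 then show ?case using p(1) a by simp
    next
      case (Suc i)
      then have "\<exists>e\<in>edges (delete_verts H' S). {p i, p (Suc i)} \<subseteq> e"
        using bspec[OF p(4), of "Suc i"] by simp
      then obtain e where e: "e \<in> edges H'" "e \<inter> S = {}" "p i \<in> e" "p (Suc i) \<in> e"
        by (auto simp: delete_verts_def)
      have "e \<subseteq> verts H'" using e u' unfolding uniform_hypergraph_def by blast
      then have "e \<inter> T = {}" using e(2) S(1) by blast
      then have "e \<subseteq> A \<or> e \<subseteq> B" using c e(1) sub unfolding cut_def subgraph_def by blast
      then show ?case using e Suc disj by fastforce
    qed
    then show False using p(2) b disj by blast
  qed
  then show ?thesis using u unfolding small_conn_def by blast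
qed

section \<open>Transport along injective maps\<close>

definition map_hyp :: "('a \<Rightarrow> 'b) \<Rightarrow> 'a hypergraph \<Rightarrow> 'b hypergraph" where
  "map_hyp f H = \<lparr>verts = f ` verts H, edges = (`) f ` edges H\<rparr>"

lemma map_hyp_simps [simp]: "verts (map_hyp f H) = f ` verts H" "edges (map_hyp f H) = (`) f ` edges H"
  by (auto simp: map_hyp_def)

lemma uniform_map_hyp:
  assumes "uniform_hypergraph r H" "inj_on f (verts H)" shows "uniform_hypergraph r (map_hyp f H)"
  using assms unfolding uniform_hypergraph_def
  by (auto simp: card_image inj_on_subset)

lemma connected_map_hyp:
  assumes "connected_hypergraph H" shows "connected_hypergraph (map_hyp f H)"
  unfolding connected_hypergraph_walk
proof (intro ballI)
  fix x y assume "x \<in> verts (map_hyp f H)" "y \<in> verts (map_hyp f H)"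
  then obtain x' y' where xy: "x = f x'" "y = f y'" "x' \<in> verts H" "y' \<in> verts H" by auto
  obtain a s where w: "walk H x' y' a s"
    using assms xy(3,4) unfolding connected_hypergraph_walk by blast
  have "\<exists>e\<in>edges (map_hyp f H). {(f \<circ> a) (i - 1), (f \<circ> a) i} \<subseteq> e" if i: "i \<in> {1..s}" for i
  proof -
    obtain e where "e \<in> edges H" "{a (i - 1), a i} \<subseteq> e" using w i unfolding walk_def by blast
    then show ?thesis by (intro bexI[of _ "f ` e"]) auto
  qed
  then have "walk (map_hyp f H) x y (f \<circ> a) s" using w xy unfolding walk_def by simp
  then show "\<exists>a s. walk (map_hyp f H) x y a s" by blast
qed

lemma vertex_connected_map_hyp:
  assumes "vertex_connected k H" "inj_on f (verts H)" "uniform_hypergraph r H"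
  shows "vertex_connected k (map_hyp f H)"
  unfolding vertex_connected_def
proof (intro conjI allI impI)
  show "k + 2 \<le> card (verts (map_hyp f H))"
    using assms by (simp add: card_image vertex_connected_def)
next
  fix S assume S: "S \<subseteq> verts (map_hyp f H)" "card S = k"
  then obtain S0 where S0: "S0 \<subseteq> verts H" "S = f ` S0" by (auto simp: subset_image_iff)
  have "card S0 = k" using S S0 assms(2) by (metis card_image inj_on_subset)
  then have conn: "connected_hypergraph (delete_verts H S0)" using assms(1) S0 unfolding vertex_connected_def by blast
  have "f ` e \<inter> f ` S0 = {} \<longleftrightarrow> e \<inter> S0 = {}" if "e \<in> edges H" for e
    using that assms S0 inj_on_image_Int[OF assms(2), of e S0] unfolding uniform_hypergraph_def by auto
  then have "delete_verts (map_hyp f H) S = map_hyp f (delete_verts H S0)"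
    using S0 assms(2) by (auto simp: delete_verts_def map_hyp_def inj_on_image_set_diff)
  then show "connected_hypergraph (delete_verts (map_hyp f H) S)" using connected_map_hyp[OF conn, of f] by metis
qed

lemma small_conn_map_hyp:
  assumes sc: "small_conn d k r H" and inj: "inj_on f (verts H)"
  shows "small_conn d k r (map_hyp f H)"
proof -
  have u: "uniform_hypergraph r H" using sc by (rule small_conn_uniform)
  have False if sub: "subgraph r K (map_hyp f H)" and vc: "vertex_connected k K"
    and gt: "card (verts K) > d + k" for K
  proof -
    define g where "g = inv_into (verts H) f"
    have uK: "uniform_hypergraph r K" using sub by (simp add: subgraph_def)
    have VK: "verts K \<subseteq> f ` verts H" using sub by (simp add: subgraph_def)
    have injg: "inj_on g (verts K)" unfolding g_def using VK inj_on_inv_into by blast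
    have gf: "g ` f ` e = e" if "e \<subseteq> verts H" for e
      using that inj unfolding g_def by (simp add: inv_into_image_cancel)
    have "subgraph r (map_hyp g K) H" unfolding subgraph_def
    proof (intro conjI)
      show "uniform_hypergraph r (map_hyp g K)" by (rule uniform_map_hyp[OF uK injg])
      show "verts (map_hyp g K) \<subseteq> verts H" using image_mono[OF VK, of g] gf[of "verts H"] by simp
      show "edges (map_hyp g K) \<subseteq> edges H"
      proof
        fix e assume "e \<in> edges (map_hyp g K)"
        then obtain e' where e': "e' \<in> edges K" "e = g ` e'" by auto
        then obtain e0 where "e0 \<in> edges H" "e' = f ` e0" using sub unfolding subgraph_def by auto
        then show "e \<in> edges H" using e' gf u unfolding uniform_hypergraph_def by auto
      qed
    qed
    moreover have "vertex_connected k (map_hyp g K)" by (rule vertex_connected_map_hyp[OF vc injg uK])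
    moreover have "card (verts (map_hyp g K)) > d + k" using gt injg by (simp add: card_image)
    ultimately show False using sc unfolding small_conn_def by blast
  qed
  then show ?thesis using uniform_map_hyp[OF u inj] unfolding small_conn_def by blast
qed

lemma missing_map_hyp:
  assumes u: "uniform_hypergraph r H" and inj: "inj_on f (verts H)"
  shows "missing r (map_hyp f H) = (`) f ` missing r H"
proof -
  have inj2: "inj_on ((`) f) (Pow (verts H))" using inj by (rule inj_on_image_Pow)
  have n: "nsets (f ` verts H) r = (`) f ` nsets (verts H) r"
  proof (intro equalityI subsetI)
    fix e assume "e \<in> nsets (f ` verts H) r"
    then obtain e0 where e0: "e0 \<subseteq> verts H" "e = f ` e0" "card e = r" "finite e"
      by (auto simp: nsets_def subset_image_iff)
    moreover have "inj_on f e0" using inj e0(1) by (rule inj_on_subset)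
    ultimately have "card e0 = r" "finite e0" by (auto simp: card_image finite_image_iff)
    then show "e \<in> (`) f ` nsets (verts H) r" using e0 by (auto simp: nsets_def)
  next
    fix e assume "e \<in> (`) f ` nsets (verts H) r"
    then show "e \<in> nsets (f ` verts H) r" using inj
      by (auto simp: nsets_def card_image inj_on_subset)
  qed
  show ?thesis unfolding missing_def map_hyp_simps n
    by (rule inj_on_image_set_diff[OF inj2, symmetric])
       (use uniform_edges_subset[OF u] in \<open>auto simp: nsets_def\<close>)
qed

section \<open>Gluing, and the relative surplus as a supremum\<close>

definition cross :: "nat \<Rightarrow> 'a set \<Rightarrow> 'a set \<Rightarrow> 'a set set" where
  "cross r A B = nsets (A \<union> B) r - nsets A r - nsets B r"

text \<open>The richest way to join \<open>G\<close> and \<open>H\<close> with their overlap as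
  separator: an r-set is left out only if it is missing on one side or avoids the overlap and
  reaches both sides. Describing it by what is missing makes \<open>missing_glue\<close> a plain
  union.\<close>

definition glue :: "nat \<Rightarrow> 'a hypergraph \<Rightarrow> 'a hypergraph \<Rightarrow> 'a hypergraph" where
  "glue r G H = \<lparr>verts = verts G \<union> verts H,
     edges = nsets (verts G \<union> verts H) r -
       (missing r G \<union> missing r H \<union> cross r (verts G - verts H) (verts H - verts G))\<rparr>"

text \<open>By \<open>card_edges_eq\<close> this is e(H) - binom n r + binom (n-k) r, the surplus of
  a single hypergraph. In terms of missing sets, the r-sets that meet a separator drop out of all
  computations.\<close>

definition sur :: "nat \<Rightarrow> nat \<Rightarrow> 'a hypergraph \<Rightarrow> real" where
  "sur r k H = real ((card (verts H) - k) choose r) - real (card (missing r H))"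

definition complete_hyp :: "nat \<Rightarrow> 'a set \<Rightarrow> 'a hypergraph" where
  "complete_hyp r V = \<lparr>verts = V, edges = nsets V r\<rparr>"

lemma complete_hyp_simps [simp]:
  "verts (complete_hyp r V) = V" "edges (complete_hyp r V) = nsets V r" "missing r (complete_hyp r V) = {}"
  by (auto simp: complete_hyp_def missing_def)

lemma uniform_complete: "finite V \<Longrightarrow> uniform_hypergraph r (complete_hyp r V)"
  by (auto simp: uniform_hypergraph_def nsets_def)

lemma small_conn_complete: "finite V \<Longrightarrow> card V \<le> d + k \<Longrightarrow> small_conn d k r (complete_hyp r V)"
  by (intro small_conn_few_verts uniform_complete) auto

lemma sur_complete: "sur r k (complete_hyp r V) = real ((card V - k) choose r)"
  by (simp add: sur_def)

lemma card_cross: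
  assumes "finite A" "finite B" "A \<inter> B = {}" "r \<ge> 1"
  shows "real (card (cross r A B)) =
    real ((card A + card B) choose r) - real (card A choose r) - real (card B choose r)"
proof -
  have disj: "nsets A r \<inter> nsets B r = {}" by (rule disjoint_nsets[OF assms(3,4)])
  have fin: "finite (nsets A r)" "finite (nsets B r)" "finite (nsets (A \<union> B) r)"
    using assms by (simp_all add: finite_imp_finite_nsets)
  have sub: "nsets A r \<union> nsets B r \<subseteq> nsets (A \<union> B) r" by (auto simp: nsets_def)
  have "cross r A B = nsets (A \<union> B) r - (nsets A r \<union> nsets B r)" by (auto simp: cross_def)
  then have "card (cross r A B) = card (nsets (A \<union> B) r) - card (nsets A r \<union> nsets B r)"
    using fin sub by (simp add: card_Diff_subset)
  moreover have "card (nsets A r \<union> nsets B r) \<le> card (nsets (A \<union> B) r)"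
    using sub fin by (intro card_mono)
  moreover have "card (nsets A r \<union> nsets B r) = (card A choose r) + (card B choose r)"
    using fin disj by (simp add: card_Un_disjoint card_nsets)
  moreover have "card (nsets (A \<union> B) r) = (card A + card B) choose r"
    using assms by (simp add: card_nsets card_Un_disjoint)
  ultimately show ?thesis by simp
qed

lemma verts_glue [simp]: "verts (glue r G H) = verts G \<union> verts H"
  by (simp add: glue_def)

lemma missing_glue:
  "missing r (glue r G H) =
     missing r G \<union> missing r H \<union> cross r (verts G - verts H) (verts H - verts G)"
  unfolding missing_def glue_def cross_def nsets_def by auto

lemma small_conn_glue:
  assumes G: "small_conn d k r G" and H: "small_conn d k r H" and T: "card (verts G \<inter> verts H) \<le> k"
  shows "small_conn d k r (glue r G H)"
proof -
  let ?K = "glue r G H"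
  let ?A = "verts G - verts H" and ?B = "verts H - verts G" and ?T = "verts G \<inter> verts H"
  have u: "uniform_hypergraph r ?K"
    using small_conn_finite[OF G] small_conn_finite[OF H]
    by (auto simp: uniform_hypergraph_def glue_def nsets_def)
  have c: "cut ?K ?A ?B ?T"
    unfolding cut_def
  proof (intro conjI ballI impI)
    fix e assume e: "e \<in> edges ?K" "e \<inter> ?T = {}"
    then have "e \<in> nsets (?A \<union> ?B) r" "e \<notin> cross r ?A ?B" by (auto simp: glue_def nsets_def)
    then show "e \<subseteq> ?A \<or> e \<subseteq> ?B" by (auto simp: cross_def nsets_def)
  qed auto
  have AT: "?A \<union> ?T = verts G" and BT: "?B \<union> ?T = verts H" by auto
  \<comment> \<open>Only an inclusion: an r-set inside the overlap that is an edge of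
    \<open>G\<close> but missing in \<open>H\<close> is missing in the glued hypergraph.\<close>
  have sub: "subgraph r (induced ?K (verts G)) G" "subgraph r (induced ?K (verts H)) H"
    using small_conn_finite[OF G] small_conn_finite[OF H]
    by (auto simp: subgraph_def uniform_hypergraph_def glue_def nsets_def missing_def)
  show ?thesis
    by (rule small_conn_of_cut[OF u c T])
       (unfold AT BT, rule small_conn_subgraph[OF G sub(1)], rule small_conn_subgraph[OF H sub(2)])
qed

text \<open>The \<open>cross\<close> sets account exactly for the difference between the binomial of
  the sum and the sum of the binomials. A set missing on both sides is subtracted twice on the right
  but missing only once after gluing, which is the gain.\<close>

lemma sur_glue:
  assumes fin: "finite (verts G)" "finite (verts H)" and T: "card (verts G \<inter> verts H) = k" and r: "r \<ge> 1"
  shows "sur r k (glue r G H) = sur r k G + sur r k H + real (card (missing r G \<inter> missing r H))"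
proof -
  let ?A = "verts G - verts H" and ?B = "verts H - verts G" and ?T = "verts G \<inter> verts H"
  let ?C = "cross r ?A ?B"
  have cardA: "card (verts G) - k = card ?A" using fin T by (simp add: card_Diff_subset_Int)
  have cardB: "card (verts H) - k = card ?B" using fin T by (simp add: card_Diff_subset_Int Int_commute)
  have "verts G \<union> verts H = ?A \<union> ?B \<union> ?T" by auto
  moreover have "card (?A \<union> ?B \<union> ?T) = card ?A + card ?B + card ?T"
    using fin by (subst card_Un_disjoint; (subst card_Un_disjoint)?) auto
  ultimately have cardV: "card (verts G \<union> verts H) - k = card ?A + card ?B" using T by simp
  have disj: "(missing r G \<union> missing r H) \<inter> ?C = {}"
    by (auto simp: missing_def cross_def nsets_def)
  have finm: "finite (missing r G)" "finite (missing r H)" using fin by (simp_all add: finite_missing)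
  have finC: "finite ?C" unfolding cross_def using fin by (simp add: finite_imp_finite_nsets)
  have "card (missing r (glue r G H)) = card (missing r G \<union> missing r H) + card ?C"
    unfolding missing_glue using finm finC disj by (simp add: card_Un_disjoint)
  moreover have "card (missing r G \<union> missing r H) + card (missing r G \<inter> missing r H) =
      card (missing r G) + card (missing r H)" using card_Un_Int[OF finm] by simp
  moreover have "real (card ?C) = real ((card ?A + card ?B) choose r) - real (card ?A choose r) - real (card ?B choose r)"
    using fin r by (intro card_cross) auto
  ultimately show ?thesis unfolding sur_def verts_glue cardA cardB cardV by linarith
qed

text \<open>A complete hypergraph on \<open>k + 1\<close> vertices, glued along \<open>k\<close> of
  them, has surplus \<open>1 choose r = 0\<close>. This makes the surplus monotone in the number of
  vertices and the family nonempty for every size.\<close>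

lemma small_conn_add_vertex:
  fixes G :: "nat hypergraph"
  assumes G: "small_conn d k r G" and k: "card (verts G) \<ge> k" and d: "d \<ge> 1" and r: "r \<ge> 2"
  obtains K :: "nat hypergraph" where "small_conn d k r K" "card (verts K) = card (verts G) + 1" "sur r k K = sur r k G"
proof -
  have fin: "finite (verts G)" using G by (rule small_conn_finite)
  obtain T where T: "T \<subseteq> verts G" "card T = k" using obtain_subset_with_card_n[OF k] by blast
  obtain v where v: "v \<notin> verts G" using fin ex_new_if_finite infinite_UNIV_nat by blast
  let ?H = "complete_hyp r (insert v T)"
  have finT: "finite T" using T fin finite_subset by blast
  have vT: "v \<notin> T" using v T by blast
  have int: "verts G \<inter> verts ?H = T" using T v by auto
  have H: "small_conn d k r ?H" using finT T vT d by (intro small_conn_complete) auto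
  have "small_conn d k r (glue r G ?H)" using int T by (intro small_conn_glue G H) simp
  moreover have "verts (glue r G ?H) = insert v (verts G)" using T by auto
  then have "card (verts (glue r G ?H)) = card (verts G) + 1" using v fin by simp
  moreover have "sur r k (glue r G ?H) = sur r k G"
    using sur_glue[of G ?H k r] fin finT int T r vT by (simp add: sur_complete)
  ultimately show thesis using that by blast
qed

lemma exists_copy_map:
  fixes V W :: "nat set"
  assumes "finite V" "finite W"
  obtains g where "inj_on g V" "\<And>v. v \<in> T \<Longrightarrow> g v = v" "g ` (V - T) \<inter> W = {}"
proof -
  define M where "M = Suc (Max (insert 0 (V \<union> W)))"
  have less: "x < M" if "x \<in> V \<union> W" for x
    unfolding M_def using that assms by (simp add: less_Suc_eq_le)
  define g where "g v = (if v \<in> T then v else v + M)" for v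
  have "inj_on g V" unfolding inj_on_def g_def using less by (force split: if_splits)
  moreover have "g ` (V - T) \<inter> W = {}" unfolding g_def using less by force
  ultimately show thesis using that[of g] by (simp add: g_def)
qed

text \<open>The copy fixes \<open>S\<close> and is fresh elsewhere, so a set missing in both lies
  inside \<open>S\<close>. By \<open>agree\<close> these are all the sets of \<open>S\<close>
  missing in \<open>H\<close>, so the gain is known exactly.\<close>

lemma glue_copy:
  fixes G H :: "nat hypergraph"
  assumes G: "small_conn d k r G" and H: "small_conn d k r H"
    and S: "S \<subseteq> verts G" "S \<subseteq> verts H" "card S = k" and r: "r \<ge> 1"
    and agree: "missing r G \<inter> nsets S r = missing r H \<inter> nsets S r"
  obtains g where "inj_on g (verts H)" "\<And>v. v \<in> S \<Longrightarrow> g v = v" "verts G \<inter> g ` verts H = S"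
    "small_conn d k r (glue r G (map_hyp g H))"
    "card (verts G \<union> g ` verts H) = card (verts G) + (card (verts H) - k)"
    "sur r k (glue r G (map_hyp g H)) = sur r k G + sur r k H + real (card (missing r H \<inter> nsets S r))"
    "missing r (map_hyp g H) \<inter> nsets S r = missing r H \<inter> nsets S r"
proof -
  have fin: "finite (verts G)" "finite (verts H)" using G H by (simp_all add: small_conn_finite)
  obtain g where g: "inj_on g (verts H)" "\<And>v. v \<in> S \<Longrightarrow> g v = v" "g ` (verts H - S) \<inter> verts G = {}"
    using exists_copy_map[OF fin(2,1), of S] by metis
  have gS: "g ` S = S" using g(2) by force
  have int: "verts G \<inter> g ` verts H = S"
  proof
    show "S \<subseteq> verts G \<inter> g ` verts H" using S gS by blast
    show "verts G \<inter> g ` verts H \<subseteq> S"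
    proof
      fix y assume y: "y \<in> verts G \<inter> g ` verts H"
      then obtain x where x: "x \<in> verts H" "y = g x" by blast
      then have "x \<in> S" using y g(3) by blast
      then show "y \<in> S" using g(2) x(2) by simp
    qed
  qed
  have u: "uniform_hypergraph r H" using H by (rule small_conn_uniform)
  have mis: "missing r (map_hyp g H) = (`) g ` missing r H" by (rule missing_map_hyp[OF u g(1)])
  have misS: "missing r (map_hyp g H) \<inter> nsets S r = missing r H \<inter> nsets S r"
  proof (intro equalityI subsetI)
    fix e assume e: "e \<in> missing r (map_hyp g H) \<inter> nsets S r"
    then obtain e0 where e0: "e0 \<in> missing r H" "e = g ` e0" unfolding mis by blast
    have "e \<subseteq> S" using e by (simp add: nsets_def)
    moreover have "e0 \<subseteq> verts H" using e0 by (simp add: missing_def nsets_def)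
    ultimately have "e0 \<subseteq> S" using e0(2) g(3) S(1) by blast
    then have "g ` e0 = e0" using g(2) by force
    then show "e \<in> missing r H \<inter> nsets S r" using e e0 by simp
  next
    fix e assume e: "e \<in> missing r H \<inter> nsets S r"
    then have "g ` e = e" using g(2) by (force simp: nsets_def)
    then show "e \<in> missing r (map_hyp g H) \<inter> nsets S r" unfolding mis using e by (metis IntE IntI imageI)
  qed
  have sc: "small_conn d k r (map_hyp g H)" by (rule small_conn_map_hyp[OF H g(1)])
  have "card (verts G \<union> g ` verts H) + card (verts G \<inter> g ` verts H) = card (verts G) + card (g ` verts H)"
    using fin card_Un_Int[of "verts G" "g ` verts H"] by simp
  moreover have "card (g ` verts H) = card (verts H)" using g(1) by (rule card_image)
  moreover have "k \<le> card (verts H)" using S fin card_mono by metis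
  ultimately have card: "card (verts G \<union> g ` verts H) = card (verts G) + (card (verts H) - k)"
    using int S by simp
  have "missing r G \<inter> missing r (map_hyp g H) \<subseteq> nsets S r"
    using int unfolding missing_def nsets_def by auto
  then have misI: "missing r G \<inter> missing r (map_hyp g H) = missing r H \<inter> nsets S r" using agree misS by blast
  have "card (missing r (map_hyp g H)) = card (missing r H)" unfolding mis
  proof (rule card_image)
    show "inj_on ((`) g) (missing r H)"
      using inj_on_image_Pow[OF g(1)] by (rule inj_on_subset) (auto simp: missing_def nsets_def)
  qed
  then have "sur r k (map_hyp g H) = sur r k H" using g(1) by (simp add: sur_def card_image)
  then have "sur r k (glue r G (map_hyp g H)) = sur r k G + sur r k H + real (card (missing r H \<inter> nsets S r))"
    using sur_glue[of G "map_hyp g H" k r] fin int S r misI by simp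
  moreover have "small_conn d k r (glue r G (map_hyp g H))" using small_conn_glue[OF G sc] int S by simp
  ultimately show thesis using that g(1,2) int card misS by blast
qed

text \<open>All copies share the same \<open>S\<close>, and gluing does not change which sets of
  \<open>S\<close> are missing. Hence each of the \<open>t\<close> further copies brings the same
  gain.\<close>

lemma glue_many_copies:
  fixes H :: "nat hypergraph"
  assumes H: "small_conn d k r H" and S: "S \<subseteq> verts H" "card S = k" and r: "r \<ge> 1"
  shows "\<exists>G :: nat hypergraph. small_conn d k r G \<and> S \<subseteq> verts G \<and>
     card (verts G) = k + Suc t * (card (verts H) - k) \<and>
     missing r G \<inter> nsets S r = missing r H \<inter> nsets S r \<and>
     sur r k G = real (Suc t) * sur r k H + real t * real (card (missing r H \<inter> nsets S r))"
proof (induction t)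
  case 0
  have "k \<le> card (verts H)" using S small_conn_finite[OF H] card_mono by metis
  then show ?case using H S by (intro exI[of _ H]) auto
next
  case (Suc t)
  then obtain G :: "nat hypergraph" where G: "small_conn d k r G" "S \<subseteq> verts G"
    "card (verts G) = k + Suc t * (card (verts H) - k)"
    "missing r G \<inter> nsets S r = missing r H \<inter> nsets S r"
    "sur r k G = real (Suc t) * sur r k H + real t * real (card (missing r H \<inter> nsets S r))" by blast
  obtain g where g: "inj_on g (verts H)" "\<And>v. v \<in> S \<Longrightarrow> g v = v" "verts G \<inter> g ` verts H = S"
    "small_conn d k r (glue r G (map_hyp g H))"
    "card (verts G \<union> g ` verts H) = card (verts G) + (card (verts H) - k)"
    "sur r k (glue r G (map_hyp g H)) = sur r k G + sur r k H + real (card (missing r H \<inter> nsets S r))"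
    "missing r (map_hyp g H) \<inter> nsets S r = missing r H \<inter> nsets S r"
    using glue_copy[OF G(1) H G(2) S r G(4)] by metis
  let ?K = "glue r G (map_hyp g H)"
  have "S \<inter> (verts G - g ` verts H) = {}" using g(3) by blast
  then have "cross r (verts G - g ` verts H) (g ` verts H - verts G) \<inter> nsets S r = {}"
    using g(3) r by (fastforce simp: cross_def nsets_def)
  then have "missing r ?K \<inter> nsets S r = missing r H \<inter> nsets S r"
    using G(4) g(7) unfolding missing_glue by (simp add: Int_Un_distrib2)
  moreover have "S \<subseteq> verts ?K" using G(2) by auto
  moreover have "card (verts ?K) = k + Suc (Suc t) * (card (verts H) - k)"
    using g(5) G(3) by simp
  moreover have "sur r k ?K = real (Suc (Suc t)) * sur r k H + real (Suc t) * real (card (missing r H \<inter> nsets S r))"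
    using g(6) G(5) by (simp add: algebra_simps)
  ultimately show ?case using g(4) by blast
qed

section \<open>The limit as a supremum over single hypergraphs\<close>

lemma hyp_family_eq:
  assumes "c \<ge> 0"
  shows "hyp_family c r n k = {H. small_conn (nat \<lfloor>c * real k\<rfloor>) k r H \<and> card (verts H) = n}"
proof -
  have "real m > c * real k + real k \<longleftrightarrow> m > nat \<lfloor>c * real k\<rfloor> + k" for m
  proof -
    have "0 \<le> \<lfloor>c * real k\<rfloor>" using assms by simp
    have "real m > c * real k + real k \<longleftrightarrow> \<lfloor>c * real k\<rfloor> < int m - int k"
      by (subst floor_less_iff) (auto simp: algebra_simps)
    also have "\<dots> \<longleftrightarrow> m > nat \<lfloor>c * real k\<rfloor> + k" using \<open>0 \<le> \<lfloor>c * real k\<rfloor>\<close> by linarith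
    finally show ?thesis .
  qed
  then show ?thesis unfolding hyp_family_def small_conn_def by auto
qed

text \<open>Fekete's argument, with superadditivity along multiples and monotonicity: if
  \<open>a m / m\<close> is close to the supremum, then a large \<open>x\<close> is compared with
  the multiple of \<open>m\<close> just below it.\<close>

lemma superadditive_limit:
  fixes a :: "nat \<Rightarrow> real"
  assumes mono: "\<And>x y. x \<le> y \<Longrightarrow> a x \<le> a y" and a0: "a 0 \<ge> 0"
    and super: "\<And>x t. t \<ge> 1 \<Longrightarrow> a (t * x) \<ge> real t * a x"
    and bound: "\<And>x. x \<ge> 1 \<Longrightarrow> a x \<le> B * real x"
  obtains L where "(\<lambda>x. a x / real x) \<longlonglongrightarrow> L" "\<And>x. a x \<le> L * real x" "L \<le> B"
proof -
  have nonneg: "a x \<ge> 0" for x using mono[of 0 x] a0 by simp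
  define L where "L = (SUP x\<in>{1..}. a x / real x)"
  have quot: "a x / real x \<le> B" if "x \<ge> 1" for x
    using bound[OF that] that by (simp add: field_simps)
  have bdd: "bdd_above ((\<lambda>x. a x / real x) ` {1..})" by (rule bdd_aboveI2[of _ _ B]) (use quot in auto)
  have LB: "L \<le> B" unfolding L_def by (rule cSUP_least) (use quot in auto)
  have up: "a x / real x \<le> L" if "x \<ge> 1" for x
    unfolding L_def by (rule cSUP_upper[OF _ bdd]) (use that in auto)
  have zero: "a 0 \<le> 0"
  proof -
    have "real 2 * a 0 \<le> a (2 * 0)" by (rule super) simp
    then show ?thesis by simp
  qed
  have le: "a x \<le> L * real x" for x
    using up[of x] zero by (cases "x = 0") (auto simp: field_simps)
  have "(\<lambda>x. a x / real x) \<longlonglongrightarrow> L"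
  proof (rule LIMSEQ_I)
    fix e :: real assume e: "e > 0"
    then have "L - e/2 < L" by simp
    then obtain m where m: "m \<ge> 1" "a m / real m > L - e/2"
      unfolding L_def using less_cSUP_iff[OF _ bdd, of "L - e/2"] by (auto simp: L_def)
    \<comment> \<open>Rounding \<open>x\<close> down to a multiple of \<open>m\<close> costs at most
      \<open>a m / x\<close> in the quotient, which is below \<open>e/2\<close> from
      \<open>N\<close> on.\<close>
    obtain N where N: "real N > 2 * a m / e" using reals_Archimedean2 by blast
    have "norm (a x / real x - L) < e" if x: "x \<ge> max (max m N) 1" for x
    proof -
      define t where "t = x div m"
      have xm: "x \<ge> m" "x \<ge> N" "x \<ge> 1" using x by auto
      have t1: "t \<ge> 1" unfolding t_def using m xm by (simp add: div_greater_zero_iff Suc_le_eq)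
      have tx: "t * m \<le> x" unfolding t_def by simp
      have "x mod m < m" using m by simp
      then have "x < (t + 1) * m" using div_mult_mod_eq[of x m] unfolding t_def add_mult_distrib by linarith
      then have "real x \<le> (real t + 1) * real m" by (metis less_imp_le of_nat_1 of_nat_add of_nat_le_iff of_nat_mult)
      then have t: "real t \<ge> real x / real m - 1" using m by (simp add: field_simps)
      have "a x \<ge> real t * a m" using super[OF t1, of m] mono[OF tx] by linarith
      also have "real t * a m \<ge> (real x / real m - 1) * a m" using t nonneg by (intro mult_right_mono) auto
      finally have "a x / real x \<ge> (real x / real m - 1) * a m / real x" using xm by (simp add: divide_right_mono)
      also have "(real x / real m - 1) * a m / real x = a m / real m - a m / real x"
        using xm m by (simp add: field_simps)
      finally have 1: "a x / real x \<ge> a m / real m - a m / real x" .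
      have "real N \<le> real x" using xm by simp
      then have "2 * a m / e < real x" using N by linarith
      then have "2 * a m < real x * e" using e by (simp add: pos_divide_less_eq)
      then have "a m / real x < e/2" using xm by (simp add: field_simps)
      then show ?thesis using 1 m(2) up[of x] xm by (simp add: abs_if)
    qed
    then show "\<exists>no. \<forall>n\<ge>no. norm (a n / real n - L) < e" by blast
  qed
  then show thesis using le LB that by blast
qed

text \<open>\<open>bound\<close> is an assumption because it is supplied by two different arguments,
  one for \<open>c = 1\<close> and one above the threshold. It is applied only to \<open>nat\<close>
  vertices, the type used in the definition of the surplus.\<close>

locale family =
  fixes c :: real and k r d :: nat and B :: real
  assumes c: "c \<ge> 0" and k: "k \<ge> 1" and r: "r \<ge> 2" and d: "d \<ge> 1" and dc: "d = nat \<lfloor>c * real k\<rfloor>"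
    and bound: "\<And>H :: nat hypergraph. small_conn d k r H \<Longrightarrow> card (verts H) > k \<Longrightarrow>
          sur r k H \<le> B * (real (card (verts H)) - real k)"
begin

lemma fam: "hyp_family c r n k = {H. small_conn d k r H \<and> card (verts H) = n}"
  using hyp_family_eq[OF c] dc by simp

lemma fam_nonempty: "hyp_family c r n k \<noteq> {}"
proof (induction n)
  case 0
  have "small_conn d k r (complete_hyp r ({} :: nat set))" by (intro small_conn_complete) auto
  then show ?case unfolding fam by (auto intro!: exI[of _ "complete_hyp r {}"])
next
  case (Suc n)
  show ?case
  proof (cases "n \<ge> k")
    case True
    obtain G :: "nat hypergraph" where "small_conn d k r G" "card (verts G) = n" using Suc unfolding fam by auto
    then obtain K :: "nat hypergraph" where "small_conn d k r K" "card (verts K) = n + 1"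
      using small_conn_add_vertex[of d k r G] True d r by metis
    then show ?thesis unfolding fam by auto
  next
    case False
    then have "small_conn d k r (complete_hyp r {..<Suc n})" by (intro small_conn_complete) auto
    then show ?thesis unfolding fam by (auto intro!: exI[of _ "complete_hyp r {..<Suc n}"])
  qed
qed

lemma card_edges_sur:
  assumes "H \<in> hyp_family c r n k"
  shows "real (card (edges H)) - real (n choose r) + real ((n - k) choose r) = sur r k H"
  using card_edges_eq[of r H] assms small_conn_uniform[of d k r H] unfolding fam sur_def by auto

lemma finite_card_edges: "finite ((\<lambda>H. card (edges H)) ` hyp_family c r n k)"
proof (rule finite_subset)
  show "(\<lambda>H. card (edges H)) ` hyp_family c r n k \<subseteq> {..n choose r}"
  proof (rule image_subsetI)
    fix H assume H: "H \<in> hyp_family c r n k"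
    then have "real (card (edges H)) \<le> real (n choose r)"
      using card_edges_eq[OF small_conn_uniform, of d k r H] unfolding fam by auto
    then show "card (edges H) \<in> {..n choose r}" by simp
  qed
qed simp

lemma surplus_ge:
  assumes "H \<in> hyp_family c r n k" shows "sur r k H \<le> surplus c r n k"
proof -
  have "card (edges H) \<le> Max ((\<lambda>H. card (edges H)) ` hyp_family c r n k)"
    using assms finite_card_edges by (intro Max_ge) auto
  then have "real (card (edges H)) \<le> real (Max ((\<lambda>H. card (edges H)) ` hyp_family c r n k))" by simp
  then show ?thesis using card_edges_sur[OF assms] unfolding surplus_def by linarith
qed

lemma surplus_attained:
  obtains H where "H \<in> hyp_family c r n k" "surplus c r n k = sur r k H"
proof -
  have "Max ((\<lambda>H. card (edges H)) ` hyp_family c r n k) \<in> (\<lambda>H. card (edges H)) ` hyp_family c r n k"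
    using finite_card_edges fam_nonempty by (intro Max_in) auto
  then obtain H where "H \<in> hyp_family c r n k"
    "Max ((\<lambda>H. card (edges H)) ` hyp_family c r n k) = card (edges H)" by auto
  then show thesis using that card_edges_sur unfolding surplus_def by metis
qed

text \<open>With \<open>t + 1\<close> copies of \<open>H\<close> on a common \<open>S\<close>, the
  surplus per copy tends to that of \<open>H\<close> plus the number of missing sets inside
  \<open>S\<close>. So a single pair of \<open>H\<close> and \<open>S\<close> already gives a lower
  bound for the limit that contains the gain at \<open>S\<close>; all lower bounds below have this
  form.\<close>

lemma lim_rel_surplus_eq:
  obtains L where "lim_rel_surplus c r k = fact r / real k ^ (r - 1) * L" "L \<le> B"
    "\<And>(H :: nat hypergraph) S. small_conn d k r H \<Longrightarrow> S \<subseteq> verts H \<Longrightarrow> card S = k \<Longrightarrow> card (verts H) > k \<Longrightarrow>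
       sur r k H + real (card (missing r H \<inter> nsets S r)) \<le> L * (real (card (verts H)) - real k)"
proof -
  define a where "a x = surplus c r (k + x) k" for x
  have step: "a x \<le> a (Suc x)" for x
  proof -
    obtain H where H: "H \<in> hyp_family c r (k + x) k" "a x = sur r k H"
      unfolding a_def using surplus_attained by blast
    then obtain K :: "nat hypergraph" where "small_conn d k r K" "card (verts K) = k + x + 1" "sur r k K = sur r k H"
      using small_conn_add_vertex[of d k r H] d r unfolding fam by auto
    then show ?thesis using H surplus_ge[of K "k + Suc x"] unfolding a_def fam by simp
  qed
  have mono: "a x \<le> a y" if "x \<le> y" for x y using lift_Suc_mono_le[of a, OF step that] .
  have a0: "a 0 \<ge> 0"
  proof -
    have "complete_hyp r {..<k} \<in> hyp_family c r (k + 0) k" unfolding fam by (simp add: small_conn_complete)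
    from surplus_ge[OF this] show ?thesis unfolding a_def using r by (simp add: sur_complete)
  qed
  have many: "real (Suc t) * sur r k H + real t * real (card (missing r H \<inter> nsets S r)) \<le> a (Suc t * (card (verts H) - k))"
    if H: "small_conn d k r H" "S \<subseteq> verts H" "card S = k" for H :: "nat hypergraph" and S t
  proof -
    have "r \<ge> 1" using r by simp
    then obtain G :: "nat hypergraph" where "small_conn d k r G" "card (verts G) = k + Suc t * (card (verts H) - k)"
      "sur r k G = real (Suc t) * sur r k H + real t * real (card (missing r H \<inter> nsets S r))"
      using glue_many_copies[OF H, where t = t] by blast
    then show ?thesis using surplus_ge[of G "k + Suc t * (card (verts H) - k)"] unfolding a_def fam by simp
  qed
  have super: "a (t * x) \<ge> real t * a x" if "t \<ge> 1" for t x
  proof -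
    obtain H where H: "H \<in> hyp_family c r (k + x) k" "a x = sur r k H"
      unfolding a_def using surplus_attained by blast
    obtain S where S: "S \<subseteq> verts H" "card S = k"
      using obtain_subset_with_card_n[of k "verts H"] H unfolding fam by auto
    obtain t' where t': "t = Suc t'" using \<open>t \<ge> 1\<close> by (cases t) auto
    have "real (Suc t') * sur r k H + real t' * real (card (missing r H \<inter> nsets S r)) \<le> a (t * x)"
      using many[of H S t'] H S t' unfolding fam by simp
    moreover have "0 \<le> real t' * real (card (missing r H \<inter> nsets S r))" by simp
    ultimately have "real (Suc t') * sur r k H \<le> a (t * x)" by linarith
    then show ?thesis unfolding H(2) t' .
  qed
  have "a x \<le> B * real x" if "x \<ge> 1" for x
  proof -
    obtain H where H: "H \<in> hyp_family c r (k + x) k" "a x = sur r k H"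
      unfolding a_def using surplus_attained by blast
    then show ?thesis using bound[of H] that unfolding fam by simp
  qed
  from superadditive_limit[OF mono a0 super this] obtain L where
    L: "(\<lambda>x. a x / real x) \<longlonglongrightarrow> L" "\<And>x. a x \<le> L * real x" "L \<le> B" by blast
  have eq: "(\<lambda>x. rel_surplus c r (x + k) k) = (\<lambda>x. fact r / real k ^ (r - 1) * (a x / real x))"
    by (auto simp: rel_surplus_def a_def add.commute)
  have "(\<lambda>x. rel_surplus c r (x + k) k) \<longlonglongrightarrow> fact r / real k ^ (r - 1) * L"
    unfolding eq by (rule tendsto_mult_left[OF L(1)])
  then have "lim_rel_surplus c r k = fact r / real k ^ (r - 1) * L"
    unfolding lim_rel_surplus_def by (intro limI) (rule LIMSEQ_offset)
  moreover have "sur r k H + real (card (missing r H \<inter> nsets S r)) \<le> L * (real (card (verts H)) - real k)"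
    if H: "small_conn d k r H" "S \<subseteq> verts H" "card S = k" "card (verts H) > k" for H :: "nat hypergraph" and S
  proof -
    define x where "x = card (verts H) - k"
    define m where "m = real (card (missing r H \<inter> nsets S r))"
    \<comment> \<open>The first copy has nothing to be glued to, so one of \<open>t + 1\<close>
      gains is absent; the deficit vanishes in the limit.\<close>
    have "sur r k H + m - m / real (Suc t) \<le> L * real x" for t
    proof -
      have "real (Suc t) * sur r k H + real t * m \<le> L * real (Suc t * x)"
        using many[OF H(1-3), of t] L(2) unfolding x_def m_def by (rule order_trans)
      then have "(real (Suc t) * sur r k H + real t * m) / real (Suc t) \<le> L * real (Suc t * x) / real (Suc t)"
        by (intro divide_right_mono) auto
      moreover have "L * real (Suc t * x) / real (Suc t) = L * real x"
        by (simp only: of_nat_mult) (simp del: of_nat_Suc)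
      moreover have "(real (Suc t) * sur r k H + real t * m) / real (Suc t) = sur r k H + m - m / real (Suc t)"
        by (simp add: field_simps)
      ultimately show ?thesis by simp
    qed
    moreover have "(\<lambda>t. sur r k H + m - m / real (Suc t)) \<longlonglongrightarrow> sur r k H + m - 0"
      by (intro tendsto_intros LIMSEQ_Suc[OF lim_const_over_n])
    ultimately have "sur r k H + m - 0 \<le> L * real x" by (intro LIMSEQ_le_const2) auto
    then show ?thesis using H(4) by (simp add: x_def m_def of_nat_diff)
  qed
  ultimately show thesis using L(3) that by blast
qed

end

section \<open>Extended binomial coefficients\<close>

text \<open>Below \<open>r - 1\<close> the factor for \<open>j = r - 1\<close> is cut off to 0. In
  this form every factor is nonnegative, nondecreasing and convex, which transfers to the
  product.\<close>

lemma ext_binomial_prod: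
  assumes "r \<ge> 1" shows "ext_binomial x r = (\<Prod>j<r. max 0 (x - real j)) / fact r"
proof (cases "x \<ge> real r - 1")
  case True
  have "(\<Prod>j<r. max 0 (x - real j)) = (\<Prod>j<r. x - real j)" using True by (intro prod.cong) auto
  then show ?thesis using True by (simp add: ext_binomial_def gbinomial_prod_rev atLeast0LessThan)
next
  case False
  have "max 0 (x - real (r - 1)) = 0" using False assms by (simp add: of_nat_diff)
  then have "(\<Prod>j<r. max 0 (x - real j)) = 0" using assms by (intro prod_zero) (auto intro!: bexI[of _ "r - 1"])
  then show ?thesis using False by (simp add: ext_binomial_def)
qed

lemma ext_binomial_of_nat: "r \<ge> 1 \<Longrightarrow> ext_binomial (real n) r = real (n choose r)"
  by (auto simp: ext_binomial_def binomial_gbinomial[symmetric] intro!: binomial_eq_0)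

lemma ext_binomial_nonneg: "r \<ge> 1 \<Longrightarrow> 0 \<le> ext_binomial x r"
  by (simp add: ext_binomial_prod prod_nonneg)

lemma ext_binomial_mono: "r \<ge> 1 \<Longrightarrow> x \<le> y \<Longrightarrow> ext_binomial x r \<le> ext_binomial y r"
  by (auto simp: ext_binomial_prod intro!: divide_right_mono prod_mono)

lemma ext_binomial_eq_0: "r \<ge> 1 \<Longrightarrow> x \<le> real r - 1 \<Longrightarrow> ext_binomial x r = 0"
  using ext_binomial_mono[of r x "real (r - 1)"] ext_binomial_nonneg[of r x] ext_binomial_of_nat[of r "r - 1"]
  by (simp add: of_nat_diff binomial_eq_0)

lemma convex_on_pos_part: "convex_on UNIV (\<lambda>x::real. max 0 (x - c))"
proof (rule convex_onI)
  fix t x y :: real assume t: "0 < t" "t < 1"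
  have "(1 - t) * (x - c) \<le> (1 - t) * max 0 (x - c)" "t * (y - c) \<le> t * max 0 (y - c)"
    using t by (auto intro!: mult_left_mono)
  moreover have "0 \<le> (1 - t) * max 0 (x - c)" "0 \<le> t * max 0 (y - c)" using t by auto
  ultimately show "max 0 ((1 - t) *\<^sub>R x + t *\<^sub>R y - c) \<le> (1 - t) * max 0 (x - c) + t * max 0 (y - c)"
    by (cases "(1 - t) * x + t * y \<ge> c") (simp_all add: algebra_simps)
qed simp

lemma convex_on_ext_binomial:
  assumes "r \<ge> 1" shows "convex_on UNIV (\<lambda>x. ext_binomial x r)"
proof -
  have "convex_on UNIV (\<lambda>x. \<Prod>j<n. max 0 (x - real j))" for n
  proof (induction n)
    case 0 then show ?case by (simp add: convex_on_const)
  next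
    case (Suc n)
    have "convex_on UNIV (\<lambda>x. (\<Prod>j<n. max 0 (x - real j)) * max 0 (x - real n))"
      by (intro convex_on_mul Suc convex_on_pos_part) (auto simp: mono_on_def intro!: prod_mono prod_nonneg)
    then show ?case by simp
  qed
  then show ?thesis unfolding ext_binomial_prod[OF assms]
    using convex_on_cdiv[of "fact r"] by fastforce
qed

lemma ext_binomial_scale:
  assumes "r \<ge> 1" "0 \<le> y" "y \<le> 1" shows "ext_binomial (y * x) r \<le> y * ext_binomial x r"
  using convex_onD[OF convex_on_ext_binomial[OF assms(1)] assms(2,3), of 0 x]
    ext_binomial_of_nat[OF assms(1), of 0] assms(1) by (simp add: binomial_eq_0)

lemma ext_binomial_add_one:
  assumes "r \<ge> 1" "x \<ge> real r - 1"
  shows "ext_binomial (x + 1) r = ext_binomial x r + (x gchoose (r - 1))"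
proof -
  obtain q where "r = Suc q" using assms by (cases r) auto
  then show ?thesis using assms by (simp add: ext_binomial_def gbinomial_Suc_Suc)
qed

text \<open>By convexity the chord from \<open>b\<close> to \<open>a\<close> is no steeper than the
  chord from \<open>a\<close> to \<open>a + 1\<close>, and Pascal's rule gives the slope of the
  latter.\<close>

lemma ext_binomial_slope:
  assumes r: "r \<ge> 1" and a: "a \<ge> real r - 1" and b: "b \<le> a"
  shows "ext_binomial a r - ext_binomial b r \<le> (a - b) * (a gchoose (r - 1))"
proof (cases "b = a")
  case False
  then have ba: "b < a" using b by simp
  let ?f = "\<lambda>x. ext_binomial x r"
  have "(?f b - ?f a) / (b - a) \<le> (?f b - ?f (a + 1)) / (b - (a + 1))"
    "(?f b - ?f (a + 1)) / (b - (a + 1)) \<le> (?f a - ?f (a + 1)) / (a - (a + 1))"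
    using convex_on_slope_le[OF convex_on_ext_binomial[OF r], of b "a + 1" a] ba by auto
  then have "(?f a - ?f b) / (a - b) \<le> a gchoose (r - 1)"
    using ext_binomial_add_one[OF r a] by (simp add: minus_divide_divide[symmetric, of "?f b - ?f a"] del: minus_divide_divide)
  then show ?thesis using ba by (simp add: field_simps)
qed simp

text \<open>The saving \<open>1 / p\<close> comes from the first two of the
  \<open>r - 1 \<ge> 2\<close> factors, the others being compared one by one. A single factor could
  not give it, as \<open>k / p\<close> exceeds \<open>(k - 1) / p\<close>.\<close>

lemma gbinomial_quotient_le:
  assumes r: "r \<ge> 3" and p: "p \<ge> 2" and a: "real k / real p \<ge> real r - 1"
  shows "(real k / real p) gchoose (r - 1) \<le> real ((k - 1) choose (r - 1)) / real p"
proof -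
  obtain q where q: "r - 1 = Suc (Suc q)" using r by (metis Suc_diff_Suc Suc_1 diff_Suc_1 le_Suc_ex numeral_3_eq_3 plus_nat.simps(2))
  define a where "a = real k / real p"
  have p0: "real p \<ge> 2" using p by simp
  have aq: "a \<ge> real q + 2" using a q r unfolding a_def by (simp add: of_nat_diff)
  have ka: "real k = a * real p" using p0 unfolding a_def by simp
  have "a * 2 \<le> a * real p" using aq p0 by (intro mult_left_mono) auto
  then have k2: "2 * a \<le> real k" unfolding ka by simp
  have k1: "real (k - 1) = real k - 1" using k2 aq by (simp add: of_nat_diff)
  have first: "a * (a - 1) \<le> (real k - 1) * (real k - 2) / real p"
  proof -
    have "real p * (a * (a - 1)) = real k * (a - 1)" unfolding ka by (simp add: algebra_simps)
    also have "\<dots> \<le> real k * (real k / 2 - 1)" using k2 by (intro mult_left_mono) auto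
    also have "\<dots> \<le> (real k - 1) * (real k - 2)"
    proof -
      have "0 \<le> (real k - 2) * (real k - 2)" by simp
      then show ?thesis by (simp add: field_simps)
    qed
    finally show ?thesis using p0 by (simp add: field_simps)
  qed
  have rest: "(\<Prod>i<q. a - real (Suc (Suc i))) \<le> (\<Prod>i<q. real k - 1 - real (Suc (Suc i)))"
    using aq k2 by (intro prod_mono) auto
  have rest0: "0 \<le> (\<Prod>i<q. a - real (Suc (Suc i)))" using aq by (intro prod_nonneg) auto
  have expand: "(\<Prod>i<Suc (Suc q). x - real i) = x * (x - 1) * (\<Prod>i<q. x - real (Suc (Suc i)))" for x :: real
    by (simp add: prod.lessThan_Suc_shift del: prod.lessThan_Suc)
  have "(\<Prod>i<Suc (Suc q). a - real i) \<le> (\<Prod>i<Suc (Suc q). (real k - 1) - real i) / real p"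
  proof -
    have "0 \<le> (real k - 1) * (real k - 2) / real p" using aq k2 by (intro divide_nonneg_nonneg mult_nonneg_nonneg) auto
    from mult_mono[OF first rest this rest0] show ?thesis unfolding expand by (simp add: diff_diff_eq)
  qed
  then have "(\<Prod>i<Suc (Suc q). a - real i) / fact (Suc (Suc q)) \<le> (\<Prod>i<Suc (Suc q). (real k - 1) - real i) / real p / fact (Suc (Suc q))"
    by (intro divide_right_mono) auto
  then show ?thesis unfolding binomial_gbinomial k1 gbinomial_prod_rev q a_def[symmetric] atLeast0LessThan
    by (simp add: field_simps)
qed

lemma sum_ext_binomial_ge:
  assumes r: "r \<ge> 1" and p: "p \<ge> 1"
  shows "real p * ext_binomial ((\<Sum>i<p. x i) / real p) r \<le> (\<Sum>i<p. ext_binomial (x i) r)"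
proof -
  have "ext_binomial (\<Sum>i<p. (1 / real p) *\<^sub>R x i) r \<le> (\<Sum>i<p. (1 / real p) * ext_binomial (x i) r)"
    using p by (intro convex_on_sum[OF _ _ convex_on_ext_binomial[OF r]]) (auto simp: lessThan_empty_iff)
  then have "ext_binomial ((\<Sum>i<p. x i) / real p) r \<le> (\<Sum>i<p. ext_binomial (x i) r) / real p"
    by (simp add: sum_divide_distrib)
  then show ?thesis using p by (simp add: field_simps)
qed

lemma binomial_diff_le:
  assumes "m \<le> n" "r \<ge> 1"
  shows "real (n choose r) - real (m choose r) \<le> real (n - m) * real ((n - 1) choose (r - 1))"
  using assms(1)
proof (induction n rule: dec_induct)
  case base then show ?case by simp
next
  case (step n)
  obtain q where q: "r = Suc q" using assms by (cases r) auto
  have "real (n - m) * real ((n - 1) choose q) \<le> real (n - m) * real (n choose q)"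
    by (intro mult_left_mono) (auto intro!: binomial_right_mono)
  then show ?case using step by (simp add: q Suc_diff_le algebra_simps)
qed

text \<open>\<open>s i\<close> is the share of a \<open>k\<close>-set in the i-th piece, and
  \<open>t\<close> bounds the part outside all pieces. Jensen's inequality puts the minimum at equal
  shares; moving the mean share up to \<open>k / p\<close> shifts the argument by at most
  \<open>t / p\<close>, and the slope estimate turns this into the error term. If
  \<open>k / p\<close> is below \<open>r - 1\<close>, the main term vanishes.\<close>

lemma spread_lower_bound:
  assumes r: "r \<ge> 3" and p: "p \<ge> 1" and le: "(\<Sum>i<p. s i) \<le> k" and ge: "k \<le> (\<Sum>i<p. s i) + t"
  shows "real p * ext_binomial (real k / real p) r - real t * real ((k - 1) choose (r - 1)) / real p
      \<le> (\<Sum>i<p. real (s i choose r))"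
proof -
  let ?K = "real ((k - 1) choose (r - 1))"
  define m where "m = (\<Sum>i<p. s i)"
  have r1: "r \<ge> 1" using r by simp
  show ?thesis
  proof (cases "p = 1")
    case True
    have "real (k choose r) - real (s 0 choose r) \<le> real (k - s 0) * ?K"
      using le True r1 by (intro binomial_diff_le) auto
    also have "\<dots> \<le> real t * ?K" using ge True by (intro mult_right_mono) auto
    finally show ?thesis using True r1 by (simp add: ext_binomial_of_nat)
  next
    case False
    then have p2: "p \<ge> 2" using p by simp
    let ?a = "real k / real p" and ?b = "real m / real p"
    have jensen: "real p * ext_binomial ?b r \<le> (\<Sum>i<p. real (s i choose r))"
      using sum_ext_binomial_ge[OF r1 p, of "\<lambda>i. real (s i)"] r1 by (simp add: ext_binomial_of_nat m_def)
    show ?thesis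
    proof (cases "?a \<ge> real r - 1")
      case True
      have ba: "?b \<le> ?a" using le by (intro divide_right_mono) (auto simp: m_def simp flip: of_nat_sum)
      have "ext_binomial ?a r - ext_binomial ?b r \<le> (?a - ?b) * (?a gchoose (r - 1))"
        by (rule ext_binomial_slope[OF r1 True ba])
      also have "\<dots> \<le> (?a - ?b) * (?K / real p)"
        using ba gbinomial_quotient_le[OF r p2 True] by (intro mult_left_mono) auto
      finally have "real p * (ext_binomial ?a r - ext_binomial ?b r) \<le> real p * ((?a - ?b) * (?K / real p))"
        by (intro mult_left_mono) auto
      also have "\<dots> = (real k - real m) * (?K / real p)" using p by (simp add: field_simps)
      also have "\<dots> \<le> real t * (?K / real p)" using ge unfolding m_def[symmetric] by (intro mult_right_mono) auto
      finally show ?thesis using jensen by (simp add: algebra_simps)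
    next
      case a: False
      then have "ext_binomial ?a r = 0" using r1 by (intro ext_binomial_eq_0) auto
      moreover have "0 \<le> (\<Sum>i<p. real (s i choose r))" by (intro sum_nonneg) auto
      moreover have "0 \<le> real t * ?K / real p" by simp
      ultimately show ?thesis by (simp only:)
    qed
  qed
qed

lemma binomial_power_ratio:
  assumes "x \<le> d"
  shows "real (x choose r) * real d ^ r \<le> real x ^ r * real (d choose r)"
proof (induction r)
  case (Suc r)
  have rec: "real (Suc r) * real (n choose Suc r) = real (n choose r) * (real n - real r)" for n
    using gbinomial_mult_1[of "real n" r] unfolding binomial_gbinomial by (simp add: algebra_simps)
  show ?case
  proof (cases "r < x")
    case True
    have "real (Suc r) * (real (x choose Suc r) * real d ^ Suc r) = (real (x choose r) * real d ^ r) * ((real x - real r) * real d)"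
    proof -
      have "real (Suc r) * (real (x choose Suc r) * real d ^ Suc r) = (real (Suc r) * real (x choose Suc r)) * real d ^ Suc r"
        by (simp only: mult.assoc)
      then show ?thesis unfolding rec by simp
    qed
    also have "\<dots> \<le> (real x ^ r * real (d choose r)) * (real x * (real d - real r))"
    proof (rule mult_mono[OF Suc])
      have "real r * real x \<le> real r * real d" using assms by (intro mult_left_mono) auto
      then show "(real x - real r) * real d \<le> real x * (real d - real r)" by (simp add: algebra_simps)
    qed (use True in auto)
    also have "\<dots> = real (Suc r) * (real x ^ Suc r * real (d choose Suc r))"
    proof -
      have "real (Suc r) * (real x ^ Suc r * real (d choose Suc r)) = (real (Suc r) * real (d choose Suc r)) * real x ^ Suc r"
        by (simp only: mult.commute mult.left_commute)
      then show ?thesis unfolding rec by (simp only: power_Suc mult.commute mult.left_commute)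
    qed
    finally show ?thesis by (simp del: of_nat_Suc)
  qed (simp add: binomial_eq_0)
qed simp

text \<open>This is the perspective of a convex function. For an integer \<open>p\<close> it bounds
  from below the number of r-sets inside pieces when a set of size \<open>z\<close> is spread over
  \<open>p\<close> of them; its convexity in \<open>p\<close> makes balanced merging
  optimal.\<close>

lemma convex_on_perspective:
  assumes "r \<ge> 1" shows "convex_on {0<..} (\<lambda>p. p * ext_binomial (z / p) r)"
proof (rule convex_onI)
  fix t u v :: real assume t: "0 < t" "t < 1" and uv: "u \<in> {0<..}" "v \<in> {0<..}"
  define s where "s = (1 - t) * u + t * v"
  have s: "s > 0" unfolding s_def using t uv by (auto intro!: add_pos_pos)
  \<comment> \<open>The weight that makes \<open>z / s\<close> a convex combination of
    \<open>z / u\<close> and \<open>z / v\<close>.\<close>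
  define \<alpha> where "\<alpha> = t * v / s"
  have \<alpha>: "0 \<le> \<alpha>" "1 - \<alpha> = (1 - t) * u / s" using t uv s unfolding \<alpha>_def by (auto simp: field_simps s_def)
  have "0 \<le> (1 - t) * u / s" using t uv s by auto
  then have \<alpha>1: "\<alpha> \<le> 1" using \<alpha>(2) by linarith
  have "z / s = (1 - \<alpha>) *\<^sub>R (z / u) + \<alpha> *\<^sub>R (z / v)"
    unfolding \<alpha>(2) unfolding \<alpha>_def using uv s by (simp add: field_simps)
  then have "ext_binomial (z / s) r \<le> (1 - \<alpha>) * ext_binomial (z / u) r + \<alpha> * ext_binomial (z / v) r"
    using convex_onD[OF convex_on_ext_binomial[OF assms] \<alpha>(1) \<alpha>1, of "z / u" "z / v"] by simp
  then have "s * ext_binomial (z / s) r \<le> s * ((1 - \<alpha>) * ext_binomial (z / u) r + \<alpha> * ext_binomial (z / v) r)"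
    using s by (intro mult_left_mono) auto
  also have "\<dots> = (1 - t) * (u * ext_binomial (z / u) r) + t * (v * ext_binomial (z / v) r)"
    unfolding \<alpha>(2) unfolding \<alpha>_def using s by (simp add: field_simps)
  finally show "((1 - t) *\<^sub>R u + t *\<^sub>R v) * ext_binomial (z / ((1 - t) *\<^sub>R u + t *\<^sub>R v)) r
     \<le> (1 - t) * (u * ext_binomial (z / u) r) + t * (v * ext_binomial (z / v) r)"
    by (simp add: s_def)
qed simp

lemma convex_on_four_points:
  fixes f :: "real \<Rightarrow> real"
  assumes f: "convex_on S f" and S: "a \<in> S" "b \<in> S" and x: "a \<le> x" "x \<le> b"
  shows "f x + f (a + b - x) \<le> f a + f b"
proof (cases "a = b")
  case True then show ?thesis using x by simp
next
  case False
  then have ab: "a < b" using x by simp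
  define t where "t = (x - a) / (b - a)"
  have t: "0 \<le> t" "t \<le> 1" "t * (b - a) = x - a" using ab x by (auto simp: t_def field_simps)
  have "x = (1 - t) *\<^sub>R a + t *\<^sub>R b" "a + b - x = (1 - (1 - t)) *\<^sub>R a + (1 - t) *\<^sub>R b"
    using t(3) by (simp_all add: algebra_simps)
  moreover have "f ((1 - t) *\<^sub>R a + t *\<^sub>R b) \<le> (1 - t) * f a + t * f b"
    by (rule convex_onD[OF f t(1,2) S])
  moreover have "f ((1 - (1 - t)) *\<^sub>R a + (1 - t) *\<^sub>R b) \<le> (1 - (1 - t)) * f a + (1 - t) * f b"
    by (rule convex_onD[OF f _ _ S]) (use t in auto)
  ultimately have "f x \<le> (1 - t) * f a + t * f b" "f (a + b - x) \<le> (1 - (1 - t)) * f a + (1 - t) * f b"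
    by metis+
  then show ?thesis by (simp add: algebra_simps)
qed

section \<open>Upper bounds\<close>

lemma finite_cut:
  assumes "finite (verts H)" "cut H A B T"
  shows "finite A" "finite B" "finite T"
  using assms finite_subset unfolding cut_def by auto

lemma cut_sym: "cut H A B T \<Longrightarrow> cut H B A T"
  by (auto simp: cut_def)

lemma cross_subset_missing:
  assumes "cut H A B T" shows "cross r A B \<subseteq> missing r H"
proof
  fix e assume e: "e \<in> cross r A B"
  then have sub: "e \<in> nsets (A \<union> B) r" "\<not> e \<subseteq> A" "\<not> e \<subseteq> B" by (auto simp: cross_def nsets_def)
  have "e \<inter> T = {}" using sub assms by (auto simp: cut_def nsets_def)
  then have "e \<notin> edges H" using sub assms by (auto simp: cut_def)
  then show "e \<in> missing r H" using sub assms by (auto simp: cut_def missing_def nsets_def)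
qed

text \<open>The pieces \<open>Z i\<close> play the role of complete leaves relative to the subset \<open>X\<close> of the missing edges; \<open>t\<close> bounds
  the number of vertices outside all pieces.\<close>

definition pieces :: "nat \<Rightarrow> 'a hypergraph \<Rightarrow> 'a set set \<Rightarrow> nat \<Rightarrow> nat \<Rightarrow> bool" where
  "pieces r H X p t \<longleftrightarrow> X \<subseteq> missing r H \<and> p \<ge> 1 \<and>
     (\<exists>Z :: nat \<Rightarrow> 'a set. (\<forall>i<p. Z i \<subseteq> verts H) \<and> disjoint_family_on Z {..<p} \<and>
        card (verts H - (\<Union>i<p. Z i)) \<le> t \<and> (\<forall>i<p. nsets (Z i) r \<inter> X = {}))"

text \<open>No r-set inside a piece belongs to \<open>X\<close>, so the sets of \<open>X\<close>
  inside \<open>T\<close> are at most all r-sets of \<open>T\<close> minus those contained in a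
  single piece, and \<open>spread_lower_bound\<close> counts the latter.\<close>

lemma pieces_gain:
  assumes pc: "pieces r H X p t" and T: "T \<subseteq> verts H" "card T = k" and fin: "finite (verts H)" and r: "r \<ge> 3"
  shows "real (card (X \<inter> nsets T r)) \<le> real (k choose r) - real p * ext_binomial (real k / real p) r
     + real t * real ((k - 1) choose (r - 1)) / real p"
proof -
  obtain Z :: "nat \<Rightarrow> 'a set" where p: "p \<ge> 1" and Z: "\<And>i. i < p \<Longrightarrow> Z i \<subseteq> verts H" "disjoint_family_on Z {..<p}"
    "card (verts H - (\<Union>i<p. Z i)) \<le> t" "\<And>i. i < p \<Longrightarrow> nsets (Z i) r \<inter> X = {}"
    using pc unfolding pieces_def by blast
  have finT: "finite T" using T fin finite_subset by blast
  define s where "s i = card (T \<inter> Z i)" for i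
  have disj: "disjoint_family_on (\<lambda>i. T \<inter> Z i) {..<p}" using Z(2) by (auto simp: disjoint_family_on_def)
  have sums: "(\<Sum>i<p. s i) = card (T \<inter> (\<Union>i<p. Z i))"
  proof -
    have "card (\<Union>i<p. T \<inter> Z i) = (\<Sum>i<p. s i)"
      unfolding s_def using disj finT by (intro card_UN_disjoint) (auto simp: disjoint_family_on_def)
    moreover have "(\<Union>i<p. T \<inter> Z i) = T \<inter> (\<Union>i<p. Z i)" by auto
    ultimately show ?thesis by simp
  qed
  have le: "(\<Sum>i<p. s i) \<le> k" unfolding sums using T finT by (metis card_mono inf_le1)
  have "card T \<le> card (T \<inter> (\<Union>i<p. Z i)) + card (verts H - (\<Union>i<p. Z i))"
  proof -
    have "card T \<le> card ((T \<inter> (\<Union>i<p. Z i)) \<union> (verts H - (\<Union>i<p. Z i)))"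
      using T fin finT by (intro card_mono) auto
    also have "\<dots> \<le> card (T \<inter> (\<Union>i<p. Z i)) + card (verts H - (\<Union>i<p. Z i))" by (rule card_Un_le)
    finally show ?thesis .
  qed
  then have ge: "k \<le> (\<Sum>i<p. s i) + t" unfolding sums using T Z(3) by linarith
  let ?N = "\<Union>i<p. nsets (T \<inter> Z i) r"
  have "card ?N = (\<Sum>i<p. card (nsets (T \<inter> Z i) r))"
  proof (intro card_UN_disjoint ballI impI)
    fix i j assume ij: "i \<in> {..<p}" "j \<in> {..<p}" "i \<noteq> j"
    then have "Z i \<inter> Z j = {}" using Z(2) by (auto simp: disjoint_family_on_def)
    then show "nsets (T \<inter> Z i) r \<inter> nsets (T \<inter> Z j) r = {}" using r by (intro disjoint_nsets) auto
  qed (use finT in \<open>auto simp: finite_imp_finite_nsets\<close>)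
  also have "\<dots> = (\<Sum>i<p. s i choose r)" using finT by (simp add: card_nsets s_def)
  finally have N: "card ?N = (\<Sum>i<p. s i choose r)" .
  have finN: "finite (nsets T r)" using finT by (simp add: finite_imp_finite_nsets)
  have sub: "?N \<subseteq> nsets T r" by (auto simp: nsets_def)
  have "X \<inter> nsets T r \<subseteq> nsets T r - ?N"
  proof -
    have "nsets (T \<inter> Z i) r \<inter> X = {}" if "i < p" for i
      using Z(4)[OF that] nsets_mono[of "T \<inter> Z i" "Z i" r] by blast
    then show ?thesis by blast
  qed
  then have "card (X \<inter> nsets T r) \<le> card (nsets T r - ?N)" using finN by (intro card_mono) auto
  also have "\<dots> = (k choose r) - card ?N" using finite_subset[OF sub finN] sub T by (simp add: card_Diff_subset card_nsets)
  finally have "card (X \<inter> nsets T r) + (\<Sum>i<p. s i choose r) \<le> k choose r"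
    using N card_mono[OF finN sub] T by (simp add: card_nsets)
  then have "real (card (X \<inter> nsets T r)) + (\<Sum>i<p. real (s i choose r)) \<le> real (k choose r)"
    by (metis (no_types) of_nat_add of_nat_le_iff of_nat_sum)
  then show ?thesis using spread_lower_bound[OF r p le ge] by linarith
qed

text \<open>A missing edge inside the separator \<open>T\<close> is charged to one side only, here the second one.
  Making it the side with more pieces, the gain is measured by the side with fewer.\<close>

lemma pieces_merge:
  assumes fin: "finite (verts H)" and c: "cut H A B T" and r: "r \<ge> 1"
    and 1: "pieces r (induced H (A \<union> T)) X1 p1 t1" and 2: "pieces r (induced H (B \<union> T)) X2 p2 t2"
  shows "\<exists>X. pieces r H X (p1 + p2) (t1 + t2) \<and>
     real (card X) = real (card (cross r A B)) + real (card X1) + real (card X2) - real (card (X1 \<inter> nsets T r))"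
proof -
  obtain Z1 :: "nat \<Rightarrow> 'a set" where p1: "p1 \<ge> 1" and Z1: "\<And>i. i < p1 \<Longrightarrow> Z1 i \<subseteq> A \<union> T" "disjoint_family_on Z1 {..<p1}"
    "card (A \<union> T - (\<Union>i<p1. Z1 i)) \<le> t1" "\<And>i. i < p1 \<Longrightarrow> nsets (Z1 i) r \<inter> X1 = {}"
    using 1 unfolding pieces_def by auto
  obtain Z2 :: "nat \<Rightarrow> 'a set" where p2: "p2 \<ge> 1" and Z2: "\<And>i. i < p2 \<Longrightarrow> Z2 i \<subseteq> B \<union> T" "disjoint_family_on Z2 {..<p2}"
    "card (B \<union> T - (\<Union>i<p2. Z2 i)) \<le> t2" "\<And>i. i < p2 \<Longrightarrow> nsets (Z2 i) r \<inter> X2 = {}"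
    using 2 unfolding pieces_def by auto
  have V: "verts H = A \<union> B \<union> T" and disj: "A \<inter> B = {}" "A \<inter> T = {}" "B \<inter> T = {}" using c unfolding cut_def by auto
  have X1: "X1 \<subseteq> missing r H \<inter> nsets (A \<union> T) r"
    using 1 missing_induced[of "A \<union> T" H r] V unfolding pieces_def by auto
  have X2: "X2 \<subseteq> missing r H \<inter> nsets (B \<union> T) r"
    using 2 missing_induced[of "B \<union> T" H r] V unfolding pieces_def by auto
  \<comment> \<open>A piece of the second side may contain r-sets of \<open>T\<close> that belong to
    \<open>X1\<close>, so these are dropped from \<open>X\<close>. The pieces of the first side lose
    \<open>T\<close>, to be disjoint from those of the second.\<close>
  define X where "X = cross r A B \<union> (X1 - nsets T r) \<union> X2"
  define Z where "Z i = (if i < p1 then Z1 i - T else Z2 (i - p1))" for i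
  have sub: "X \<subseteq> missing r H" using cross_subset_missing[OF c] X1 X2 unfolding X_def by blast
  have ZV: "Z i \<subseteq> verts H" if "i < p1 + p2" for i
  proof (cases "i < p1")
    case True then show ?thesis using Z1(1)[of i] unfolding Z_def V by auto
  next
    case False
    then have "Z2 (i - p1) \<subseteq> B \<union> T" using that by (intro Z2(1)) auto
    then show ?thesis using False unfolding Z_def V by auto
  qed
  have disjZ: "disjoint_family_on Z {..<p1 + p2}"
    unfolding disjoint_family_on_def
  proof (intro ballI impI)
    fix i j assume ij: "i \<in> {..<p1 + p2}" "j \<in> {..<p1 + p2}" "i \<noteq> j"
    have AB: "(Z1 a - T) \<inter> Z2 b = {}" if "a < p1" "b < p2" for a b
      using Z1(1)[OF that(1)] Z2(1)[OF that(2)] disj by blast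
    show "Z i \<inter> Z j = {}"
    proof (cases "i < p1"; cases "j < p1")
      assume "i < p1" "j < p1"
      then show ?thesis using Z1(2) ij unfolding Z_def disjoint_family_on_def by fastforce
    next
      assume "i < p1" "\<not> j < p1"
      then show ?thesis using AB[of i "j - p1"] ij unfolding Z_def by simp
    next
      assume "\<not> i < p1" "j < p1"
      then show ?thesis using AB[of j "i - p1"] ij unfolding Z_def by (simp add: Int_commute)
    next
      assume a: "\<not> i < p1" "\<not> j < p1"
      then have "i - p1 \<in> {..<p2}" "j - p1 \<in> {..<p2}" "i - p1 \<noteq> j - p1" using ij by auto
      then have "Z2 (i - p1) \<inter> Z2 (j - p1) = {}" using Z2(2) unfolding disjoint_family_on_def by blast
      then show ?thesis using a unfolding Z_def by simp
    qed
  qed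
  \<comment> \<open>Removing \<open>T\<close> from the first pieces creates no new loose vertices: a
    vertex of \<open>T\<close> that no piece of the second side covers is already counted in
    \<open>t2\<close>.\<close>
  have "verts H - (\<Union>i<p1 + p2. Z i) \<subseteq> (A \<union> T - (\<Union>i<p1. Z1 i)) \<union> (B \<union> T - (\<Union>i<p2. Z2 i))"
  proof
    fix v assume v: "v \<in> verts H - (\<Union>i<p1 + p2. Z i)"
    then have vZ: "v \<notin> Z i" if "i < p1 + p2" for i using that by auto
    have "v \<notin> Z2 i" if "i < p2" for i using vZ[of "p1 + i"] that unfolding Z_def by simp
    moreover have "v \<notin> Z1 i - T" if "i < p1" for i using vZ[of i] that unfolding Z_def by simp
    ultimately show "v \<in> (A \<union> T - (\<Union>i<p1. Z1 i)) \<union> (B \<union> T - (\<Union>i<p2. Z2 i))"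
      using v disj unfolding V by auto
  qed
  moreover have finABT: "finite A" "finite B" "finite T" using fin c by (rule finite_cut)+
  ultimately have "card (verts H - (\<Union>i<p1 + p2. Z i)) \<le> card ((A \<union> T - (\<Union>i<p1. Z1 i)) \<union> (B \<union> T - (\<Union>i<p2. Z2 i)))"
    by (intro card_mono) auto
  also have "\<dots> \<le> t1 + t2" using Z1(3) Z2(3) card_Un_le by (meson add_mono le_trans)
  finally have rest: "card (verts H - (\<Union>i<p1 + p2. Z i)) \<le> t1 + t2" .
  have clean: "nsets (Z i) r \<inter> X = {}" if i: "i < p1 + p2" for i
  proof (cases "i < p1")
    case True
    then have "Z i = Z1 i - T" "Z i \<subseteq> A" using Z1(1)[OF True] unfolding Z_def by auto
    moreover have "nsets (Z1 i - T) r \<inter> X1 = {}" using Z1(4)[OF True] nsets_mono[of "Z1 i - T" "Z1 i" r] by blast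
    moreover have "nsets A r \<inter> X2 = {}"
    proof -
      have "A \<inter> (B \<union> T) = {}" using disj by blast
      then show ?thesis using disjoint_nsets[OF _ r] X2 by blast
    qed
    moreover have "nsets A r \<inter> cross r A B = {}" by (auto simp: cross_def)
    ultimately show ?thesis unfolding X_def using nsets_mono[of "Z i" A r] by auto
  next
    case False
    then have i2: "i - p1 < p2" "Z i = Z2 (i - p1)" using i unfolding Z_def by auto
    have "e \<in> nsets T r" if "e \<in> nsets (Z i) r" "e \<in> X1" for e
    proof -
      have "e \<subseteq> A \<union> T" using that(2) X1 by (auto simp: nsets_def)
      moreover have "e \<subseteq> B \<union> T" using that(1) Z2(1)[OF i2(1)] unfolding i2(2) by (auto simp: nsets_def)
      ultimately have "e \<subseteq> (B \<union> T) \<inter> (A \<union> T)" by blast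
      then have "e \<subseteq> T" using disj by blast
      then show ?thesis using that by (simp add: nsets_def)
    qed
    moreover have "e \<notin> cross r A B" if "e \<in> nsets (Z i) r" for e
    proof
      assume "e \<in> cross r A B"
      then have "e \<subseteq> A \<union> B" "\<not> e \<subseteq> B" by (auto simp: cross_def nsets_def)
      moreover have "e \<subseteq> B \<union> T" using that Z2(1)[OF i2(1)] unfolding i2(2) by (auto simp: nsets_def)
      ultimately show False using disj by blast
    qed
    ultimately show ?thesis unfolding X_def using Z2(4)[OF i2(1)] i2(2) by auto
  qed
  have "pieces r H X (p1 + p2) (t1 + t2)"
    unfolding pieces_def using sub p1 ZV disjZ rest clean by (intro conjI exI[of _ Z]) auto
  moreover have "real (card X) = real (card (cross r A B)) + real (card X1) + real (card X2) - real (card (X1 \<inter> nsets T r))"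
  proof -
    have finX: "finite X1" "finite X2" "finite (cross r A B)"
      using X1 X2 finite_missing[OF fin, of r] cross_subset_missing[OF c, of r] finite_subset by blast+
    have "X1 \<inter> X2 \<subseteq> nsets T r"
    proof
      fix e assume "e \<in> X1 \<inter> X2"
      then have "e \<subseteq> A \<union> T" "e \<subseteq> B \<union> T" "finite e" "card e = r" using X1 X2 by (auto simp: nsets_def)
      then show "e \<in> nsets T r" using disj by (auto simp: nsets_def)
    qed
    moreover have "cross r A B \<inter> (X1 \<union> X2) = {}"
    proof -
      have "e \<notin> cross r A B" if "e \<in> nsets (A \<union> T) r \<or> e \<in> nsets (B \<union> T) r" for e
      proof
        assume "e \<in> cross r A B"
        then have "e \<subseteq> A \<union> B" "\<not> e \<subseteq> A" "\<not> e \<subseteq> B" by (auto simp: cross_def nsets_def)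
        moreover have "e \<subseteq> A \<union> T \<or> e \<subseteq> B \<union> T" using that by (auto simp: nsets_def)
        ultimately show False using disj by blast
      qed
      then show ?thesis using X1 X2 by blast
    qed
    ultimately have "card X = card (cross r A B) + card (X1 - nsets T r) + card X2"
      unfolding X_def using finX by (subst card_Un_disjoint; (subst card_Un_disjoint)?) auto
    moreover have "card (X1 - nsets T r) = card X1 - card (X1 \<inter> nsets T r)"
      using finX by (simp add: card_Diff_subset_Int)
    moreover have "card (X1 \<inter> nsets T r) \<le> card X1" using finX by (simp add: card_mono)
    ultimately show ?thesis by (simp add: of_nat_diff)
  qed
  ultimately show ?thesis by blast
qed

lemma pieces_leaf: "finite (verts H) \<Longrightarrow> pieces r H {} 1 0"
  unfolding pieces_def by (intro conjI exI[of _ "\<lambda>_. verts H"]) (auto simp: disjoint_family_on_def)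

text \<open>The side \<open>A\<close> forms no piece; its vertices become loose. Since
  \<open>X2\<close> is kept whole, no gain is paid at this separator, and the cost appears only
  later through the larger \<open>t\<close>.\<close>

lemma pieces_absorb:
  assumes fin: "finite (verts H)" and c: "cut H A B T" and r: "r \<ge> 1"
    and 2: "pieces r (induced H (B \<union> T)) X2 p2 t2"
  shows "pieces r H (cross r A B \<union> X2) p2 (t2 + card A)"
    "real (card (cross r A B \<union> X2)) = real (card (cross r A B)) + real (card X2)"
proof -
  obtain Z2 :: "nat \<Rightarrow> 'a set" where p2: "p2 \<ge> 1" and Z2: "\<And>i. i < p2 \<Longrightarrow> Z2 i \<subseteq> B \<union> T" "disjoint_family_on Z2 {..<p2}"
    "card (B \<union> T - (\<Union>i<p2. Z2 i)) \<le> t2" "\<And>i. i < p2 \<Longrightarrow> nsets (Z2 i) r \<inter> X2 = {}"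
    using 2 unfolding pieces_def by auto
  have V: "verts H = A \<union> B \<union> T" and disj: "A \<inter> B = {}" "A \<inter> T = {}" "B \<inter> T = {}" using c unfolding cut_def by auto
  have X2: "X2 \<subseteq> missing r H \<inter> nsets (B \<union> T) r"
    using 2 missing_induced[of "B \<union> T" H r] V unfolding pieces_def by auto
  have finABT: "finite A" "finite B" "finite T" using finite_cut[OF fin c] by auto
  have crossBT: "e \<notin> cross r A B" if "e \<subseteq> B \<union> T" for e
  proof
    assume "e \<in> cross r A B"
    then have "e \<subseteq> A \<union> B" "\<not> e \<subseteq> B" by (auto simp: cross_def nsets_def)
    then show False using that disj by blast
  qed
  have "card (verts H - (\<Union>i<p2. Z2 i)) \<le> card ((B \<union> T - (\<Union>i<p2. Z2 i)) \<union> A)"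
    unfolding V using finABT by (intro card_mono) auto
  also have "\<dots> \<le> t2 + card A" using Z2(3) card_Un_le by (meson add_mono le_trans order_refl)
  finally have rest: "card (verts H - (\<Union>i<p2. Z2 i)) \<le> t2 + card A" .
  have "nsets (Z2 i) r \<inter> (cross r A B \<union> X2) = {}" if "i < p2" for i
  proof -
    have "nsets (Z2 i) r \<inter> cross r A B = {}"
    proof (intro equals0I)
      fix e assume e: "e \<in> nsets (Z2 i) r \<inter> cross r A B"
      then have "e \<subseteq> Z2 i" by (simp add: nsets_def)
      then have "e \<subseteq> B \<union> T" using Z2(1)[OF that] by (rule subset_trans)
      then show False using crossBT e by blast
    qed
    then show ?thesis using Z2(4)[OF that] by blast
  qed
  moreover have "cross r A B \<union> X2 \<subseteq> missing r H" using cross_subset_missing[OF c] X2 by blast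
  moreover have "Z2 i \<subseteq> verts H" if "i < p2" for i using Z2(1)[OF that] V by blast
  ultimately show "pieces r H (cross r A B \<union> X2) p2 (t2 + card A)"
    unfolding pieces_def using p2 rest Z2(2) by (intro conjI exI[of _ Z2]) auto
  have "finite X2" "finite (cross r A B)"
    using X2 finite_missing[OF fin, of r] cross_subset_missing[OF c, of r] finite_subset by blast+
  moreover have "cross r A B \<inter> X2 = {}"
  proof -
    have "e \<subseteq> B \<union> T" if "e \<in> X2" for e using that X2 by (auto simp: nsets_def)
    then show ?thesis using crossBT by blast
  qed
  ultimately show "real (card (cross r A B \<union> X2)) = real (card (cross r A B)) + real (card X2)"
    by (simp add: card_Un_disjoint)
qed

lemma cut_card:
  assumes "finite (verts H)" "cut H A B T"
  shows "card (verts H) = card A + card B + card T" "card (A \<union> T) = card A + card T" "card (B \<union> T) = card B + card T"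
proof -
  have fin: "finite A" "finite B" "finite T" using finite_cut[OF assms] by auto
  have disj: "A \<inter> B = {}" "A \<inter> T = {}" "B \<inter> T = {}" and V: "verts H = A \<union> B \<union> T"
    using assms(2) by (auto simp: cut_def)
  show "card (A \<union> T) = card A + card T" "card (B \<union> T) = card B + card T"
    using fin disj by (simp_all add: card_Un_disjoint)
  have "(A \<union> B) \<inter> T = {}" using disj by blast
  then show "card (verts H) = card A + card B + card T" unfolding V using fin disj by (simp add: card_Un_disjoint)
qed

lemma small_conn_induced:
  assumes "small_conn d k r H" "W \<subseteq> verts H" shows "small_conn d k r (induced H W)"
  using small_conn_subgraph[OF assms(1) subgraph_induced[OF small_conn_uniform[OF assms(1)] assms(2)]] .

text \<open>\<open>psi N k r p\<close> is the budget that a structure with \<open>p\<close> pieces reserves for later merges: two equal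
  ones hold \<open>2 * psi N k r p\<close>, pay for the gain of their merge and keep \<open>psi N k r (2 * p)\<close>.\<close>

definition psi :: "nat \<Rightarrow> nat \<Rightarrow> nat \<Rightarrow> real \<Rightarrow> real" where
  "psi N k r p = real (k choose r) - (\<Sum>i<N. p * ext_binomial (real k / (2 ^ i * p)) r) / 2"

text \<open>Doubling \<open>p\<close> shifts the summation index by one. The term for
  \<open>i = 0\<close> becomes the gain of the merge, and the new last term is 0 by the choice of
  \<open>N\<close>.\<close>

lemma psi_double:
  assumes r: "r \<ge> 1" and N: "real k \<le> (real r - 1) * 2 ^ N" and p: "p \<ge> 1"
  shows "psi N k r (2 * p) = 2 * psi N k r p - (real (k choose r) - p * ext_binomial (real k / p) r)"
proof -
  let ?f = "\<lambda>i. p * ext_binomial (real k / (2 ^ i * p)) r"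
  have "real k / (2 ^ N * p) \<le> real k / 2 ^ N" using p by (intro divide_left_mono) auto
  also have "\<dots> \<le> real r - 1" using N by (simp add: field_simps)
  finally have z: "?f N = 0" using r by (simp add: ext_binomial_eq_0)
  have arith: "b = 2 * e \<Longrightarrow> a + z = q + e \<Longrightarrow> z = 0 \<Longrightarrow> c - b / 2 = 2 * (c - a / 2) - (c - q)"
    for a b c e q z :: real by (simp add: field_simps)
  have "(\<Sum>i<N. ?f i) + ?f N = ?f 0 + (\<Sum>i<N. ?f (Suc i))"
    using sum.lessThan_Suc_shift[of ?f N] unfolding sum.lessThan_Suc .
  moreover have "(\<Sum>i<N. 2 * p * ext_binomial (real k / (2 ^ i * (2 * p))) r) = 2 * (\<Sum>i<N. ?f (Suc i))"
    by (simp add: sum_distrib_left mult_ac)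
  moreover have "?f 0 = p * ext_binomial (real k / p) r" by simp
  ultimately show ?thesis using z arith unfolding psi_def by metis
qed

text \<open>\<open>psi\<close> is a constant minus a sum of perspectives, hence concave in
  \<open>p\<close>. Both \<open>2 * p1\<close> and \<open>p2\<close> lie between \<open>p1\<close>
  and \<open>p1 + p2\<close> and have the same sum as these two.\<close>

lemma psi_increments:
  assumes r: "r \<ge> 1" and p: "1 \<le> p1" "p1 \<le> p2"
  shows "psi N k r p1 + psi N k r (p1 + p2) \<le> psi N k r (2 * p1) + psi N k r p2"
proof -
  have "2 * p1 * ext_binomial (real k / (2 ^ i * (2 * p1))) r + p2 * ext_binomial (real k / (2 ^ i * p2)) r
     \<le> p1 * ext_binomial (real k / (2 ^ i * p1)) r + (p1 + p2) * ext_binomial (real k / (2 ^ i * (p1 + p2))) r" for i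
    using convex_on_four_points[OF convex_on_perspective[OF r, of "real k / 2 ^ i"], of p1 "p1 + p2" "2 * p1"] p
    by (simp add: field_simps)
  then have "(\<Sum>i<N. 2 * p1 * ext_binomial (real k / (2 ^ i * (2 * p1))) r + p2 * ext_binomial (real k / (2 ^ i * p2)) r)
     \<le> (\<Sum>i<N. p1 * ext_binomial (real k / (2 ^ i * p1)) r + (p1 + p2) * ext_binomial (real k / (2 ^ i * (p1 + p2))) r)"
    by (intro sum_mono)
  then show ?thesis unfolding psi_def sum.distrib by simp
qed

text \<open>Convexity through the origin bounds the i-th summand by
  \<open>(k choose r) / 2^i\<close>, and the halved sum by \<open>k choose r\<close>.\<close>

lemma psi_nonneg:
  assumes r: "r \<ge> 1" and p: "p \<ge> 1" shows "0 \<le> psi N k r p"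
proof -
  have "p * ext_binomial (real k / (2 ^ i * p)) r \<le> (1/2) ^ i * real (k choose r)" for i
  proof -
    have "2 ^ i * p \<ge> 1 * 1" using p by (intro mult_mono) auto
    then have y: "0 \<le> 1 / (2 ^ i * p)" "1 / (2 ^ i * p) \<le> 1" by auto
    have "p * ext_binomial (real k / (2 ^ i * p)) r \<le> p * (1 / (2 ^ i * p) * ext_binomial (real k) r)"
      using ext_binomial_scale[OF r y, of "real k"] p by (intro mult_left_mono) auto
    also have "\<dots> = (1/2) ^ i * real (k choose r)" using p r by (simp add: ext_binomial_of_nat power_divide)
    finally show ?thesis .
  qed
  then have "(\<Sum>i<N. p * ext_binomial (real k / (2 ^ i * p)) r) \<le> (\<Sum>i<N. (1/2) ^ i * real (k choose r))"
    by (intro sum_mono)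
  also have "\<dots> = (\<Sum>i<N. (1/2) ^ i) * real (k choose r)" by (simp add: sum_distrib_right)
  also have "\<dots> \<le> 2 * real (k choose r)"
  proof (rule mult_right_mono)
    show "(\<Sum>i<N. (1/2::real) ^ i) \<le> 2" by (simp add: geometric_sum)
  qed simp
  finally show ?thesis by (simp add: psi_def)
qed

section \<open>Upper bound above the threshold\<close>

text \<open>\<open>\<beta>\<close> is the price per vertex outside the separator. \<open>b1\<close>
  lets a full leaf of \<open>d\<close> such vertices pay for its edges and for the reserve
  \<open>psi\<close> of one piece; \<open>b2\<close> lets a tiny leaf pay the deposit
  \<open>2 * K\<close> for each of its vertices. The condition on \<open>N\<close> says that
  \<open>psi\<close> omits only vanishing terms.\<close>

locale upper =
  fixes k r d N :: nat and \<beta> :: real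
  assumes r: "r \<ge> 3" and rk: "r \<le> k" and kd: "k \<le> d" and N: "real k \<le> (real r - 1) * 2 ^ N"
    and b1: "\<beta> * real d \<ge> real (d choose r) + psi N k r 1"
    and b2: "\<beta> \<ge> 2 * real ((k - 1) choose (r - 1)) + psi N k r 1 / real d"
begin

abbreviation "\<gamma> \<equiv> psi N k r 1"
abbreviation "K \<equiv> real ((k - 1) choose (r - 1))"
abbreviation "D \<equiv> real (d choose r)"

lemma pos: "real d > 0" "D > 0" "r \<ge> 1"
  using r rk kd by auto

text \<open>The term \<open>i = 0\<close> of the sum is \<open>k choose r\<close>, which leaves at
  most half of it for \<open>\<gamma>\<close>. The factor 2 ensures that two tiny sides never make
  up more than \<open>d\<close> vertices.\<close>

lemma gamma_le: "2 * \<gamma> \<le> D"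
proof -
  have "N \<noteq> 0" using N r rk by (cases N) auto
  then have "ext_binomial (real k / 2 ^ 0) r \<le> (\<Sum>i<N. ext_binomial (real k / 2 ^ i) r)"
    using pos(3) by (intro member_le_sum) (auto simp: ext_binomial_nonneg)
  then have "2 * \<gamma> \<le> real (k choose r)" using pos(3) by (simp add: psi_def ext_binomial_of_nat)
  also have "\<dots> \<le> D" using kd by (simp add: binomial_right_mono)
  finally show ?thesis .
qed

lemma gamma_nonneg: "0 \<le> \<gamma>" using psi_nonneg[of r 1] pos by simp

lemma quad: assumes "x \<le> d" shows "real (x choose r) \<le> (real x / real d)\<^sup>2 * D"
proof -
  have "real (x choose r) \<le> (real x / real d) ^ r * D"
    using binomial_power_ratio[OF assms, of r] pos by (simp add: field_simps)
  also have "\<dots> \<le> (real x / real d)\<^sup>2 * D"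
    using assms pos r by (intro mult_right_mono power_decreasing) auto
  finally show ?thesis .
qed

text \<open>A leaf with \<open>x\<close> vertices outside its separator counts as a piece only if \<open>x * D \<ge> \<gamma> * d\<close>. Smaller leaves
  are absorbed as loose vertices, each of which pays \<open>2 * K / p\<close> for enlarging the gains of later merges.\<close>

lemma big_leaf: assumes "x \<le> d" "real x * D \<ge> \<gamma> * real d" shows "real (x choose r) \<le> \<beta> * real x - \<gamma>"
proof -
  define y where "y = real x / real d"
  have y: "0 \<le> y" "y \<le> 1" "real x = y * real d" using assms pos by (auto simp: y_def)
  have "y * D \<ge> \<gamma>" using assms(2) pos unfolding y(3) by (simp add: field_simps)
  \<comment> \<open>The claim amounts to
    \<open>y * y * D \<le> y * (D + \<gamma>) - \<gamma>\<close>, which rearranges to the size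
    threshold \<open>\<gamma> \<le> y * D\<close> multiplied by \<open>1 - y\<close>.\<close>
  then have "(1 - y) * \<gamma> \<le> (1 - y) * (y * D)" using y by (intro mult_left_mono) auto
  moreover have "y * (D + \<gamma>) \<le> y * (\<beta> * real d)" using b1 y by (intro mult_left_mono) auto
  moreover have "real (x choose r) \<le> y\<^sup>2 * D" using quad[OF assms(1)] by (simp add: y_def)
  ultimately show ?thesis unfolding y(3) by (simp add: algebra_simps power2_eq_square)
qed

lemma tiny_leaf: assumes "x \<le> d" "real x * D < \<gamma> * real d" shows "real (x choose r) \<le> (\<beta> - 2 * K) * real x"
proof -
  define y where "y = real x / real d"
  have y: "0 \<le> y" "y \<le> 1" "real x = y * real d" using assms pos by (auto simp: y_def)
  have "y * D \<le> \<gamma>" using assms(2) pos unfolding y(3) by (simp add: field_simps)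
  then have "y * (y * D) \<le> y * \<gamma>" using y by (intro mult_left_mono) auto
  moreover have "real (x choose r) \<le> y\<^sup>2 * D" using quad[OF assms(1)] by (simp add: y_def)
  moreover have "\<gamma> / real d * real x \<le> (\<beta> - 2 * K) * real x" using b2 by (intro mult_right_mono) auto
  ultimately show ?thesis using pos unfolding y(3) by (simp add: algebra_simps power2_eq_square)
qed

text \<open>The induction invariant. Counting only the sets in \<open>X\<close> overestimates the
  surplus, but in return the pieces behave like complete leaves. The right side withholds the
  reserve for later merges and \<open>2 * K / p\<close> for each loose vertex.\<close>

definition bounded :: "'a hypergraph \<Rightarrow> bool" where
  "bounded H \<longleftrightarrow> (\<exists>X p t. pieces r H X p t \<and>
     real ((card (verts H) - k) choose r) - real (card X)
       \<le> \<beta> * (real (card (verts H)) - real k) - psi N k r (real p) - real t * (2 * K / real p))"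

text \<open>\<open>psi_increments\<close> and \<open>psi_double\<close> together let the reserves
  pay the main part of the gain. A loose vertex on the side with fewer pieces has
  \<open>2 * K / p1\<close> at its disposal: half covers the error in the gain, the other half the
  new rate \<open>2 * K / (p1 + p2) \<le> K / p1\<close>. On the other side the rate only
  drops.\<close>

lemma merge_arith:
  assumes p: "1 \<le> p1" "p1 \<le> (p2 :: nat)"
    and v1: "v1 \<le> \<beta> * x1 - psi N k r (real p1) - real t1 * (2 * K / real p1)"
    and v2: "v2 \<le> \<beta> * x2 - psi N k r (real p2) - real t2 * (2 * K / real p2)"
    and g: "g \<le> real (k choose r) - real p1 * ext_binomial (real k / real p1) r + real t1 * K / real p1"
  shows "v1 + v2 + g \<le> \<beta> * (x1 + x2) - psi N k r (real (p1 + p2)) - real (t1 + t2) * (2 * K / real (p1 + p2))"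
proof -
  have pp: "real p1 \<ge> 1" "real p1 \<le> real p2" using p by auto
  have "psi N k r (real p1) + psi N k r (real p1 + real p2) \<le> psi N k r (2 * real p1) + psi N k r (real p2)"
    by (rule psi_increments[OF pos(3) pp])
  moreover have "psi N k r (2 * real p1) = 2 * psi N k r (real p1) - (real (k choose r) - real p1 * ext_binomial (real k / real p1) r)"
    by (rule psi_double[OF pos(3) N pp(1)])
  moreover have "2 * K / (real p1 + real p2) \<le> 2 * K / (2 * real p1)" using pp by (intro divide_left_mono) auto
  then have "real t1 * (2 * K / (real p1 + real p2)) \<le> real t1 * (K / real p1)" by (intro mult_left_mono) auto
  moreover have "2 * K / (real p1 + real p2) \<le> 2 * K / real p2" using pp by (intro divide_left_mono) auto
  then have "real t2 * (2 * K / (real p1 + real p2)) \<le> real t2 * (2 * K / real p2)" by (intro mult_left_mono) auto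
  moreover have "real t1 * (2 * K / real p1) = 2 * (real t1 * (K / real p1))" by simp
  moreover have "real t1 * K / real p1 = real t1 * (K / real p1)" by simp
  ultimately show ?thesis using v1 v2 g unfolding of_nat_add distrib_left distrib_right by linarith
qed

lemma bounded_merge:
  assumes fin: "finite (verts H)" and c: "cut H A B T" and T: "card T = k"
    and 1: "pieces r (induced H (A \<union> T)) X1 p1 t1"
    "real (card A choose r) - real (card X1) \<le> \<beta> * real (card A) - psi N k r (real p1) - real t1 * (2 * K / real p1)"
    and 2: "pieces r (induced H (B \<union> T)) X2 p2 t2"
    "real (card B choose r) - real (card X2) \<le> \<beta> * real (card B) - psi N k r (real p2) - real t2 * (2 * K / real p2)"
    and p: "p1 \<le> p2"
  shows "bounded H"
proof -
  have finABT: "finite A" "finite B" "finite T" using finite_cut[OF fin c] by auto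
  obtain X where X: "pieces r H X (p1 + p2) (t1 + t2)"
    "real (card X) = real (card (cross r A B)) + real (card X1) + real (card X2) - real (card (X1 \<inter> nsets T r))"
    using pieces_merge[OF fin c pos(3) 1(1) 2(1)] by blast
  have disj: "A \<inter> B = {}" using c by (simp add: cut_def)
  have gain: "real (card (X1 \<inter> nsets T r)) \<le> real (k choose r) - real p1 * ext_binomial (real k / real p1) r + real t1 * K / real p1"
    using pieces_gain[OF 1(1) _ T _ r] finABT by simp
  have p1: "1 \<le> p1" using 1(1) by (simp add: pieces_def)
  have "real ((card A + card B) choose r) - real (card X) =
    (real (card A choose r) - real (card X1)) + (real (card B choose r) - real (card X2)) + real (card (X1 \<inter> nsets T r))"
    using card_cross[OF finABT(1,2) disj pos(3)] X(2) by linarith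
  also have "\<dots> \<le> \<beta> * (real (card A) + real (card B)) - psi N k r (real (p1 + p2)) - real (t1 + t2) * (2 * K / real (p1 + p2))"
    by (rule merge_arith[OF p1 p 1(2) 2(2) gain])
  finally show ?thesis unfolding bounded_def using X(1) cut_card(1)[OF fin c] T
    by (intro exI[of _ X] exI[of _ "p1 + p2"] exI[of _ "t1 + t2"]) (simp add: algebra_simps)
qed

lemma bounded_absorb:
  assumes fin: "finite (verts H)" and c: "cut H A B T" and T: "card T = k"
    and A: "card A \<le> d" "real (card A) * D < \<gamma> * real d"
    and 2: "pieces r (induced H (B \<union> T)) X2 p2 t2"
    "real (card B choose r) - real (card X2) \<le> \<beta> * real (card B) - psi N k r (real p2) - real t2 * (2 * K / real p2)"
  shows "bounded H"
proof -
  let ?X = "cross r A B \<union> X2"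
  have finABT: "finite A" "finite B" "finite T" using finite_cut[OF fin c] by auto
  have disj: "A \<inter> B = {}" using c by (simp add: cut_def)
  have p2: "1 \<le> p2" using 2(1) by (simp add: pieces_def)
  have "2 * K / real p2 \<le> 2 * K / 1" using p2 by (intro divide_left_mono) auto
  then have "real (card A) * (2 * K / real p2) \<le> real (card A) * (2 * K)" by (intro mult_left_mono) auto
  moreover have "real (card A choose r) \<le> (\<beta> - 2 * K) * real (card A)" by (rule tiny_leaf[OF A])
  moreover have "real ((card A + card B) choose r) - real (card ?X) = real (card A choose r) + (real (card B choose r) - real (card X2))"
    using card_cross[OF finABT(1,2) disj pos(3)] pieces_absorb(2)[OF fin c pos(3) 2(1)] by linarith
  moreover have "real (t2 + card A) * (2 * K / real p2) = real t2 * (2 * K / real p2) + real (card A) * (2 * K / real p2)"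
    by (simp only: of_nat_add distrib_right)
  moreover have "(\<beta> - 2 * K) * real (card A) = \<beta> * real (card A) - real (card A) * (2 * K)" by (simp add: algebra_simps)
  moreover have "\<beta> * (real (card A) + real (card B)) = \<beta> * real (card A) + \<beta> * real (card B)" by (simp add: algebra_simps)
  ultimately have "real ((card A + card B) choose r) - real (card ?X) \<le> \<beta> * (real (card A) + real (card B)) - psi N k r (real p2) - real (t2 + card A) * (2 * K / real p2)"
    using 2(2) by linarith
  then show ?thesis unfolding bounded_def using pieces_absorb(1)[OF fin c pos(3) 2(1)] cut_card(1)[OF fin c] T
    by (intro exI[of _ ?X] exI[of _ p2] exI[of _ "t2 + card A"]) (simp add: algebra_simps)
qed

text \<open>Induction over the sizes, with tiny hypergraphs excluded because they cannot pay the
  reserve of a piece. A tiny side of a separator is absorbed instead; otherwise both sides are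
  merged, the one with fewer pieces in the first role.\<close>

lemma all_bounded:
  assumes "small_conn d k r H" "card (verts H) \<ge> k" "real (card (verts H) - k) * D \<ge> \<gamma> * real d"
  shows "bounded H"
  using assms
proof (induction "card (verts H)" arbitrary: H rule: less_induct)
  case less
  note fin = small_conn_finite[OF less.prems(1)]
  show ?case
  proof (cases "card (verts H) \<le> d + k")
    case True
    then have "real ((card (verts H) - k) choose r) \<le> \<beta> * real (card (verts H) - k) - \<gamma>"
      using less.prems by (intro big_leaf) auto
    then show ?thesis unfolding bounded_def using pieces_leaf[OF fin, of r] less.prems(2)
      by (intro exI[of _ "{}"] exI[of _ 1] exI[of _ 0]) (simp add: of_nat_diff)
  next
    case False
    obtain A B T where c: "cut H A B T" "A \<noteq> {}" "B \<noteq> {}" and T: "card T = k"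
      using small_conn_cut[OF less.prems(1)] False kd rk r by (metis (no_types, lifting) le_trans not_less one_le_numeral)
    have finABT: "finite A" "finite B" "finite T" using finite_cut[OF fin c(1)] by auto
    have sub: "A \<union> T \<subseteq> verts H" "B \<union> T \<subseteq> verts H" using c(1) by (auto simp: cut_def)
    note cards = cut_card[OF fin c(1)]
    have pAB: "card A > 0" "card B > 0" using finABT c by (auto simp: card_gt_0_iff)
    have IH: "bounded (induced H (A \<union> T))" if "real (card A) * D \<ge> \<gamma> * real d"
      using that cards T pAB small_conn_induced[OF less.prems(1) sub(1)] by (intro less.hyps) auto
    have IH': "bounded (induced H (B \<union> T))" if "real (card B) * D \<ge> \<gamma> * real d"
      using that cards T pAB small_conn_induced[OF less.prems(1) sub(2)] by (intro less.hyps) auto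
    have unf: "\<exists>X p t. pieces r (induced H (C \<union> T)) X p t \<and>
      real (card C choose r) - real (card X) \<le> \<beta> * real (card C) - psi N k r (real p) - real t * (2 * K / real p)"
      if "bounded (induced H (C \<union> T))" "card (C \<union> T) = card C + card T" for C
      using that T unfolding bounded_def by simp
    have xsum: "d < card A + card B" using False cards(1) T by simp
    have tiny_d: "card C \<le> d" if "real (card C) * D < \<gamma> * real d" for C :: "'a set"
    proof (rule ccontr)
      assume "\<not> card C \<le> d"
      then have "real d * D \<le> real (card C) * D" using pos by (intro mult_right_mono) auto
      moreover have "\<gamma> * real d \<le> D * real d" using gamma_le gamma_nonneg pos by (intro mult_right_mono) auto
      ultimately show False using that by (simp add: mult.commute)
    qed
    show ?thesis
    proof (cases "real (card A) * D < \<gamma> * real d")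
      case tA: True
      \<comment> \<open>If both sides were tiny, \<open>gamma_le\<close> would leave fewer than
        \<open>d\<close> vertices outside \<open>T\<close>, against
        \<open>card (verts H) > d + k\<close>.\<close>
      have "real (card B) * D \<ge> \<gamma> * real d"
      proof (rule ccontr)
        assume "\<not> ?thesis"
        then have "(real (card A) + real (card B)) * D < 2 * \<gamma> * real d" using tA by (simp add: algebra_simps)
        also have "\<dots> \<le> D * real d" using gamma_le pos by (intro mult_right_mono) auto
        finally have "real (card A) + real (card B) < real d" using pos by simp
        then show False using xsum by simp
      qed
      then obtain X p t where "pieces r (induced H (B \<union> T)) X p t"
        "real (card B choose r) - real (card X) \<le> \<beta> * real (card B) - psi N k r (real p) - real t * (2 * K / real p)"
        using unf[OF IH' cards(3)] by blast
      then show ?thesis by (rule bounded_absorb[OF fin c(1) T tiny_d[OF tA] tA])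
    next
      case A: False
      then obtain X1 p1 t1 where 1: "pieces r (induced H (A \<union> T)) X1 p1 t1"
        "real (card A choose r) - real (card X1) \<le> \<beta> * real (card A) - psi N k r (real p1) - real t1 * (2 * K / real p1)"
        using unf[OF IH cards(2)] by auto
      show ?thesis
      proof (cases "real (card B) * D < \<gamma> * real d")
        case tB: True
        show ?thesis by (rule bounded_absorb[OF fin cut_sym[OF c(1)] T tiny_d[OF tB] tB 1])
      next
        case False
        then obtain X2 p2 t2 where 2: "pieces r (induced H (B \<union> T)) X2 p2 t2"
          "real (card B choose r) - real (card X2) \<le> \<beta> * real (card B) - psi N k r (real p2) - real t2 * (2 * K / real p2)"
          using unf[OF IH' cards(3)] by auto
        show ?thesis
        proof (cases "p1 \<le> p2")
          case True show ?thesis by (rule bounded_merge[OF fin c(1) T 1 2 True])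
        next
          case False
          then have "p2 \<le> p1" by simp
          show ?thesis by (rule bounded_merge[OF fin cut_sym[OF c(1)] T 2 1 \<open>p2 \<le> p1\<close>])
        qed
      qed
    qed
  qed
qed

theorem sur_le:
  assumes H: "small_conn d k r H" and k: "card (verts H) > k"
  shows "sur r k H \<le> \<beta> * (real (card (verts H)) - real k)"
proof (cases "real (card (verts H) - k) * D \<ge> \<gamma> * real d")
  case True
  then obtain X p t where X: "pieces r H X p t"
    "real ((card (verts H) - k) choose r) - real (card X)
       \<le> \<beta> * (real (card (verts H)) - real k) - psi N k r (real p) - real t * (2 * K / real p)"
    using all_bounded[OF H] k unfolding bounded_def by auto
  have "card X \<le> card (missing r H)"
    using X(1) small_conn_finite[OF H] by (intro card_mono finite_missing) (auto simp: pieces_def)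
  moreover have "0 \<le> psi N k r (real p)" using X(1) pos by (intro psi_nonneg) (auto simp: pieces_def)
  moreover have "0 \<le> real t * (2 * K / real p)" by simp
  ultimately show ?thesis using X(2) unfolding sur_def by linarith
next
  case False
  have "card (verts H) - k \<le> d"
  proof (rule ccontr)
    assume "\<not> ?thesis"
    then have "real d * D \<le> real (card (verts H) - k) * D" using pos by (intro mult_right_mono) auto
    moreover have "\<gamma> * real d \<le> D * real d" using gamma_le gamma_nonneg pos by (intro mult_right_mono) auto
    ultimately show False using False by (simp add: mult.commute)
  qed
  then have "real ((card (verts H) - k) choose r) \<le> (\<beta> - 2 * K) * real (card (verts H) - k)"
    using False by (intro tiny_leaf) auto
  also have "\<dots> \<le> \<beta> * real (card (verts H) - k)" by (intro mult_right_mono) auto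
  finally show ?thesis using k by (simp add: sur_def of_nat_diff)
qed

end

section \<open>Upper bound for \<open>c = 1\<close>\<close>

text \<open>The counterpart of \<open>sur_glue\<close> for an arbitrary separator:
  \<open>cross\<close> sets are missing on neither side, and only sets inside \<open>T\<close> can
  be missing on both.\<close>

lemma sur_cut_le:
  assumes fin: "finite (verts H)" and c: "cut H A B T" and T: "card T = k" and r: "r \<ge> 1"
  shows "sur r k H \<le> sur r k (induced H (A \<union> T)) + sur r k (induced H (B \<union> T)) + real (card (missing r H \<inter> nsets T r))"
proof -
  let ?m1 = "missing r (induced H (A \<union> T))" and ?m2 = "missing r (induced H (B \<union> T))"
  have finABT: "finite A" "finite B" "finite T" using finite_cut[OF fin c] by auto
  have disj: "A \<inter> B = {}" "A \<inter> T = {}" "B \<inter> T = {}" and V: "verts H = A \<union> B \<union> T"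
    using c by (auto simp: cut_def)
  have m: "?m1 = missing r H \<inter> nsets (A \<union> T) r" "?m2 = missing r H \<inter> nsets (B \<union> T) r"
    using V by (auto intro!: missing_induced)
  have finm: "finite (missing r H)" using fin by (rule finite_missing)
  have fin': "finite ?m1" "finite ?m2" "finite (cross r A B)"
    unfolding m using finm finite_subset[OF cross_subset_missing[OF c] finm] by auto
  have "(A \<union> T) \<inter> (B \<union> T) = T" using disj by blast
  then have "?m1 \<inter> ?m2 \<subseteq> missing r H \<inter> nsets T r" unfolding m by (auto simp: nsets_def)
  then have i: "card (?m1 \<inter> ?m2) \<le> card (missing r H \<inter> nsets T r)" using finm by (intro card_mono) auto
  have "cross r A B \<inter> (?m1 \<union> ?m2) = {}"
  proof -
    have "e \<notin> cross r A B" if "e \<subseteq> A \<union> T \<or> e \<subseteq> B \<union> T" for e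
    proof
      assume "e \<in> cross r A B"
      then have "e \<subseteq> A \<union> B" "\<not> e \<subseteq> A" "\<not> e \<subseteq> B" by (auto simp: cross_def nsets_def)
      then show False using disj that by blast
    qed
    then show ?thesis unfolding m nsets_def by blast
  qed
  then have "card (cross r A B) + card (?m1 \<union> ?m2) = card (cross r A B \<union> (?m1 \<union> ?m2))"
    using fin' by (simp add: card_Un_disjoint)
  also have "\<dots> \<le> card (missing r H)"
    using cross_subset_missing[OF c, of r] finm by (intro card_mono) (auto simp: m)
  finally have "card (cross r A B) + card (?m1 \<union> ?m2) \<le> card (missing r H)" .
  moreover have "card ?m1 + card ?m2 = card (?m1 \<union> ?m2) + card (?m1 \<inter> ?m2)" using fin' by (intro card_Un_Int)
  moreover have "real (card (cross r A B)) = real ((card A + card B) choose r) - real (card A choose r) - real (card B choose r)"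
    by (rule card_cross[OF finABT(1,2) disj(1) r])
  ultimately show ?thesis using i unfolding sur_def using cut_card[OF fin c] T by simp
qed

text \<open>The additive term \<open>- (k choose r)\<close> pays for the gain of a later merge.\<close>

lemma sur_le_small_c:
  assumes "small_conn k k r H" "card (verts H) \<ge> 2 * k" and k: "k \<ge> 1" and r: "r \<ge> 1"
  shows "sur r k H \<le> 2 * real (k choose r) / real k * (real (card (verts H)) - real k) - real (k choose r)"
  using assms(1,2)
proof (induction "card (verts H)" arbitrary: H rule: less_induct)
  case less
  let ?C = "real (k choose r)"
  note fin = small_conn_finite[OF less.prems(1)]
  have ratio: "real (x choose r) \<le> ?C / real k * real x" if "x \<le> k" for x
  proof -
    have "real (x choose r) \<le> (real x / real k) ^ r * ?C"
      using binomial_power_ratio[OF that, of r] k by (simp add: field_simps)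
    also have "\<dots> \<le> (real x / real k) ^ 1 * ?C"
      using that k r by (intro mult_right_mono power_decreasing) auto
    finally show ?thesis by (simp add: mult.commute)
  qed
  show ?case
  proof (cases "card (verts H) \<le> k + k")
    case True
    then have "card (verts H) = 2 * k" using less.prems(2) by simp
    then show ?thesis using k by (simp add: sur_def)
  next
    case False
    obtain A B T where c: "cut H A B T" "A \<noteq> {}" "B \<noteq> {}" and T: "card T = k"
      using small_conn_cut[OF less.prems(1)] False k by (metis not_less)
    have finABT: "finite A" "finite B" "finite T" using finite_cut[OF fin c(1)] by auto
    have sub: "A \<union> T \<subseteq> verts H" "B \<union> T \<subseteq> verts H" using c(1) by (auto simp: cut_def)
    note cards = cut_card[OF fin c(1)]
    have pAB: "card A > 0" "card B > 0" using finABT c by (auto simp: card_gt_0_iff)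
    have mT: "real (card (missing r H \<inter> nsets T r)) \<le> ?C"
      using card_mono[of "nsets T r" "missing r H \<inter> nsets T r"] finABT(3) T
      by (simp add: finite_imp_finite_nsets card_nsets)
    \<comment> \<open>The gain at \<open>T\<close> is no profit here: the same sets are already
      subtracted in the surplus of this side, so surplus and gain together stay below
      \<open>card W choose r\<close>.\<close>
    have small: "sur r k (induced H (W \<union> T)) + real (card (missing r H \<inter> nsets T r)) \<le> ?C / real k * real (card W)"
      if W: "W \<union> T \<subseteq> verts H" "card (W \<union> T) = card W + card T" "card W \<le> k" for W
    proof -
      have "missing r H \<inter> nsets T r \<subseteq> missing r (induced H (W \<union> T))"
        unfolding missing_induced[OF W(1)] using nsets_mono[of T "W \<union> T" r] by blast
      then have "card (missing r H \<inter> nsets T r) \<le> card (missing r (induced H (W \<union> T)))"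
        using fin W(1) finite_subset by (intro card_mono finite_missing) auto
      then show ?thesis using ratio[OF W(3)] W(2) T by (simp add: sur_def)
    qed
    have IH: "sur r k (induced H (A \<union> T)) \<le> 2 * ?C / real k * real (card A) - ?C" if "k \<le> card A"
      using less.hyps[of "induced H (A \<union> T)"] that cards T pAB small_conn_induced[OF less.prems(1) sub(1)] by simp
    have IH': "sur r k (induced H (B \<union> T)) \<le> 2 * ?C / real k * real (card B) - ?C" if "k \<le> card B"
      using less.hyps[of "induced H (B \<union> T)"] that cards T pAB small_conn_induced[OF less.prems(1) sub(2)] by simp
    note merge = sur_cut_le[OF fin c(1) T r]
    have double: "2 * ?C / real k * x = 2 * (?C / real k * x)" for x by simp
    have nn: "0 \<le> ?C / real k * real x" for x by simp
    have tot: "2 * ?C / real k * (real (card (verts H)) - real k) = 2 * (?C / real k * real (card A)) + 2 * (?C / real k * real (card B))"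
      using cards(1) T by (simp add: field_simps add_divide_distrib)
    consider "k \<le> card A" "k \<le> card B" | "k \<le> card A" "card B \<le> k" | "card A \<le> k" "k \<le> card B" | "card A \<le> k" "card B \<le> k"
      by linarith
    then show ?thesis
    proof cases
      case 1
      then show ?thesis using IH[OF 1(1)] IH'[OF 1(2)] merge mT unfolding tot unfolding double by linarith
    next
      case 2
      then show ?thesis using IH[OF 2(1)] small[OF sub(2) cards(3)] merge nn[of "card B"] unfolding tot unfolding double by linarith
    next
      case 3
      then show ?thesis using IH'[OF 3(2)] small[OF sub(1) cards(2)] merge nn[of "card A"] unfolding tot unfolding double by linarith
    next
      case 4
      \<comment> \<open>Two short sides use only half of the allowance \<open>2 * ?C / k\<close> per
        vertex; on at least \<open>k\<close> vertices the other half is worth the required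
        \<open>?C\<close>.\<close>
      have "real k \<le> real (card A) + real (card B)" using False cards(1) T by simp
      then have "?C / real k * real k \<le> ?C / real k * (real (card A) + real (card B))" by (intro mult_left_mono) auto
      then have "?C \<le> ?C / real k * real (card A) + ?C / real k * real (card B)" using k by (simp add: field_simps)
      moreover have "0 \<le> real (card (missing r H \<inter> nsets T r))" by simp
      ultimately show ?thesis using 4 small[OF sub(1) cards(2)] small[OF sub(2) cards(3)] merge unfolding tot unfolding double by linarith
    qed
  qed
qed

section \<open>Lower bounds\<close>

text \<open>The parts are what remains of the leaves after all vertices of earlier separators have
  been removed; the last clause says that no edge inside their union joins two of them.
  \<open>m\<close> records how many vertices each part can still offer.\<close>

definition free_parts :: "'a hypergraph \<Rightarrow> nat \<Rightarrow> nat \<Rightarrow> (nat \<Rightarrow> 'a set) \<Rightarrow> bool" where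
  "free_parts H p m Z \<longleftrightarrow> (\<forall>i<p. Z i \<subseteq> verts H \<and> m \<le> card (Z i)) \<and> disjoint_family_on Z {..<p} \<and>
     (\<forall>e\<in>edges H. e \<subseteq> (\<Union>i<p. Z i) \<longrightarrow> (\<exists>i<p. e \<subseteq> Z i))"

text \<open>Take \<open>q\<close> vertices from every part and trim to \<open>k\<close>. An edge
  inside \<open>S\<close> must lie in one part, which leaves at most \<open>p * (q choose r)\<close>
  present r-sets.\<close>

lemma free_parts_select:
  assumes Z: "free_parts H p m Z" and fin: "finite (verts H)" and q: "q \<le> m" "k \<le> p * q"
  obtains S where "S \<subseteq> verts H" "card S = k" "\<And>i. i < p \<Longrightarrow> card (S \<inter> Z i) \<le> q"
    "real (k choose r) - real p * real (q choose r) \<le> real (card (missing r H \<inter> nsets S r))"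
proof -
  have ZV: "Z i \<subseteq> verts H" "m \<le> card (Z i)" if "i < p" for i using Z that unfolding free_parts_def by auto
  have disj: "Z i \<inter> Z j = {}" if "i < p" "j < p" "i \<noteq> j" for i j
    using Z that unfolding free_parts_def disjoint_family_on_def by auto
  have "\<exists>W. i < p \<longrightarrow> W \<subseteq> Z i \<and> card W = q" for i
    using ZV(2)[of i] q(1) obtain_subset_with_card_n[of q "Z i"] by (cases "i < p") auto
  then obtain W where W: "\<And>i. i < p \<Longrightarrow> W i \<subseteq> Z i \<and> card (W i) = q" by metis
  have finW: "finite (W i)" if "i < p" for i
    using W[OF that] ZV(1)[OF that] fin finite_subset by metis
  have "card (\<Union>i<p. W i) = (\<Sum>i<p. card (W i))"
  proof (intro card_UN_disjoint ballI impI)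
    fix i j assume ij: "i \<in> {..<p}" "j \<in> {..<p}" "i \<noteq> j"
    then have "W i \<subseteq> Z i" "W j \<subseteq> Z j" using W by auto
    then show "W i \<inter> W j = {}" using disj[of i j] ij by blast
  qed (use finW in auto)
  also have "\<dots> = p * q" using W by simp
  finally obtain S where S: "S \<subseteq> (\<Union>i<p. W i)" "card S = k"
    using q(2) obtain_subset_with_card_n[of k "\<Union>i<p. W i"] by metis
  have finS: "finite S" using S(1) finW finite_subset[of S "\<Union>i<p. W i"] by auto
  have SZ: "S \<inter> Z i \<subseteq> W i" if "i < p" for i
  proof
    fix x assume x: "x \<in> S \<inter> Z i"
    then obtain j where j: "j < p" "x \<in> W j" using S(1) by auto
    then have "j = i" using W[OF j(1)] disj[OF j(1) that] x by blast
    then show "x \<in> W i" using j by simp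
  qed
  have le: "card (S \<inter> Z i) \<le> q" if "i < p" for i
    using card_mono[OF finW[OF that] SZ[OF that]] W[OF that] by simp
  have SV: "S \<subseteq> verts H" using S(1) W ZV by blast
  have "nsets S r - missing r H \<subseteq> (\<Union>i<p. nsets (S \<inter> Z i) r)"
  proof
    fix e assume e: "e \<in> nsets S r - missing r H"
    then have eS: "e \<subseteq> S" "finite e" "card e = r" by (auto simp: nsets_def)
    have "e \<in> edges H" using e SV nsets_mono[OF SV, of r] unfolding missing_def by blast
    moreover have "S \<subseteq> (\<Union>i<p. Z i)" using S(1) W by blast
    then have "e \<subseteq> (\<Union>i<p. Z i)" using eS by blast
    ultimately obtain i where "i < p" "e \<subseteq> Z i" using Z unfolding free_parts_def by blast
    then show "e \<in> (\<Union>i<p. nsets (S \<inter> Z i) r)" using eS by (auto simp: nsets_def)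
  qed
  then have "card (nsets S r - missing r H) \<le> card (\<Union>i<p. nsets (S \<inter> Z i) r)"
    using finS by (intro card_mono) (auto simp: finite_imp_finite_nsets)
  also have "\<dots> \<le> (\<Sum>i<p. card (nsets (S \<inter> Z i) r))" by (intro card_UN_le) auto
  also have "\<dots> \<le> (\<Sum>i<p. q choose r)"
    using finS le by (intro sum_mono) (auto simp: card_nsets intro!: binomial_right_mono)
  finally have 1: "card (nsets S r - missing r H) \<le> p * (q choose r)" by simp
  have "card (nsets S r) = card (nsets S r - missing r H) + card (missing r H \<inter> nsets S r)"
  proof -
    have "nsets S r = (nsets S r - missing r H) \<union> (missing r H \<inter> nsets S r)" by blast
    moreover have "card ((nsets S r - missing r H) \<union> (missing r H \<inter> nsets S r)) =
        card (nsets S r - missing r H) + card (missing r H \<inter> nsets S r)"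
      using finS by (intro card_Un_disjoint) (auto simp: finite_imp_finite_nsets)
    ultimately show ?thesis by simp
  qed
  then have "k choose r \<le> p * (q choose r) + card (missing r H \<inter> nsets S r)" using 1 finS S(2) by (simp add: card_nsets)
  then have "real (k choose r) \<le> real p * real (q choose r) + real (card (missing r H \<inter> nsets S r))"
    by (metis of_nat_add of_nat_le_iff of_nat_mult)
  then show thesis using that[of S] SV S(2) le by simp
qed

text \<open>\<open>H\<close> is glued to a copy of itself along \<open>S\<close>. Removing
  \<open>S\<close> from the parts and from their images gives twice as many parts, each at most
  \<open>q\<close> vertices smaller.\<close>

lemma double_free_parts:
  fixes H :: "nat hypergraph"
  assumes H: "small_conn d k r H" and Z: "free_parts H p (m + q) Z"
    and S: "S \<subseteq> verts H" "card S = k" "\<And>i. i < p \<Longrightarrow> card (S \<inter> Z i) \<le> q" and r: "r \<ge> 1"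
  obtains K :: "nat hypergraph" and Y where "small_conn d k r K" "free_parts K (2 * p) m Y"
    "card (verts K) = card (verts H) + (card (verts H) - k)"
    "sur r k K = 2 * sur r k H + real (card (missing r H \<inter> nsets S r))"
proof -
  let ?V = "verts H"
  obtain g where g: "inj_on g ?V" "\<And>v. v \<in> S \<Longrightarrow> g v = v" "?V \<inter> g ` ?V = S"
    "small_conn d k r (glue r H (map_hyp g H))"
    "card (?V \<union> g ` ?V) = card ?V + (card ?V - k)"
    "sur r k (glue r H (map_hyp g H)) = sur r k H + sur r k H + real (card (missing r H \<inter> nsets S r))"
    using glue_copy[OF H H S(1) S(1) S(2) r refl] by metis
  let ?K = "glue r H (map_hyp g H)"
  have fin: "finite ?V" using H by (rule small_conn_finite)
  have finS: "finite S" using S(1) fin finite_subset by blast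
  have u: "uniform_hypergraph r H" using H by (rule small_conn_uniform)
  have ZV: "Z i \<subseteq> ?V" "m + q \<le> card (Z i)" if "i < p" for i using Z that unfolding free_parts_def by auto
  have disj: "Z i \<inter> Z j = {}" if "i < p" "j < p" "i \<noteq> j" for i j
    using Z that unfolding free_parts_def disjoint_family_on_def by auto
  have ZE: "\<exists>i<p. e \<subseteq> Z i" if "e \<in> edges H" "e \<subseteq> (\<Union>i<p. Z i)" for e
    using Z that unfolding free_parts_def by blast
  have gS: "g ` S = S" using g(2) by force
  have out: "g v \<notin> ?V" if "v \<in> ?V" "v \<notin> S" for v
  proof
    assume "g v \<in> ?V"
    then have "g v \<in> S" using g(3) that by blast
    then have "g (g v) = g v" by (rule g(2))
    then have "g v = v" using g(1) \<open>g v \<in> ?V\<close> that by (auto simp: inj_on_def)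
    then show False using \<open>g v \<in> S\<close> that by simp
  qed
  define Y where "Y i = (if i < p then Z i - S else g ` (Z (i - p) - S))" for i
  have cardZ: "m \<le> card (Z i - S)" if "i < p" for i
  proof -
    have "card (Z i - S) = card (Z i) - card (S \<inter> Z i)"
      using finS by (simp add: card_Diff_subset_Int Int_commute)
    then show ?thesis using S(3)[OF that] ZV(2)[OF that] by linarith
  qed
  have Yout: "Y i \<inter> ?V = {}" if "\<not> i < p" "i < 2 * p" for i
    using out ZV(1)[of "i - p"] that unfolding Y_def by force
  have YS: "Y i \<inter> S = {}" if "i < 2 * p" for i
    using Yout[of i] that S(1) by (cases "i < p") (auto simp: Y_def)
  have Ycard: "Y i \<subseteq> verts ?K \<and> m \<le> card (Y i)" if i: "i < 2 * p" for i
  proof (cases "i < p")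
    case True then show ?thesis using ZV(1)[of i] cardZ[of i] by (auto simp: Y_def)
  next
    case False
    then have ip: "i - p < p" using i by simp
    have "inj_on g (Z (i - p) - S)" using g(1) by (rule inj_on_subset) (use ZV(1)[OF ip] in blast)
    then show ?thesis using ZV(1)[OF ip] cardZ[OF ip] False by (auto simp: Y_def card_image)
  qed
  have Ydisj: "Y i \<inter> Y j = {}" if ij: "i < 2 * p" "j < 2 * p" "i \<noteq> j" for i j
  proof (cases "i < p"; cases "j < p")
    assume "i < p" "j < p"
    then show ?thesis using disj[of i j] ij by (auto simp: Y_def)
  next
    assume "i < p" "\<not> j < p"
    then show ?thesis using Yout[of j] ij ZV(1)[of i] by (auto simp: Y_def)
  next
    assume "\<not> i < p" "j < p"
    then show ?thesis using Yout[of i] ij ZV(1)[of j] by (auto simp: Y_def)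
  next
    assume a: "\<not> i < p" "\<not> j < p"
    then have ij': "i - p < p" "j - p < p" "i - p \<noteq> j - p" using ij by auto
    have "g ` (Z (i - p) - S) \<inter> g ` (Z (j - p) - S) = g ` ((Z (i - p) - S) \<inter> (Z (j - p) - S))"
      using g(1) ZV(1)[OF ij'(1)] ZV(1)[OF ij'(2)] by (intro inj_on_image_Int[symmetric]) auto
    then show ?thesis using a disj[OF ij'] by (auto simp: Y_def)
  qed
  have "\<exists>i<2 * p. e \<subseteq> Y i" if e: "e \<in> edges ?K" "e \<subseteq> (\<Union>i<2 * p. Y i)" for e
  proof -
    have eS: "e \<inter> S = {}" using e(2) YS by blast
    have enc: "e \<in> nsets (?V \<union> g ` ?V) r" "e \<notin> missing r H" "e \<notin> missing r (map_hyp g H)"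
      "e \<notin> cross r (?V - g ` ?V) (g ` ?V - ?V)"
      using e(1) by (auto simp: glue_def)
    \<comment> \<open>An edge that avoids \<open>S\<close> and is no \<open>cross\<close> set lies
      in one of the two copies, where the parts of \<open>H\<close> apply.\<close>
    have "e \<subseteq> (?V - g ` ?V) \<union> (g ` ?V - ?V)" using enc(1) eS g(3) by (auto simp: nsets_def)
    then have "e \<subseteq> ?V - g ` ?V \<or> e \<subseteq> g ` ?V - ?V" using enc(1,4) by (auto simp: cross_def nsets_def)
    then show ?thesis
    proof
      assume eV: "e \<subseteq> ?V - g ` ?V"
      then have "e \<in> edges H" using enc(1,2) by (auto simp: missing_def nsets_def)
      moreover have "e \<subseteq> (\<Union>i<p. Z i)"
      proof
        fix x assume x: "x \<in> e"
        then obtain i where i: "i < 2 * p" "x \<in> Y i" using e(2) by blast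
        then have "i < p" using Yout[of i] eV x by blast
        then show "x \<in> (\<Union>i<p. Z i)" using i by (auto simp: Y_def)
      qed
      ultimately obtain i where "i < p" "e \<subseteq> Z i" using ZE by blast
      then show ?thesis using eS by (intro exI[of _ i]) (auto simp: Y_def)
    next
      assume eV: "e \<subseteq> g ` ?V - ?V"
      then have "e \<in> edges (map_hyp g H)" using enc(1,3) by (auto simp: missing_def nsets_def)
      then obtain e0 where e0: "e0 \<in> edges H" "e = g ` e0" by auto
      have e0V: "e0 \<subseteq> ?V" using e0(1) u by (simp add: uniform_hypergraph_def)
      have e0S: "e0 \<inter> S = {}" using eS e0(2) gS by blast
      have "e0 \<subseteq> (\<Union>i<p. Z i)"
      proof
        fix x assume x: "x \<in> e0"
        then have "g x \<in> e" using e0 by simp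
        then obtain i where i: "i < 2 * p" "g x \<in> Y i" using e(2) by blast
        have "g x \<notin> ?V" using eV \<open>g x \<in> e\<close> by blast
        then have "\<not> i < p" using i ZV(1)[of i] by (auto simp: Y_def)
        then obtain z where z: "z \<in> Z (i - p)" "g x = g z" "i - p < p" using i by (auto simp: Y_def)
        then have "x = z" using g(1) e0V x ZV(1)[OF z(3)] by (auto simp: inj_on_def)
        then show "x \<in> (\<Union>i<p. Z i)" using z by blast
      qed
      then obtain i where i: "i < p" "e0 \<subseteq> Z i" using ZE[OF e0(1)] by blast
      then have "e \<subseteq> Y (p + i)" using e0 e0S by (auto simp: Y_def)
      then show ?thesis using i(1) by (intro exI[of _ "p + i"]) auto
    qed
  qed
  then have "free_parts ?K (2 * p) m Y"
    unfolding free_parts_def disjoint_family_on_def using Ycard Ydisj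
    by (intro conjI allI ballI impI) (simp_all del: map_hyp_simps)
  then show thesis using that[of ?K Y] g by simp
qed

text \<open>Level \<open>j\<close> takes at most \<open>q j\<close> vertices from each of the
  \<open>2^j\<close> parts and gains \<open>(k choose r) - 2^j * (q j choose r)\<close>. The
  subtracted \<open>k choose r\<close> in the invariant stands for a gain still to come and solves
  the recursion. \<open>room\<close> keeps the parts from being exhausted.\<close>

lemma iterated_doubling:
  assumes q0: "q 0 = k" and cover: "\<And>j. j \<le> N \<Longrightarrow> k \<le> 2 ^ j * q j" and room: "(\<Sum>i<Suc N. q i) \<le> d + k"
    and r: "r \<ge> 1"
  shows "j \<le> N \<Longrightarrow> \<exists>(H :: nat hypergraph) Z. small_conn d k r H \<and> card (verts H) = k + 2 ^ j * d \<and>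
     free_parts H (2 ^ j) (d + k - (\<Sum>i<j. q i)) Z \<and>
     sur r k H \<ge> 2 ^ j * (real (d choose r) + real (k choose r) - (\<Sum>i<j. real (q i choose r)) / 2) - real (k choose r)"
proof (induction j)
  case 0
  let ?H = "complete_hyp r {..<d + k}"
  have "small_conn d k r ?H" by (intro small_conn_complete) auto
  moreover have "free_parts ?H 1 (d + k) (\<lambda>_. {..<d + k})"
    by (auto simp: free_parts_def disjoint_family_on_def nsets_def)
  ultimately show ?case by (intro exI[of _ ?H] exI[of _ "\<lambda>_. {..<d + k}"]) (auto simp: sur_complete)
next
  case (Suc j)
  then obtain H :: "nat hypergraph" and Z where H: "small_conn d k r H" "card (verts H) = k + 2 ^ j * d"
     "free_parts H (2 ^ j) (d + k - (\<Sum>i<j. q i)) Z"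
     "sur r k H \<ge> 2 ^ j * (real (d choose r) + real (k choose r) - (\<Sum>i<j. real (q i choose r)) / 2) - real (k choose r)"
    by auto
  have "(\<Sum>i<Suc j. q i) \<le> (\<Sum>i<Suc N. q i)" using Suc.prems by (intro sum_mono2) auto
  then have room': "(\<Sum>i<j. q i) + q j \<le> d + k" using room by simp
  define m where "m = d + k - (\<Sum>i<Suc j. q i)"
  have mq: "d + k - (\<Sum>i<j. q i) = m + q j" using room' by (simp add: m_def)
  have kj: "k \<le> 2 ^ j * q j" using cover Suc.prems by simp
  obtain S where S: "S \<subseteq> verts H" "card S = k" "\<And>i. i < 2 ^ j \<Longrightarrow> card (S \<inter> Z i) \<le> q j"
    "real (k choose r) - real (2 ^ j) * real (q j choose r) \<le> real (card (missing r H \<inter> nsets S r))"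
    using free_parts_select[OF H(3) small_conn_finite[OF H(1)] _ kj, of r] unfolding mq by auto
  obtain K :: "nat hypergraph" and Y where K: "small_conn d k r K" "free_parts K (2 * 2 ^ j) m Y"
    "card (verts K) = card (verts H) + (card (verts H) - k)"
    "sur r k K = 2 * sur r k H + real (card (missing r H \<inter> nsets S r))"
    using double_free_parts[OF H(1) H(3)[unfolded mq] S(1-3) r] by metis
  have "2 ^ Suc j * (real (d choose r) + real (k choose r) - (\<Sum>i<Suc j. real (q i choose r)) / 2) - real (k choose r) =
    2 * (2 ^ j * (real (d choose r) + real (k choose r) - (\<Sum>i<j. real (q i choose r)) / 2) - real (k choose r))
     + (real (k choose r) - 2 ^ j * real (q j choose r))"
    by (simp add: field_simps)
  also have "\<dots> \<le> sur r k K" unfolding K(4) using H(4) S(4) by simp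
  finally show ?case using K(1,2,3) H(2) unfolding m_def by (intro exI[of _ K] exI[of _ Y]) simp
qed

text \<open>As \<open>q N < r\<close>, the last selection has no r-set inside a part. All r-sets of
  \<open>S\<close> are then missing, which restores the outstanding
  \<open>k choose r\<close>.\<close>

lemma doubling_lower_bound:
  assumes q0: "q 0 = k" and cover: "\<And>j. j \<le> N \<Longrightarrow> k \<le> 2 ^ j * q j" and room: "(\<Sum>i<N. q (Suc i)) \<le> d"
    and qN: "q N < r" and r: "r \<ge> 1"
  obtains H :: "nat hypergraph" and S where "small_conn d k r H" "S \<subseteq> verts H" "card S = k" "card (verts H) = k + 2 ^ N * d"
    "2 ^ N * (real (d choose r) + real (k choose r) - (\<Sum>i<N. real (q i choose r)) / 2)
       \<le> sur r k H + real (card (missing r H \<inter> nsets S r))"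
proof -
  have room': "(\<Sum>i<Suc N. q i) \<le> d + k" using room q0 by (subst sum.lessThan_Suc_shift) simp
  obtain H :: "nat hypergraph" and Z where H: "small_conn d k r H" "card (verts H) = k + 2 ^ N * d"
     "free_parts H (2 ^ N) (d + k - (\<Sum>i<N. q i)) Z"
     "sur r k H \<ge> 2 ^ N * (real (d choose r) + real (k choose r) - (\<Sum>i<N. real (q i choose r)) / 2) - real (k choose r)"
    using iterated_doubling[of q k N d r N, OF q0 cover room' r] by auto
  have "q N \<le> d + k - (\<Sum>i<N. q i)" using room' by simp
  then obtain S where S: "S \<subseteq> verts H" "card S = k"
    "real (k choose r) - real (2 ^ N) * real (q N choose r) \<le> real (card (missing r H \<inter> nsets S r))"
    using free_parts_select[OF H(3) small_conn_finite[OF H(1)] _ cover[OF order_refl], of r] by metis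
  show thesis using that[OF H(1) S(1,2) H(2)] H(4) S(3) qN by (simp add: binomial_eq_0)
qed

section \<open>Lower bound for \<open>c = 1\<close>\<close>

lemma cross_mono:
  assumes "A \<subseteq> A'" "B \<subseteq> B'" "A' \<inter> B' = {}" shows "cross r A B \<subseteq> cross r A' B'"
proof
  fix e assume "e \<in> cross r A B"
  then have e: "e \<subseteq> A \<union> B" "\<not> e \<subseteq> A" "\<not> e \<subseteq> B" "finite e" "card e = r" by (auto simp: cross_def nsets_def)
  obtain a b where "a \<in> e" "a \<in> A" "b \<in> e" "b \<in> B" using e(1-3) by blast
  then have "\<not> e \<subseteq> A'" "\<not> e \<subseteq> B'" using assms by blast+
  moreover have "e \<subseteq> A' \<union> B'" using e(1) assms by blast
  ultimately show "e \<in> cross r A' B'" using e(4,5) by (simp add: cross_def nsets_def)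
qed

text \<open>The leaves share \<open>k\<close> vertices, and \<open>S\<close> avoids these: it has
  \<open>k - q\<close> private vertices of the first leaf and all \<open>q\<close> of the second.
  The r-sets of \<open>S\<close> meeting both groups are missing. Their count contains
  \<open>- (q choose r)\<close>, which cancels against the surplus of the second leaf.\<close>

lemma two_leaves_lower_bound:
  assumes r: "r \<ge> 1" and q: "1 \<le> q" "q \<le> k"
  obtains H :: "nat hypergraph" and S where "small_conn k k r H" "S \<subseteq> verts H" "card S = k" "card (verts H) = 2 * k + q"
    "2 * real (k choose r) - real ((k - q) choose r) \<le> sur r k H + real (card (missing r H \<inter> nsets S r))"
proof -
  let ?V = "{..<2 * k}" and ?W = "{..<k} \<union> {2 * k..<2 * k + q}"
  let ?G = "complete_hyp r ?V" and ?H = "complete_hyp r ?W"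
  let ?K = "glue r ?G ?H"
  let ?A = "{k..<2 * k - q}" and ?B = "{2 * k..<2 * k + q}"
  let ?S = "?A \<union> ?B"
  have cardW: "card ?W = k + q" by (subst card_Un_disjoint) auto
  have G: "small_conn k k r ?G" "small_conn k k r ?H" using cardW q by (auto intro!: small_conn_complete)
  have int: "?V \<inter> ?W = {..<k}" by auto
  have K: "small_conn k k r ?K" by (rule small_conn_glue[OF G]) (simp add: int)
  have VK: "verts ?K = {..<2 * k + q}" using q by auto
  have cardS: "card ?S = k" using q by (subst card_Un_disjoint) auto
  have surK: "sur r k ?K = real (k choose r) + real (q choose r)"
    using sur_glue[of ?G ?H k r] r int cardW by (simp add: sur_complete)
  have sub: "cross r ?A ?B \<subseteq> missing r ?K \<inter> nsets ?S r"
  proof -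
    have "cross r ?A ?B \<subseteq> cross r (?V - ?W) (?W - ?V)"
      by (rule cross_mono) auto
    moreover have "cross r ?A ?B \<subseteq> nsets ?S r" unfolding cross_def by blast
    ultimately show ?thesis unfolding missing_glue complete_hyp_simps by blast
  qed
  have "finite (nsets ?S r)" by (simp add: finite_imp_finite_nsets)
  then have "card (cross r ?A ?B) \<le> card (missing r ?K \<inter> nsets ?S r)" using sub by (intro card_mono) auto
  moreover have "real (card (cross r ?A ?B)) = real (k choose r) - real ((k - q) choose r) - real (q choose r)"
    using card_cross[of ?A ?B r] r q by auto
  ultimately have "2 * real (k choose r) - real ((k - q) choose r) \<le> sur r k ?K + real (card (missing r ?K \<inter> nsets ?S r))"
    unfolding surK by linarith
  moreover have "?S \<subseteq> verts ?K" unfolding VK using q by auto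
  moreover have "card (verts ?K) = 2 * k + q" unfolding VK by simp
  ultimately show thesis using that[OF K _ cardS] by blast
qed

section \<open>The limits\<close>

lemma fact_ext_binomial: "r \<ge> 1 \<Longrightarrow> fact r * ext_binomial x r = (\<Prod>j<r. max 0 (x - real j))"
  by (simp add: ext_binomial_prod)

text \<open>Replacing the factors \<open>a - j\<close> by \<open>a\<close> changes the product by at
  most the sum of all \<open>j\<close> times \<open>a^(r-1)\<close>, and that sum is below
  \<open>r * r\<close>. The induction carries the upper bound \<open>a^n\<close> along to control
  the error of the next factor.\<close>

lemma fact_ext_binomial_ge:
  assumes r: "r \<ge> 1" and a: "a \<ge> 0"
  shows "a ^ r - (real r)\<^sup>2 * a ^ (r - 1) \<le> fact r * ext_binomial a r"
proof -
  have "a ^ n - (real n)\<^sup>2 * a ^ (n - 1) \<le> (\<Prod>j<n. max 0 (a - real j)) \<and> (\<Prod>j<n. max 0 (a - real j)) \<le> a ^ n" for n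
  proof (induction n)
    case 0 then show ?case by simp
  next
    case (Suc n)
    let ?P = "\<Prod>j<n. max 0 (a - real j)"
    have P: "0 \<le> ?P" by (simp add: prod_nonneg)
    have "a * (a ^ n - (real n)\<^sup>2 * a ^ (n - 1)) \<le> a * ?P" using Suc a by (intro mult_left_mono) auto
    moreover have "a * (a ^ n - (real n)\<^sup>2 * a ^ (n - 1)) = a * a ^ n - (real n)\<^sup>2 * a ^ n"
      by (cases n) (auto simp: algebra_simps)
    moreover have "?P * (a - real n) \<le> ?P * max 0 (a - real n)" using P by (intro mult_left_mono) auto
    moreover have "?P * (a - real n) = a * ?P - real n * ?P" by (simp add: algebra_simps)
    moreover have "real n * ?P \<le> real n * a ^ n" using Suc by (intro mult_left_mono) auto
    moreover have "0 \<le> real n * a ^ n" "0 \<le> a ^ n" using a by auto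
    moreover have "(real (Suc n))\<^sup>2 * a ^ n = (real n)\<^sup>2 * a ^ n + 2 * (real n * a ^ n) + a ^ n"
      by (simp add: algebra_simps power2_eq_square)
    ultimately have 1: "a * a ^ n - (real (Suc n))\<^sup>2 * a ^ n \<le> ?P * max 0 (a - real n)" by linarith
    have "?P * max 0 (a - real n) \<le> a ^ n * a" using Suc a P by (intro mult_mono) auto
    then show ?case using 1 by (simp add: mult.commute del: of_nat_Suc)
  qed
  then show ?thesis unfolding fact_ext_binomial[OF r] by blast
qed

lemma fact_binomial_le_power: "fact r * real (n choose r) \<le> real n ^ r"
  using binomial_fact_pow[of n r] by (metis mult.commute of_nat_fact of_nat_le_iff of_nat_mult of_nat_power)

text \<open>Rounding up hurts only the first factor, which is at most \<open>a + 1\<close>; each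
  later factor subtracts at least 1 and is at most \<open>a\<close>.\<close>

lemma fact_binomial_ceiling_le:
  assumes r: "r \<ge> 1" and a: "a \<ge> 0"
  shows "fact r * real (nat \<lceil>a\<rceil> choose r) \<le> a ^ r + a ^ (r - 1)"
proof -
  obtain m where m: "r = Suc m" using r by (cases r) auto
  let ?n = "real (nat \<lceil>a\<rceil>)"
  have n: "?n \<le> a + 1" using a by linarith
  have "fact r * real (nat \<lceil>a\<rceil> choose r) = max 0 ?n * (\<Prod>j<m. max 0 (?n - real (Suc j)))"
    unfolding ext_binomial_of_nat[OF r, symmetric] fact_ext_binomial[OF r] unfolding m
    by (simp add: prod.lessThan_Suc_shift del: prod.lessThan_Suc)
  also have "\<dots> \<le> (a + 1) * (\<Prod>j<m. a)"
  proof (intro mult_mono prod_mono)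
    show "0 \<le> max 0 (?n - real (Suc j)) \<and> max 0 (?n - real (Suc j)) \<le> a" for j using n a by linarith
  qed (use n a in \<open>auto intro!: prod_nonneg\<close>)
  also have "\<dots> = a ^ r + a ^ (r - 1)" by (simp add: m algebra_simps)
  finally show ?thesis .
qed

lemma power_diff_le:
  fixes u c :: real
  assumes "0 \<le> u" "u \<le> c" shows "c ^ m - u ^ m \<le> real m * c ^ (m - 1) * (c - u)"
proof (induction m)
  case (Suc m)
  have "c ^ Suc m - u ^ Suc m = c * (c ^ m - u ^ m) + u ^ m * (c - u)" by (simp add: algebra_simps)
  also have "\<dots> \<le> c * (real m * c ^ (m - 1) * (c - u)) + c ^ m * (c - u)"
    using assms Suc by (intro add_mono mult_left_mono mult_right_mono power_mono) auto
  also have "c * (real m * c ^ (m - 1) * (c - u)) = real m * c ^ m * (c - u)" by (cases m) auto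
  finally show ?case by (simp add: algebra_simps)
qed simp

text \<open>Here \<open>q = k / m\<close>, and \<open>m\<close> will be about the square root of
  \<open>r\<close>. In the lower bound, \<open>1 - 1 / m\<close> is the price of replacing the
  binomial by a power, allowed by \<open>k \<ge> m * r * r\<close>; \<open>exp (- m)\<close> bounds
  \<open>(1 - 1 / m)^r\<close>, as \<open>r \<ge> m * m\<close>; and \<open>1 + 1 / m\<close> comes
  from the \<open>k + q\<close> vertices outside a \<open>k\<close>-set.\<close>

lemma c_one_sandwich:
  fixes m q k r :: nat
  assumes r: "r \<ge> 2" and m: "m \<ge> 1" "m * m \<le> r" and q: "q \<ge> 1" and km: "k = m * q" and big: "m * r\<^sup>2 \<le> k"
  shows "lim_rel_surplus 1 r k \<le> 2"
    "(1 - 1 / real m) * (2 - exp (- real m)) / (1 + 1 / real m) \<le> lim_rel_surplus 1 r k"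
proof -
  have k1: "k \<ge> 1" using km m q by simp
  let ?C = "real (k choose r)"
  interpret family 1 k r k "2 * ?C / real k"
  proof
    fix H :: "nat hypergraph" assume H: "small_conn k k r H" "card (verts H) > k"
    show "sur r k H \<le> 2 * ?C / real k * (real (card (verts H)) - real k)"
    proof (cases "card (verts H) \<ge> 2 * k")
      case True
      have "0 \<le> ?C" by simp
      then show ?thesis using sur_le_small_c[OF H(1) True k1] r by linarith
    next
      case False
      define x where "x = card (verts H) - k"
      have x: "x \<le> k" "real x = real (card (verts H)) - real k" using False H(2) by (auto simp: x_def)
      have "real (x choose r) \<le> (real x / real k) ^ r * ?C"
        using binomial_power_ratio[OF x(1), of r] k1 by (simp add: field_simps)
      also have "\<dots> \<le> (real x / real k) ^ 1 * ?C"
        using x k1 r by (intro mult_right_mono power_decreasing) auto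
      also have "\<dots> \<le> 2 * ((real x / real k) ^ 1 * ?C)"
      proof -
        have "0 \<le> (real x / real k) ^ 1 * ?C" by simp
        then show ?thesis by linarith
      qed
      also have "\<dots> = 2 * ?C / real k * real x" by simp
      finally show ?thesis unfolding x(2)[symmetric] by (simp add: sur_def x_def)
    qed
  qed (use k1 r in auto)
  obtain L where L: "lim_rel_surplus 1 r k = fact r / real k ^ (r - 1) * L" "L \<le> 2 * ?C / real k"
    "\<And>(H :: nat hypergraph) S. small_conn k k r H \<Longrightarrow> S \<subseteq> verts H \<Longrightarrow> card S = k \<Longrightarrow> card (verts H) > k \<Longrightarrow>
       sur r k H + real (card (missing r H \<inter> nsets S r)) \<le> L * (real (card (verts H)) - real k)"
    using lim_rel_surplus_eq by blast
  have kr: "real k ^ r = real k ^ (r - 1) * real k" using r by (cases r) auto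
  have k0: "real k > 0" using k1 by simp
  have "lim_rel_surplus 1 r k \<le> fact r / real k ^ (r - 1) * (2 * ?C / real k)"
    unfolding L(1) using L(2) by (intro mult_left_mono) auto
  also have "\<dots> = 2 * (fact r * ?C / real k ^ r)" by (simp add: kr)
  also have "\<dots> \<le> 2 * 1" using fact_binomial_le_power[of r k] k0 by (intro mult_left_mono) auto
  finally show "lim_rel_surplus 1 r k \<le> 2" by simp
  have "1 * q \<le> m * q" using m by (intro mult_right_mono) auto
  then have qk: "1 \<le> q" "q \<le> k" using q km by auto
  have r1: "r \<ge> 1" using r by simp
  obtain H :: "nat hypergraph" and S where H: "small_conn k k r H" "S \<subseteq> verts H" "card S = k" "card (verts H) = 2 * k + q"
    "2 * ?C - real ((k - q) choose r) \<le> sur r k H + real (card (missing r H \<inter> nsets S r))"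
    using two_leaves_lower_bound[OF r1 qk] by blast
  have low: "2 * ?C - real ((k - q) choose r) \<le> L * (real k + real q)"
    using L(3)[OF H(1-3)] H(4,5) k1 by simp
  have frac: "real (k - q) = real k * (1 - 1 / real m)" using km m qk by (simp add: of_nat_diff field_simps)
  have "real ((k - q) choose r) * real k ^ r \<le> real (k - q) ^ r * ?C" by (rule binomial_power_ratio) simp
  then have "real ((k - q) choose r) \<le> (1 - 1 / real m) ^ r * ?C"
    unfolding frac power_mult_distrib using k0 by (simp add: field_simps)
  also have "\<dots> \<le> exp (- real m) * ?C"
  proof (rule mult_right_mono)
    have "(1 - 1 / real m) ^ r \<le> exp (- (1 / real m)) ^ r"
      using m exp_ge_add_one_self[of "- (1 / real m)"] by (intro power_mono) auto
    also have "\<dots> = exp (- (real r / real m))" by (simp add: exp_of_nat_mult[symmetric])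
    also have "\<dots> \<le> exp (- real m)"
    proof -
      have "real m * real m \<le> real r" using m(2) by (metis of_nat_le_iff of_nat_mult)
      then show ?thesis using m by (simp add: field_simps)
    qed
    finally show "(1 - 1 / real m) ^ r \<le> exp (- real m)" .
  qed simp
  finally have "(2 - exp (- real m)) * ?C \<le> L * (real k + real q)" using low by (simp add: algebra_simps)
  moreover have "real k + real q = real k * (1 + 1 / real m)" using km m by (simp add: field_simps)
  ultimately have "(2 - exp (- real m)) * ?C \<le> L * (real k * (1 + 1 / real m))" by simp
  then have "fact r / real k ^ r * ((2 - exp (- real m)) * ?C) \<le> fact r / real k ^ r * (L * (real k * (1 + 1 / real m)))"
    by (intro mult_left_mono) auto
  also have "\<dots> = lim_rel_surplus 1 r k * (1 + 1 / real m)" unfolding L(1) kr using k0 by simp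
  finally have 1: "(2 - exp (- real m)) * (fact r * ?C / real k ^ r) \<le> lim_rel_surplus 1 r k * (1 + 1 / real m)"
    by (simp add: mult_ac)
  have "1 - 1 / real m \<le> 1 - (real r)\<^sup>2 / real k"
  proof -
    have "real m * (real r)\<^sup>2 \<le> real k" using big by (metis of_nat_le_iff of_nat_mult of_nat_power)
    then show ?thesis using k0 m by (simp add: field_simps)
  qed
  also have "\<dots> = (real k ^ r - (real r)\<^sup>2 * real k ^ (r - 1)) / real k ^ r" unfolding kr using k0 by (simp add: field_simps)
  also have "\<dots> \<le> fact r * ?C / real k ^ r"
    using fact_ext_binomial_ge[OF r1, of "real k"] r1 by (intro divide_right_mono) (auto simp: ext_binomial_of_nat)
  finally have 2: "1 - 1 / real m \<le> fact r * ?C / real k ^ r" .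
  have "exp (- real m) \<le> 1" by simp
  then have "0 \<le> 2 - exp (- real m)" by linarith
  then have "(1 - 1 / real m) * (2 - exp (- real m)) \<le> (2 - exp (- real m)) * (fact r * ?C / real k ^ r)"
    by (subst mult.commute) (rule mult_left_mono[OF 2])
  then have "(1 - 1 / real m) * (2 - exp (- real m)) \<le> lim_rel_surplus 1 r k * (1 + 1 / real m)" using 1 by linarith
  then show "(1 - 1 / real m) * (2 - exp (- real m)) / (1 + 1 / real m) \<le> lim_rel_surplus 1 r k"
    using m by (simp add: pos_divide_le_eq add_pos_pos)
qed

text \<open>With \<open>m\<close> the integer part of the square root of \<open>r\<close>, the
  sandwich has a width depending on \<open>r\<close> alone that tends to 0. It applies to all
  multiples of \<open>m\<close> from \<open>m * r * r\<close> on.\<close>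

lemma c_one_part:
  "\<exists>\<epsilon> :: nat \<Rightarrow> real. \<epsilon> \<longlonglongrightarrow> 0 \<and> (\<forall>r\<ge>3. infinite {k :: nat. \<bar>lim_rel_surplus 1 r k - 2\<bar> \<le> \<epsilon> r})"
proof -
  define f where "f m = 2 - (1 - 1 / real m) * (2 - exp (- real m)) / (1 + 1 / real m)" for m :: nat
  define s where "s r = nat \<lfloor>sqrt (real r)\<rfloor>" for r :: nat
  have "f \<longlonglongrightarrow> 2 - (1 - 0) * (2 - 0) / (1 + 0)"
    unfolding f_def
  proof (intro tendsto_intros lim_const_over_n)
    show "(\<lambda>m. exp (- real m)) \<longlonglongrightarrow> 0"
      by (intro filterlim_compose[OF exp_at_bot] filterlim_compose[OF filterlim_uminus_at_bot_at_top] filterlim_real_sequentially)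
  qed simp
  then have f: "f \<longlonglongrightarrow> 0" by simp
  have s: "filterlim s at_top sequentially"
    unfolding filterlim_at_top eventually_sequentially
  proof (intro allI exI impI)
    fix Z n :: nat assume "Z * Z \<le> n"
    then have "real Z * real Z \<le> real n" by (metis of_nat_le_iff of_nat_mult)
    then have "real Z \<le> sqrt (real n)" by (intro real_le_rsqrt) (simp add: power2_eq_square)
    then show "Z \<le> s n" unfolding s_def by (rule le_nat_floor)
  qed
  have "(\<lambda>r. f (s r)) \<longlonglongrightarrow> 0" by (rule filterlim_compose[OF f s])
  moreover have "infinite {k :: nat. \<bar>lim_rel_surplus 1 r k - 2\<bar> \<le> f (s r)}" if r: "r \<ge> 3" for r
  proof -
    define m where "m = s r"
    have sq: "real m \<le> sqrt (real r)" unfolding m_def s_def by simp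
    have "1 \<le> m" unfolding m_def s_def using r by (intro le_nat_floor) simp
    have "real m * real m \<le> sqrt (real r) * sqrt (real r)" using sq by (intro mult_mono) auto
    then have "real (m * m) \<le> real r" by simp
    then have mm: "m * m \<le> r" by linarith
    have "(\<lambda>q. m * q) ` {r\<^sup>2..} \<subseteq> {k. \<bar>lim_rel_surplus 1 r k - 2\<bar> \<le> f m}"
    proof (rule image_subsetI)
      fix q assume q: "q \<in> {r\<^sup>2..}"
      have "q \<ge> 1" using q r by (metis atLeast_iff le_trans one_le_numeral one_le_power)
      moreover have "m * r\<^sup>2 \<le> m * q" using q by simp
      ultimately show "m * q \<in> {k. \<bar>lim_rel_surplus 1 r k - 2\<bar> \<le> f m}"
        using c_one_sandwich[of r m q "m * q"] r mm \<open>1 \<le> m\<close> unfolding f_def by auto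
    qed
    moreover have "infinite ((\<lambda>q. m * q) ` {r\<^sup>2..})"
      using \<open>1 \<le> m\<close> infinite_Ici by (subst finite_image_iff) (auto simp: inj_on_def)
    ultimately show ?thesis unfolding m_def using infinite_super by blast
  qed
  ultimately show ?thesis by blast
qed

text \<open>The doubling construction is run with the selection sizes \<open>k / 2^i\<close> rounded
  up, which suffice to collect \<open>k\<close> vertices at every level. The two bounds on
  \<open>L\<close> thus differ by this rounding and by the slack in \<open>\<beta>\<close>.\<close>

lemma lim_rel_surplus_bounds:
  fixes c \<beta> :: real
  assumes c: "c \<ge> 0" and d: "d = nat \<lfloor>c * real k\<rfloor>" and up: "upper k r d N \<beta>"
    and room: "(\<Sum>i<N. nat \<lceil>real k / 2 ^ Suc i\<rceil>) \<le> d"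
  obtains L where "lim_rel_surplus c r k = fact r / real k ^ (r - 1) * L" "L \<le> \<beta>"
    "real (d choose r) + real (k choose r) - (\<Sum>i<N. real (nat \<lceil>real k / 2 ^ i\<rceil> choose r)) / 2 \<le> L * real d"
proof -
  interpret U: upper k r d N \<beta> by (rule up)
  have bounds: "r \<ge> 2" "k \<ge> 1" "d \<ge> 1" "r \<ge> 1" using U.r U.rk U.kd by auto
  interpret family c k r d \<beta>
    by unfold_locales (use c d bounds U.sur_le in auto)
  obtain L where L: "lim_rel_surplus c r k = fact r / real k ^ (r - 1) * L" "L \<le> \<beta>"
    "\<And>(H :: nat hypergraph) S. small_conn d k r H \<Longrightarrow> S \<subseteq> verts H \<Longrightarrow> card S = k \<Longrightarrow> card (verts H) > k \<Longrightarrow>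
       sur r k H + real (card (missing r H \<inter> nsets S r)) \<le> L * (real (card (verts H)) - real k)"
    using lim_rel_surplus_eq by blast
  define q where "q i = nat \<lceil>real k / 2 ^ i\<rceil>" for i
  have q0: "q 0 = k" by (simp add: q_def)
  have cover: "k \<le> 2 ^ j * q j" for j
  proof -
    have "real k / 2 ^ j \<le> real (q j)" unfolding q_def by linarith
    then have "real k \<le> real (2 ^ j * q j)" by (simp add: field_simps)
    then show ?thesis by linarith
  qed
  have qN: "q N < r"
  proof -
    have "real k / 2 ^ N \<le> real_of_int (int r - 1)" using U.N by (simp add: field_simps)
    then have "\<lceil>real k / 2 ^ N\<rceil> \<le> int r - 1" by (simp only: ceiling_le_iff)
    then show ?thesis unfolding q_def using bounds by linarith
  qed
  obtain H :: "nat hypergraph" and S where H: "small_conn d k r H" "S \<subseteq> verts H" "card S = k" "card (verts H) = k + 2 ^ N * d"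
    "2 ^ N * (real (d choose r) + real (k choose r) - (\<Sum>i<N. real (q i choose r)) / 2)
       \<le> sur r k H + real (card (missing r H \<inter> nsets S r))"
    using doubling_lower_bound[of q k N d r, OF q0 cover _ qN bounds(4)] room unfolding q_def by blast
  have "2 ^ N * (real (d choose r) + real (k choose r) - (\<Sum>i<N. real (q i choose r)) / 2) \<le> L * (2 ^ N * real d)"
    by (rule order_trans[OF H(5)]) (use L(3)[OF H(1-3)] H(4) bounds in simp)
  also have "\<dots> = 2 ^ N * (L * real d)" by simp
  finally have "real (d choose r) + real (k choose r) - (\<Sum>i<N. real (q i choose r)) / 2 \<le> L * real d"
    by simp
  then show thesis using that L unfolding q_def by blast
qed

lemma threshold_power:
  assumes r: "r \<ge> 3" and c: "c \<ge> (2 * real r) powr (1 / (real r - 1))"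
  shows "c \<ge> 1" "c ^ (r - 1) \<ge> 2 * real r"
proof -
  let ?t = "(2 * real r) powr (1 / (real r - 1))"
  have t: "?t \<ge> 1" using r by (intro ge_one_powr_ge_zero) auto
  then show "c \<ge> 1" using c by simp
  have "?t ^ (r - 1) = ?t powr real (r - 1)" using r by (intro powr_realpow[symmetric]) auto
  also have "\<dots> = 2 * real r" using r by (simp add: powr_powr of_nat_diff)
  finally have "?t ^ (r - 1) = 2 * real r" .
  then show "c ^ (r - 1) \<ge> 2 * real r" using power_mono[OF c, of "r - 1"] t by simp
qed

text \<open>For \<open>k = 2^s * r\<close> the numbers \<open>k / 2^i\<close> with
  \<open>i \<le> s\<close> are integers, so the selections are perfectly even and rounding costs
  nothing. Beyond \<open>s\<close> all terms vanish, and the two bounds coincide.\<close>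

lemma exact_value:
  assumes r: "r \<ge> 3" and c: "c \<ge> (2 * real r) powr (1 / (real r - 1))" and s: "s \<ge> 1"
    and k: "k = 2 ^ s * r" and ck: "c * real k \<in> \<nat>"
  shows "lim_rel_surplus c r k = fact r / (c * real k ^ r) *
      (ext_binomial (c * real k) r + ext_binomial (real k) r - 1 / 2 * (\<Sum>i::nat. ext_binomial (real k / 2 ^ i) r))"
proof -
  have c1: "c \<ge> 1" and cr: "c ^ (r - 1) \<ge> 2 * real r" using threshold_power[OF r c] by auto
  obtain d where d: "c * real k = real d" using ck by (auto simp: Nats_def)
  have d': "d = nat \<lfloor>c * real k\<rfloor>" unfolding d by simp
  have r1: "r \<ge> 1" using r by simp
  have rk: "r \<le> k" unfolding k by simp
  have k0: "real k > 0" using rk r by simp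
  have "1 * real k \<le> c * real k" using c1 by (intro mult_right_mono) auto
  then have kd: "k \<le> d" unfolding d by simp
  have d0: "real d > 0" using kd k0 by simp
  \<comment> \<open>The first level with no contribution: \<open>k / 2^N = r / 2\<close>, which is
    at most \<open>r - 1\<close>.\<close>
  define N where "N = Suc s"
  define \<gamma> where "\<gamma> = psi N k r 1"
  have \<gamma>: "\<gamma> = real (k choose r) - (\<Sum>i<N. ext_binomial (real k / 2 ^ i) r) / 2"
    by (simp add: \<gamma>_def psi_def)
  have half: "real r / 2 \<le> real r - 1" using r by simp
  have kN: "real k \<le> (real r - 1) * 2 ^ N"
  proof -
    have "real k = real r / 2 * 2 ^ N" by (simp add: k N_def)
    also have "\<dots> \<le> (real r - 1) * 2 ^ N" using half by (intro mult_right_mono) auto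
    finally show ?thesis .
  qed
  \<comment> \<open>Here the threshold enters: \<open>k * K = r * (k choose r)\<close> for
    \<open>K = (k - 1) choose (r - 1)\<close>, and \<open>d choose r\<close> is at least
    \<open>c^r * (k choose r)\<close>, hence at least
    \<open>2 * r * c * (k choose r)\<close>.\<close>
  have "2 * real ((k - 1) choose (r - 1)) \<le> real (d choose r) / real d"
  proof -
    have K: "real k * real ((k - 1) choose (r - 1)) = real r * real (k choose r)"
      using times_binomial_minus1_eq[of r k] r1 by (metis of_nat_mult less_le_trans zero_less_one)
    have "c ^ r * real (k choose r) \<le> real (d choose r)"
    proof -
      have "real (k choose r) * real d ^ r \<le> real k ^ r * real (d choose r)" by (rule binomial_power_ratio[OF kd])
      then have "(real k ^ r) * (c ^ r * real (k choose r)) \<le> real k ^ r * real (d choose r)"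
        unfolding d[symmetric] by (simp add: power_mult_distrib mult_ac)
      then show ?thesis using k0 by simp
    qed
    moreover have "c * (2 * real r) * real (k choose r) \<le> c ^ r * real (k choose r)"
    proof (rule mult_right_mono)
      have "c ^ r = c * c ^ (r - 1)" using r1 by (cases r) auto
      then show "c * (2 * real r) \<le> c ^ r" using cr c1 by simp
    qed simp
    ultimately have "c * 2 * (real k * real ((k - 1) choose (r - 1))) \<le> real (d choose r)" unfolding K by (simp add: mult_ac)
    then have "2 * real ((k - 1) choose (r - 1)) * real d \<le> real (d choose r)" unfolding d[symmetric] by (simp add: mult_ac)
    then show ?thesis using d0 by (simp add: pos_le_divide_eq)
  qed
  then have up: "upper k r d N ((real (d choose r) + \<gamma>) / real d)"
  proof unfold_locales
    show "(real (d choose r) + \<gamma>) / real d * real d \<ge> real (d choose r) + psi N k r 1"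
      using d0 by (simp add: \<gamma>_def)
  qed (use r rk kd kN d0 in \<open>auto simp: \<gamma>_def add_divide_distrib\<close>)
  have q: "real k / 2 ^ i = real (2 ^ (s - i) * r)" if "i \<le> s" for i
  proof -
    have "(2::real) ^ s = 2 ^ (s - i) * 2 ^ i" using that by (simp flip: power_add)
    then show ?thesis by (simp add: k)
  qed
  \<comment> \<open>The selections of levels 1 to \<open>s\<close> sum to
    \<open>(2^s - 1) * r\<close>, and the last one needs at most \<open>r\<close> more, in total
    \<open>k \<le> d\<close>.\<close>
  have room: "(\<Sum>i<N. nat \<lceil>real k / 2 ^ Suc i\<rceil>) \<le> d"
  proof -
    have "(\<Sum>i<N. nat \<lceil>real k / 2 ^ Suc i\<rceil>) = (\<Sum>i<s. nat \<lceil>real k / 2 ^ Suc i\<rceil>) + nat \<lceil>real k / 2 ^ Suc s\<rceil>"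
      by (simp add: N_def)
    also have "(\<Sum>i<s. nat \<lceil>real k / 2 ^ Suc i\<rceil>) = (\<Sum>i<s. 2 ^ (s - Suc i) * r)"
    proof (intro sum.cong refl)
      fix i assume "i \<in> {..<s}"
      then have "Suc i \<le> s" by simp
      show "nat \<lceil>real k / 2 ^ Suc i\<rceil> = 2 ^ (s - Suc i) * r"
        unfolding q[OF \<open>Suc i \<le> s\<close>] ceiling_of_nat nat_int ..
    qed
    also have "\<dots> = (2 ^ s - 1) * r"
    proof -
      have "(\<Sum>i<s. (2::nat) ^ (s - Suc i)) = 2 ^ s - 1"
        using sum.nat_diff_reindex[of "\<lambda>i. (2::nat) ^ i" s] sum_power2[of s] by (simp add: lessThan_atLeast0)
      then show ?thesis by (simp add: sum_distrib_right[symmetric])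
    qed
    also have "nat \<lceil>real k / 2 ^ Suc s\<rceil> \<le> r"
    proof -
      have "real k / 2 ^ Suc s = real r / 2" by (simp add: k)
      also have "\<dots> \<le> real_of_int (int r)" by simp
      finally show ?thesis by (simp only: nat_le_iff ceiling_le_iff)
    qed
    also have "(2 ^ s - 1) * r + r = k" by (simp add: k diff_mult_distrib)
    finally show ?thesis using kd by simp
  qed
  obtain L where L: "lim_rel_surplus c r k = fact r / real k ^ (r - 1) * L" "L \<le> (real (d choose r) + \<gamma>) / real d"
    "real (d choose r) + real (k choose r) - (\<Sum>i<N. real (nat \<lceil>real k / 2 ^ i\<rceil> choose r)) / 2 \<le> L * real d"
    using lim_rel_surplus_bounds[OF _ d' up room] c1 by auto
  have "(\<Sum>i<N. real (nat \<lceil>real k / 2 ^ i\<rceil> choose r)) = (\<Sum>i<N. ext_binomial (real k / 2 ^ i) r)"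
  proof (intro sum.cong refl)
    fix i assume "i \<in> {..<N}"
    then have "i \<le> s" by (simp add: N_def)
    show "real (nat \<lceil>real k / 2 ^ i\<rceil> choose r) = ext_binomial (real k / 2 ^ i) r"
      unfolding q[OF \<open>i \<le> s\<close>] ceiling_of_nat nat_int ext_binomial_of_nat[OF r1] ..
  qed
  then have "real (d choose r) + \<gamma> \<le> L * real d" using L(3) unfolding \<gamma> by linarith
  then have Leq: "L = (real (d choose r) + \<gamma>) / real d" using L(2) d0 by (intro antisym) (simp_all add: pos_divide_le_eq)
  have "(\<Sum>i::nat. ext_binomial (real k / 2 ^ i) r) = (\<Sum>i<N. ext_binomial (real k / 2 ^ i) r)"
  proof (rule suminf_finite)
    fix i assume "i \<notin> {..<N}"
    then have "N \<le> i" by simp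
    then have "real k / 2 ^ i \<le> real k / 2 ^ N" by (intro divide_left_mono power_increasing) auto
    also have "\<dots> \<le> real r - 1" using kN by (simp add: field_simps)
    finally show "ext_binomial (real k / 2 ^ i) r = 0" by (rule ext_binomial_eq_0[OF r1])
  qed simp
  moreover have "real k ^ r = real k ^ (r - 1) * real k" using r1 by (cases r) auto
  ultimately show ?thesis
    unfolding L(1) Leq d ext_binomial_of_nat[OF r1] \<gamma> unfolding d[symmetric] by (simp add: mult_ac)
qed

section \<open>Asymptotics for large k\<close>

lemma geometric_half_le: "(\<Sum>i<N. (1/2::real) ^ i) \<le> 2"
  by (simp add: geometric_sum)

lemma scaled_ceiling_sum_le:
  assumes r: "r \<ge> 2"
  shows "fact r * (\<Sum>i<N. real (nat \<lceil>real k / 2 ^ i\<rceil> choose r)) \<le> real k ^ r * (\<Sum>i<N. ((1/2) ^ r) ^ i) + 2 * real k ^ (r - 1)"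
proof -
  have term_le: "fact r * real (nat \<lceil>real k / 2 ^ i\<rceil> choose r) \<le> real k ^ r * ((1/2) ^ r) ^ i + real k ^ (r - 1) * (1/2) ^ i" for i
  proof -
    have "fact r * real (nat \<lceil>real k / 2 ^ i\<rceil> choose r) \<le> (real k / 2 ^ i) ^ r + (real k / 2 ^ i) ^ (r - 1)"
      using r by (intro fact_binomial_ceiling_le) auto
    also have "(real k / 2 ^ i) ^ r = real k ^ r * ((1/2) ^ r) ^ i"
      by (simp add: power_divide power_mult[symmetric] mult.commute)
    also have "(real k / 2 ^ i) ^ (r - 1) = real k ^ (r - 1) * ((1/2) ^ i) ^ (r - 1)" by (simp add: power_divide)
    also have "\<dots> \<le> real k ^ (r - 1) * ((1/2) ^ i) ^ 1"
      using r by (intro mult_left_mono power_decreasing) (auto simp: power_le_one)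
    finally show ?thesis by simp
  qed
  have "fact r * (\<Sum>i<N. real (nat \<lceil>real k / 2 ^ i\<rceil> choose r)) \<le> (\<Sum>i<N. real k ^ r * ((1/2) ^ r) ^ i + real k ^ (r - 1) * (1/2) ^ i)"
    unfolding sum_distrib_left by (intro sum_mono term_le)
  also have "\<dots> = real k ^ r * (\<Sum>i<N. ((1/2) ^ r) ^ i) + real k ^ (r - 1) * (\<Sum>i<N. (1/2) ^ i)"
    by (simp only: sum.distrib sum_distrib_left)
  also have "real k ^ (r - 1) * (\<Sum>i<N. (1/2) ^ i) \<le> real k ^ (r - 1) * 2"
    by (intro mult_left_mono geometric_half_le) auto
  finally show ?thesis by simp
qed

lemma scaled_ext_sum_ge:
  assumes r: "r \<ge> 2"
  shows "real k ^ r * (\<Sum>i<N. ((1/2) ^ r) ^ i) - 2 * (real r)\<^sup>2 * real k ^ (r - 1) \<le> fact r * (\<Sum>i<N. ext_binomial (real k / 2 ^ i) r)"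
proof -
  have term_le: "real k ^ r * ((1/2) ^ r) ^ i - (real r)\<^sup>2 * real k ^ (r - 1) * (1/2) ^ i \<le> fact r * ext_binomial (real k / 2 ^ i) r" for i
  proof -
    have "(real k / 2 ^ i) ^ r - (real r)\<^sup>2 * (real k / 2 ^ i) ^ (r - 1) \<le> fact r * ext_binomial (real k / 2 ^ i) r"
      using r by (intro fact_ext_binomial_ge) auto
    moreover have "(real k / 2 ^ i) ^ r = real k ^ r * ((1/2) ^ r) ^ i"
      by (simp add: power_divide power_mult[symmetric] mult.commute)
    moreover have "(real r)\<^sup>2 * (real k / 2 ^ i) ^ (r - 1) \<le> (real r)\<^sup>2 * real k ^ (r - 1) * (1/2) ^ i"
    proof -
      have "(real k / 2 ^ i) ^ (r - 1) = real k ^ (r - 1) * ((1/2) ^ i) ^ (r - 1)" by (simp add: power_divide)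
      also have "\<dots> \<le> real k ^ (r - 1) * ((1/2) ^ i) ^ 1"
        using r by (intro mult_left_mono power_decreasing) (auto simp: power_le_one)
      finally have "(real k / 2 ^ i) ^ (r - 1) \<le> real k ^ (r - 1) * (1/2) ^ i" by simp
      then have "(real r)\<^sup>2 * (real k / 2 ^ i) ^ (r - 1) \<le> (real r)\<^sup>2 * (real k ^ (r - 1) * (1/2) ^ i)"
        by (rule mult_left_mono) simp
      then show ?thesis by (simp only: mult.assoc)
    qed
    ultimately show ?thesis by linarith
  qed
  have "(real r)\<^sup>2 * real k ^ (r - 1) * (\<Sum>i<N. (1/2) ^ i) \<le> (real r)\<^sup>2 * real k ^ (r - 1) * 2"
    by (intro mult_left_mono geometric_half_le) auto
  moreover have "(\<Sum>i<N. real k ^ r * ((1/2) ^ r) ^ i - (real r)\<^sup>2 * real k ^ (r - 1) * (1/2) ^ i) =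
     real k ^ r * (\<Sum>i<N. ((1/2) ^ r) ^ i) - (real r)\<^sup>2 * real k ^ (r - 1) * (\<Sum>i<N. (1/2) ^ i)"
    by (simp only: sum_subtractf sum_distrib_left)
  moreover have "(\<Sum>i<N. real k ^ r * ((1/2) ^ r) ^ i - (real r)\<^sup>2 * real k ^ (r - 1) * (1/2) ^ i)
     \<le> fact r * (\<Sum>i<N. ext_binomial (real k / 2 ^ i) r)"
    unfolding sum_distrib_left by (intro sum_mono term_le)
  ultimately show ?thesis by linarith
qed

text \<open>Both bounds on the limit are expanded to first order. In the constant,
  \<open>r * r\<close> occurs twice because falling products are replaced by powers both for the
  leaf and for the gains, while \<open>r\<close> comes from rounding \<open>ck\<close> down to
  \<open>d\<close>. The condition \<open>big\<close> makes room for the rounded selections: each of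
  about \<open>log 2 k\<close> levels may waste one vertex.\<close>

lemma asymptotic_value:
  assumes r: "r \<ge> 3" and c1: "c \<ge> 1" and cr: "c ^ (r - 1) \<ge> 2 * real r" and rk: "r \<le> k"
    and big: "log 2 (real k) + 2 \<le> (c - 1) * real k"
  shows "\<bar>lim_rel_surplus c r k - (c ^ (r - 1) + 1 / (2 * c) * (1 - 1 / (2 ^ r - 1)))\<bar>
     \<le> (2 * (real r)\<^sup>2 + real r + 3) * c ^ (r - 2) / real k"
proof -
  define d where "d = nat \<lfloor>c * real k\<rfloor>"
  define N where "N = nat \<lceil>log 2 (real k)\<rceil>"
  define P where "P = real k ^ (r - 1)"
  define R where "R = (real r)\<^sup>2"
  define F where "F = (fact r :: real)"
  define D where "D = real (d choose r)"
  define \<gamma> where "\<gamma> = psi N k r 1"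
  define W where "W = real (k choose r) - (\<Sum>i<N. real (nat \<lceil>real k / 2 ^ i\<rceil> choose r)) / 2"
  have k3: "real k \<ge> 3" using r rk by simp
  have r1: "r \<ge> 1" "r \<ge> 2" using r by auto
  have P0: "P > 0" and F0: "F > 0" using k3 by (auto simp: P_def F_def)
  have kr: "real k ^ r = P * real k" unfolding P_def using r1 by (cases r) auto
  have log0: "0 \<le> log 2 (real k)" using k3 by simp
  have dle: "real d \<le> c * real k" unfolding d_def using c1 by simp
  have dgt: "real d > c * real k - 1" unfolding d_def using c1 by linarith
  have ck: "real k + log 2 (real k) + 2 \<le> c * real k" using big by (simp add: algebra_simps)
  have kd': "real k \<le> real d" using ck log0 dgt by linarith
  then have kd: "k \<le> d" by simp
  have d0: "real d > 0" using kd' k3 by linarith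
  have N1: "log 2 (real k) \<le> real N" "real N \<le> log 2 (real k) + 1" unfolding N_def using log0 by linarith+
  have "real k = 2 powr (log 2 (real k))" using k3 by simp
  also have "\<dots> \<le> 2 powr real N" using N1 by (intro powr_mono) auto
  finally have k2N: "real k \<le> 2 ^ N" by (simp add: powr_realpow)
  have kN: "real k \<le> (real r - 1) * 2 ^ N"
  proof -
    have "1 * 2 ^ N \<le> (real r - 1) * 2 ^ N" using r by (intro mult_right_mono) auto
    then show ?thesis using k2N by linarith
  qed
  have room: "(\<Sum>i<N. nat \<lceil>real k / 2 ^ Suc i\<rceil>) \<le> d"
  proof -
    have "real (\<Sum>i<N. nat \<lceil>real k / 2 ^ Suc i\<rceil>) \<le> (\<Sum>i<N. real k / 2 * (1/2) ^ i + 1)"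
      unfolding of_nat_sum
    proof (intro sum_mono)
      fix i
      have "0 \<le> real k / 2 ^ Suc i" by simp
      then have h: "real (nat \<lceil>real k / 2 ^ Suc i\<rceil>) \<le> real k / 2 ^ Suc i + 1" by linarith
      have e: "real k / 2 ^ Suc i = real k / 2 * (1/2) ^ i" by (simp add: power_divide)
      show "real (nat \<lceil>real k / 2 ^ Suc i\<rceil>) \<le> real k / 2 * (1/2) ^ i + 1" using h by (simp only: e)
    qed
    also have "\<dots> = real k / 2 * (\<Sum>i<N. (1/2) ^ i) + real N" by (simp add: sum.distrib sum_distrib_left)
    also have "real k / 2 * (\<Sum>i<N. (1/2) ^ i) \<le> real k / 2 * 2" by (intro mult_left_mono geometric_half_le) auto
    finally have "real (\<Sum>i<N. nat \<lceil>real k / 2 ^ Suc i\<rceil>) \<le> real d" using ck dgt N1 by linarith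
    then show ?thesis by (simp only: of_nat_le_iff)
  qed
  define x where "x = (1/2::real) ^ r"
  have x: "0 < x" "x \<le> 1/2"
    unfolding x_def using power_decreasing[of 1 r "1/2::real"] r1 by auto
  \<comment> \<open>\<open>G\<close> is the full geometric series over \<open>2^(-r*i)\<close>, and
    \<open>g = 1 - G / 2\<close> is the limiting gain per leaf in units of
    \<open>k^r / r!\<close>.\<close>
  define G where "G = 1 / (1 - x)"
  have G: "1 \<le> G" "G \<le> 2" unfolding G_def using x by (auto simp: field_simps)
  define g where "g = 1 - G / 2"
  have g: "0 \<le> g" "g \<le> 1" using G by (auto simp: g_def)
  define S where "S = (\<Sum>i<N. x ^ i)"
  have SG: "S = G - x ^ N * G" unfolding S_def G_def using x by (simp add: sum_gp_strict diff_divide_distrib)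
  have "x ^ N \<le> (1/2) ^ N" using x by (intro power_mono) auto
  also have "\<dots> \<le> 1 / real k" using k2N k3 by (simp add: power_divide frac_le)
  finally have "x ^ N * G \<le> 1 / real k * 2" using G x by (intro mult_mono) auto
  then have "real k * (x ^ N * G) \<le> 2" using k3 by (simp add: field_simps)
  moreover have "0 \<le> real k * (x ^ N * G)" using x G by auto
  ultimately have S: "real k * G - 2 \<le> real k * S" "real k * S \<le> real k * G"
    unfolding SG by (auto simp: algebra_simps)
  have \<gamma>up: "F * \<gamma> \<le> P * (real k * g + 1 + R)"
  proof -
    have "real k ^ r * S - 2 * R * P \<le> F * (\<Sum>i<N. ext_binomial (real k / 2 ^ i) r)"
      using scaled_ext_sum_ge[OF r1(2), of k N] unfolding S_def x_def R_def P_def F_def .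
    moreover have "P * (real k * G - 2) \<le> P * (real k * S)" by (rule mult_left_mono[OF S(1)]) (use P0 in simp)
    moreover have "F * real (k choose r) \<le> P * real k" using fact_binomial_le_power[of r k] unfolding F_def kr .
    moreover have "F * \<gamma> = F * real (k choose r) - F * (\<Sum>i<N. ext_binomial (real k / 2 ^ i) r) / 2"
      by (simp add: \<gamma>_def psi_def algebra_simps)
    moreover have "P * (real k * g + 1 + R) = P * real k - P * (real k * G - 2) / 2 + R * P"
      by (simp add: g_def field_simps)
    moreover have "P * (real k * S) = P * real k * S" by simp
    ultimately show ?thesis unfolding kr by linarith
  qed
  have Wlow: "P * (real k * g - 1 - R) \<le> F * W"
  proof -
    have "F * (\<Sum>i<N. real (nat \<lceil>real k / 2 ^ i\<rceil> choose r)) \<le> P * real k * S + 2 * P"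
      using scaled_ceiling_sum_le[OF r1(2), of k N] unfolding S_def x_def P_def[symmetric] F_def kr .
    moreover have "P * (real k * S) \<le> P * (real k * G)" by (rule mult_left_mono[OF S(2)]) (use P0 in simp)
    moreover have "P * real k - R * P \<le> F * real (k choose r)"
      using fact_ext_binomial_ge[OF r1(1), of "real k"]
      unfolding ext_binomial_of_nat[OF r1(1)] F_def R_def kr P_def[symmetric] by simp
    moreover have "F * W = F * real (k choose r) - F * (\<Sum>i<N. real (nat \<lceil>real k / 2 ^ i\<rceil> choose r)) / 2"
      by (simp add: W_def algebra_simps)
    moreover have "P * (real k * g - 1 - R) = P * real k - P * (real k * G) / 2 - P - R * P"
      by (simp add: g_def field_simps)
    moreover have "P * (real k * S) = P * real k * S" by simp
    ultimately show ?thesis by linarith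
  qed
  \<comment> \<open>The term \<open>D / d\<close> is raised to its bound
    \<open>c^(r-1) * P / F\<close>. In this form \<open>b2\<close> follows at once from
    \<open>c^(r-1) \<ge> 2 * r\<close>, whereas \<open>d\<close> itself may be slightly smaller than
    \<open>ck\<close>.\<close>
  define \<beta> where "\<beta> = c ^ (r - 1) * P / F + \<gamma> / real d"
  have up: "upper k r d N \<beta>"
  proof unfold_locales
    show "r \<ge> 3" "r \<le> k" "k \<le> d" "real k \<le> (real r - 1) * 2 ^ N" by fact+
    have "F * D \<le> real d ^ r" unfolding F_def D_def by (rule fact_binomial_le_power)
    also have "\<dots> = real d ^ (r - 1) * real d" using r1 by (cases r) auto
    also have "\<dots> \<le> (c * real k) ^ (r - 1) * real d" using dle by (intro mult_right_mono power_mono) auto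
    also have "\<dots> = c ^ (r - 1) * P * real d" by (simp add: P_def power_mult_distrib)
    finally have "D \<le> c ^ (r - 1) * P / F * real d" using F0 by (simp add: field_simps)
    then show "real (d choose r) + psi N k r 1 \<le> \<beta> * real d"
      using d0 unfolding \<beta>_def \<gamma>_def[symmetric] D_def[symmetric] by (simp add: distrib_right)
    have "F = real r * fact (r - 1)" unfolding F_def using r1 by (cases r) auto
    then have "F * (2 * real ((k - 1) choose (r - 1))) = 2 * real r * (fact (r - 1) * real ((k - 1) choose (r - 1)))"
      by simp
    also have "\<dots> \<le> 2 * real r * real (k - 1) ^ (r - 1)" by (intro mult_left_mono fact_binomial_le_power) auto
    also have "\<dots> \<le> c ^ (r - 1) * P" unfolding P_def using cr by (intro mult_mono power_mono) auto
    finally have "2 * real ((k - 1) choose (r - 1)) \<le> c ^ (r - 1) * P / F" using F0 by (simp add: field_simps)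
    then show "2 * real ((k - 1) choose (r - 1)) + psi N k r 1 / real d \<le> \<beta>" unfolding \<beta>_def \<gamma>_def by simp
  qed
  have c0: "c \<ge> 0" using c1 by simp
  obtain L where L: "lim_rel_surplus c r k = F / P * L" "L \<le> \<beta>"
    "D + real (k choose r) - (\<Sum>i<N. real (nat \<lceil>real k / 2 ^ i\<rceil> choose r)) / 2 \<le> L * real d"
    unfolding F_def P_def D_def by (rule lim_rel_surplus_bounds[OF c0 d_def up room])
  have LW: "D + W \<le> L * real d" using L(3) unfolding W_def by linarith
  have kdc: "real k / real d \<le> 1 / c + 1 / real k" "1 / c \<le> real k / real d"
  proof -
    have "c * real k \<le> real d + 1" using dgt by simp
    then have "c * real k * real k \<le> (real d + 1) * real k" by (intro mult_right_mono) auto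
    also have "\<dots> \<le> real d * real k + real d * c"
    proof -
      have "1 * real k \<le> c * real d" using c1 kd' by (intro mult_mono) auto
      then show ?thesis by (simp add: algebra_simps)
    qed
    finally show "real k / real d \<le> 1 / c + 1 / real k" using d0 k3 c1 by (simp add: field_simps)
    show "1 / c \<le> real k / real d" using dle d0 c1 by (simp add: field_simps)
  qed
  have cpow: "1 \<le> c ^ (r - 2)" using c1 by simp
  have small: "(1 + R) / real d \<le> (1 + R) / real k" using kd' k3 by (intro divide_left_mono) (auto simp: R_def)
  have target: "1 / (2 * c) * (1 - 1 / (2 ^ r - 1)) = g / c"
  proof -
    have y: "(2::real) ^ r \<noteq> 1" using r1 power_increasing[of 1 r "2::real"] by auto
    have "g = (1 - 1 / (2 ^ r - 1)) / 2" unfolding g_def G_def x_def using y by (simp add: power_divide field_simps)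
    then have "1 - 1 / (2 ^ r - 1) = 2 * g" by (simp add: field_simps)
    then show ?thesis by (simp only:) simp
  qed
  have upper_bd: "lim_rel_surplus c r k \<le> c ^ (r - 1) + g / c + (2 + R) / real k"
  proof -
    have "lim_rel_surplus c r k \<le> F / P * \<beta>" unfolding L(1) using L(2) F0 P0 by (intro mult_left_mono) auto
    also have "\<dots> = c ^ (r - 1) + F * \<gamma> / (P * real d)" unfolding \<beta>_def using F0 P0 by (simp add: field_simps)
    also have "F * \<gamma> / (P * real d) \<le> P * (real k * g + 1 + R) / (P * real d)"
      using \<gamma>up P0 d0 by (intro divide_right_mono) auto
    also have "\<dots> = g * (real k / real d) + (1 + R) / real d" using P0 by (simp add: add_divide_distrib)
    also have "g * (real k / real d) \<le> g * (1 / c + 1 / real k)" using kdc(1) g by (intro mult_left_mono) auto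
    also have "\<dots> \<le> g / c + 1 / real k"
    proof -
      have "g * (1 / real k) \<le> 1 * (1 / real k)" using g by (intro mult_right_mono) auto
      then show ?thesis by (simp add: distrib_left)
    qed
    finally show ?thesis using small by (simp add: add_divide_distrib)
  qed
  have lower_bd: "c ^ (r - 1) + g / c - (real r + R) * c ^ (r - 2) / real k - (1 + R) / real k \<le> lim_rel_surplus c r k"
  proof -
    have r2: "r - 1 = Suc (r - 2)" "r = Suc (Suc (r - 2))" using r by auto
    have "(D + W) / real d \<le> L" using LW d0 by (simp add: pos_divide_le_eq)
    then have "F / P * ((D + W) / real d) \<le> lim_rel_surplus c r k" unfolding L(1) using F0 P0 by (intro mult_left_mono) auto
    moreover have "F / P * ((D + W) / real d) = F * D / (P * real d) + F * W / (P * real d)"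
      by (simp add: add_divide_distrib distrib_left)
    moreover have "g / c - (1 + R) / real k \<le> F * W / (P * real d)"
    proof -
      have "P * (real k * g - 1 - R) / (P * real d) \<le> F * W / (P * real d)"
        using Wlow P0 d0 by (intro divide_right_mono) auto
      moreover have "P * (real k * g - 1 - R) / (P * real d) = g * (real k / real d) - (1 + R) / real d"
        using P0 by (simp add: diff_divide_distrib add_divide_distrib)
      moreover have "g * (1 / c) \<le> g * (real k / real d)" using kdc(2) g by (intro mult_left_mono) auto
      ultimately show ?thesis using small by simp
    qed
    \<comment> \<open>Two losses: \<open>R\<close> for the falling product of \<open>d\<close>, and
      \<open>r\<close> for passing from \<open>u = d / k\<close> to \<open>c\<close>, which are less
      than \<open>1 / k\<close> apart.\<close>
    moreover have "c ^ (r - 1) - (real r + R) * c ^ (r - 2) / real k \<le> F * D / (P * real d)"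
    proof -
      define u where "u = real d / real k"
      have "(c * real k - real d) / real k \<le> 1 / real k" using dgt by (intro divide_right_mono) auto
      moreover have "c - u = (c * real k - real d) / real k" unfolding u_def using k3 by (simp add: field_simps)
      ultimately have u: "0 \<le> u" "u \<le> c" "c - u \<le> 1 / real k" "real d = u * real k"
        unfolding u_def using dle k3 by (auto simp: field_simps)
      have "real d ^ r - R * real d ^ (r - 1) \<le> F * D"
        using fact_ext_binomial_ge[OF r1(1), of "real d"] r1 unfolding F_def D_def R_def by (simp add: ext_binomial_of_nat)
      then have "(real d ^ r - R * real d ^ (r - 1)) / (P * real d) \<le> F * D / (P * real d)"
        using P0 d0 by (intro divide_right_mono) auto
      moreover have "(real d ^ r - R * real d ^ (r - 1)) / (P * real d) = u ^ (r - 1) - R * u ^ (r - 2) / real k"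
      proof -
        have "real d ^ r = u ^ (r - 1) * P * real d"
          unfolding P_def using u(4) r2 by (metis power_Suc2 power_mult_distrib)
        moreover have "R * real d ^ (r - 1) = R * u ^ (r - 2) / real k * P * real d"
        proof -
          have "P = real k ^ (r - 2) * real k" unfolding P_def using r2 by (metis power_Suc2)
          moreover have "real d ^ (r - 1) = (u * real k) ^ (r - 2) * real d" using r2 u(4) by (metis power_Suc2)
          ultimately show ?thesis using k3 by (simp add: power_mult_distrib)
        qed
        ultimately show ?thesis using P0 d0 by (simp add: field_simps)
      qed
      moreover have "R * u ^ (r - 2) / real k \<le> R * c ^ (r - 2) / real k"
        using u by (intro divide_right_mono mult_left_mono power_mono) (auto simp: R_def)
      moreover have "c ^ (r - 1) - u ^ (r - 1) \<le> real r * c ^ (r - 2) / real k"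
      proof -
        have "c ^ (r - 1) - u ^ (r - 1) \<le> real (r - 1) * c ^ (r - 1 - 1) * (c - u)" by (rule power_diff_le[OF u(1,2)])
        also have "r - 1 - 1 = r - 2" by simp
        also have "real (r - 1) * c ^ (r - 2) * (c - u) \<le> real r * c ^ (r - 2) * (1 / real k)"
          using u c1 by (intro mult_mono) auto
        finally show ?thesis by simp
      qed
      moreover have "(real r + R) * c ^ (r - 2) / real k = real r * c ^ (r - 2) / real k + R * c ^ (r - 2) / real k"
        by (simp add: distrib_right add_divide_distrib)
      ultimately show ?thesis by linarith
    qed
    ultimately show ?thesis by linarith
  qed
  have R0: "0 \<le> R" by (simp add: R_def)
  have e1: "(2 + R) / real k \<le> (2 + R) * c ^ (r - 2) / real k"
    using cpow R0 k3 mult_left_mono[OF cpow, of "2 + R"] by (intro divide_right_mono) auto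
  have e2: "(1 + R) / real k \<le> (1 + R) * c ^ (r - 2) / real k"
    using cpow R0 k3 mult_left_mono[OF cpow, of "1 + R"] by (intro divide_right_mono) auto
  have e3: "(2 * R + real r + 3) * c ^ (r - 2) / real k = (real r + R) * c ^ (r - 2) / real k + (1 + R) * c ^ (r - 2) / real k + 2 * (c ^ (r - 2) / real k)"
    "(2 * R + real r + 3) * c ^ (r - 2) / real k = (2 + R) * c ^ (r - 2) / real k + (R + real r + 1) * (c ^ (r - 2) / real k)"
    by (simp_all add: algebra_simps add_divide_distrib)
  have e4: "0 \<le> c ^ (r - 2) / real k" "0 \<le> (R + real r + 1) * (c ^ (r - 2) / real k)" using cpow R0 by auto
  show ?thesis unfolding target R_def[symmetric]
  proof (rule abs_leI)
    show "lim_rel_surplus c r k - (c ^ (r - 1) + g / c) \<le> (2 * R + real r + 3) * c ^ (r - 2) / real k"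
      using upper_bd e1 e3(2) e4(2) by linarith
    show "- (lim_rel_surplus c r k - (c ^ (r - 1) + g / c)) \<le> (2 * R + real r + 3) * c ^ (r - 2) / real k"
      using lower_bd e2 e3(1) e4(1) by linarith
  qed
qed

text \<open>The threshold \<open>t\<close> exceeds 1, so \<open>(t - 1) * k\<close> eventually
  dominates \<open>log 2 k + 2\<close>. As \<open>c \<ge> t\<close>, one starting point depending
  only on \<open>r\<close> serves all \<open>c\<close>.\<close>

lemma asymptotic_part:
  assumes r: "r \<ge> 3"
  shows "\<exists>(C::real) (K::nat). \<forall>(c::real) (k::nat).
     c \<ge> (2 * real r) powr (1 / (real r - 1)) \<longrightarrow> k \<ge> K \<longrightarrow>
     \<bar>lim_rel_surplus c r k - (c ^ (r - 1) + 1 / (2 * c) * (1 - 1 / (2 ^ r - 1)))\<bar> \<le> C * c ^ (r - 2) / real k"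
proof -
  define t where "t = (2 * real r) powr (1 / (real r - 1))"
  have t: "t > 1" unfolding t_def using r by (intro gr_one_powr) auto
  have "(\<lambda>k. ln (real k) / real k / ln 2 + 2 / real k) \<longlonglongrightarrow> 0 / ln 2 + 0"
    by (intro tendsto_intros lim_ln_over_n lim_const_over_n) auto
  then have "(\<lambda>k. ln (real k) / real k / ln 2 + 2 / real k) \<longlonglongrightarrow> 0" by simp
  then have "\<forall>\<^sub>F k in sequentially. ln (real k) / real k / ln 2 + 2 / real k < t - 1"
    using t by (intro order_tendstoD(2)) auto
  then obtain K0 where K0: "\<And>k. k \<ge> K0 \<Longrightarrow> ln (real k) / real k / ln 2 + 2 / real k < t - 1"
    unfolding eventually_sequentially by blast
  have "\<bar>lim_rel_surplus c r k - (c ^ (r - 1) + 1 / (2 * c) * (1 - 1 / (2 ^ r - 1)))\<bar>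
      \<le> (2 * (real r)\<^sup>2 + real r + 3) * c ^ (r - 2) / real k"
    if c: "c \<ge> t" and k: "k \<ge> max K0 r" for c k
  proof (rule asymptotic_value[OF r])
    show "c \<ge> 1" "c ^ (r - 1) \<ge> 2 * real r" using threshold_power[OF r c[unfolded t_def]] by auto
    show "r \<le> k" using k by simp
    have k0: "real k > 0" using k r by simp
    have "(ln (real k) / real k / ln 2 + 2 / real k) * real k \<le> (t - 1) * real k"
      using K0[of k] k by (intro mult_right_mono) auto
    also have "\<dots> \<le> (c - 1) * real k" using c by (intro mult_right_mono) auto
    finally show "log 2 (real k) + 2 \<le> (c - 1) * real k" using k0 by (simp add: log_def distrib_right)
  qed
  then show ?thesis unfolding t_def by blast
qed

text \<open>The left side depends on \<open>c\<close> only through the integer part of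
  \<open>ck\<close>. The exact formula, written in \<open>ck\<close>, is therefore stated for
  integral \<open>ck\<close>. In the asymptotic formula, \<open>c^(r-1)\<close> varies by the order
  of \<open>c^(r-2) / k\<close> while the integer part is constant; this is the factor
  \<open>c^(r-2)\<close> in an error term that is uniform in \<open>c\<close>.\<close>

theorem theorem1p4:
  "(\<exists>\<epsilon> :: nat \<Rightarrow> real. \<epsilon> \<longlonglongrightarrow> 0 \<and>
      (\<forall>r\<ge>3. infinite {k :: nat. \<bar>lim_rel_surplus 1 r k - 2\<bar> \<le> \<epsilon> r})) \<and>
   (\<forall>r::nat. r \<ge> 3 \<longrightarrow>
      (\<forall>(c::real) (s::nat) (k::nat).
         c \<ge> (2 * real r) powr (1 / (real r - 1)) \<longrightarrow> s \<ge> 1 \<longrightarrow> k = 2 ^ s * r \<longrightarrow>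
         c * real k \<in> \<nat> \<longrightarrow>
         lim_rel_surplus c r k =
           fact r / (c * real k ^ r) *
             (ext_binomial (c * real k) r + ext_binomial (real k) r
                - 1 / 2 * (\<Sum>i::nat. ext_binomial (real k / 2 ^ i) r))) \<and>
      (\<exists>(C::real) (K::nat). \<forall>(c::real) (k::nat).
         c \<ge> (2 * real r) powr (1 / (real r - 1)) \<longrightarrow> k \<ge> K \<longrightarrow>
         \<bar>lim_rel_surplus c r k
            - (c ^ (r - 1) + 1 / (2 * c) * (1 - 1 / (2 ^ r - 1)))\<bar>
           \<le> C * c ^ (r - 2) / real k))"
  using c_one_part exact_value asymptotic_part by blast

end
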